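(* Let $m\ge 2$ be even, $d\ge 1$, let $R=\sum_{i=0}^d a_ix^{2^i}\in\mathbf{F}_{2^m}[x]$ with $a_d\neq 0$, and set $f(x)=xR(x)$. Let $\widetilde R=\sum_{i=0}^d\left(a_i^{2^d}x^{2^{d+i}}+a_i^{2^{d-i}}x^{2^{d-i}}\right)$, and let $\mathbf{F}_{2^{mN}}$ be the splitting field of $\widetilde R$ over $\mathbf{F}_{2^m}$. The invariants $\varepsilon_n(f)$, $n\ge1$, satisfy: (i) if $\varepsilon_N(f)=-1$, then $\varepsilon_n(f)=\varepsilon_{\gcd(n,N)}(f)$ for all $n\ge 1$; (ii) if $\varepsilon_N(f)=1$, then for all $n\ge1$: $\varepsilon_n(f)=0$ when $v_2(n)\le v_2(N)-1$; $\varepsilon_n(f)=\varepsilon_{\gcd(n,N)}(f)$ when $v_2(n)=v_2(N)$; and $\varepsilon_n(f)=-\varepsilon_{\gcd(n,N)}(f)$ when $v_2(n)\ge v_2(N)+1$; (iii) if $\varepsilon_N(f)=0$, then: (iiia) if $\varepsilon_{2N}(f)=-1$, then $\varepsilon_n(f)=\varepsilon_{\gcd(n,2N)}(f)$ for all $n\ge1$; (iiib) if $\varepsilon_{2N}(f)=1$, then for all $n\ge 1$: $\varepsilon_n(f)=0$ when $v_2(n)\le v_2(N)$; $\varepsilon_n(f)=\varepsilon_{\gcd(n,2N)}(f)$ when $v_2(n)=v_2(N)+1$; and $\varepsilon_n(f)=-\varepsilon_{\gcd(n,2N)}(f)$ when $v_2(n)\ge v_2(N)+2$.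
   Context: For a quadratic form $q$ on a $k$-dimensional $\mathbf{F}_2$-vector space $V$, with polarisation $b(x,y)=q(x+y)+q(x)+q(y)$ whose radical has dimension $c$ (set $r=k-c$), the invariant $\varepsilon(q)\in\{0,1,-1\}$ is defined as follows: $\varepsilon(q)=0$ if $q$ is not identically zero on the radical of $b$ (equivalently $q$ is isometric to $x_1x_2+\cdots+x_{r-1}x_r+x_{r+1}^2$); $\varepsilon(q)=1$ if $q$ is isometric to $x_1x_2+\cdots+x_{r-1}x_r$; $\varepsilon(q)=-1$ if $q$ is isometric to $x_1^2+x_1x_2+x_2^2+x_3x_4+\cdots+x_{r-1}x_r$. One has $\sum_{x\in V}(-1)^{q(x)}=\varepsilon(q)2^{(k+c)/2}$. For $n\ge1$, $q_n=\mathrm{Tr}_{\mathbf{F}_{2^{mn}}/\mathbf{F}_2}\circ f$ is a quadratic form on the $\mathbf{F}_2$-vector space $\mathbf{F}_{2^{mn}}$, and $\varepsilon_n(f):=\varepsilon(q_n)$. $v_2$ denotes the $2$-adic valuation. *)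

theory Defs
  imports
    "HOL-Library.Z2"
    "HOL-Computational_Algebra.Computational_Algebra"
    "HOL-Algebra.Generated_Fields"
    "HOL-Algebra.Algebraic_Closure_Type"
begin

section \<open>Quadratic forms over the two-element field\<close>

text \<open>
  The field with two elements is the type \<^typ>\<open>bit\<close>.  A finite-dimensional vector space over it is
  a subspace \<open>V\<close> of an ambient space with scalar multiplication \<open>s\<close>; forms on \<open>V\<close> are total
  functions of which only the values on \<open>V\<close> matter.
\<close>

definition polarisation :: "('v::ab_group_add \<Rightarrow> bit) \<Rightarrow> 'v \<Rightarrow> 'v \<Rightarrow> bit" where
  "polarisation q x y = q (x + y) + q x + q y"

definition polar_radical :: "'v::ab_group_add set \<Rightarrow> ('v \<Rightarrow> bit) \<Rightarrow> 'v set" where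
  "polar_radical V q = {x \<in> V. \<forall>y\<in>V. polarisation q x y = 0}"

text \<open>
  The coordinate space of dimension \<open>k\<close>; the coordinates \<open>x\<^sub>1, \<dots>, x\<^sub>k\<close> of the usual
  notation are \<open>v 0, \<dots>, v (k - 1)\<close>.
\<close>

definition coord_space :: "nat \<Rightarrow> (nat \<Rightarrow> bit) set" where
  "coord_space k = {v. \<forall>i\<ge>k. v i = 0}"

text \<open>
  The standard forms are used with \<open>r\<close> even, the rank of an alternating form, and the second one
  only with \<open>r \<ge> 2\<close>.
\<close>

definition hyperbolic_form :: "nat \<Rightarrow> (nat \<Rightarrow> bit) \<Rightarrow> bit" where
  "hyperbolic_form r v = (\<Sum>i<r div 2. v (2 * i) * v (2 * i + 1))"

definition elliptic_form :: "nat \<Rightarrow> (nat \<Rightarrow> bit) \<Rightarrow> bit" where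
  "elliptic_form r v =
     (v 0)\<^sup>2 + v 0 * v 1 + (v 1)\<^sup>2 + (\<Sum>i\<in>{1..<r div 2}. v (2 * i) * v (2 * i + 1))"

definition isometric_to_coord ::
  "(bit \<Rightarrow> 'v::ab_group_add \<Rightarrow> 'v) \<Rightarrow> 'v set \<Rightarrow> ('v \<Rightarrow> bit) \<Rightarrow> nat \<Rightarrow> ((nat \<Rightarrow> bit) \<Rightarrow> bit) \<Rightarrow> bool" where
  "isometric_to_coord s V q k Q \<longleftrightarrow>
     (\<exists>\<phi>. bij_betw \<phi> V (coord_space k) \<and>
          (\<forall>x\<in>V. \<forall>y\<in>V. \<forall>i. \<phi> (x + y) i = \<phi> x i + \<phi> y i) \<and>
          (\<forall>c. \<forall>x\<in>V. \<forall>i. \<phi> (s c x) i = c * \<phi> x i) \<and>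
          (\<forall>x\<in>V. Q (\<phi> x) = q x))"

text \<open>
  By the classification of quadratic forms in characteristic 2, the last branch never occurs for a
  quadratic form on a finite-dimensional space.
\<close>

definition qf_epsilon ::
  "(bit \<Rightarrow> 'v::ab_group_add \<Rightarrow> 'v) \<Rightarrow> 'v set \<Rightarrow> ('v \<Rightarrow> bit) \<Rightarrow> int" where
  "qf_epsilon s V q =
     (let k = vector_space.dim s V;
          c = vector_space.dim s (polar_radical V q);
          r = k - c
      in if \<exists>x\<in>polar_radical V q. q x \<noteq> 0 then 0
         else if isometric_to_coord s V q k (hyperbolic_form r) then 1
         else if r \<ge> 2 \<and> isometric_to_coord s V q k (elliptic_form r) then - 1
         else undefined)"


section \<open>Finite fields of characteristic 2\<close>

text \<open>
  All finite fields are taken inside one algebraically closed field \<open>'a\<close> of characteristic 2.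
  For \<open>k \<ge> 1\<close> the following set is its unique subfield with \<open>2 ^ k\<close> elements
  (but \<open>GF2 0\<close> is all of \<open>'a\<close>).
\<close>

definition GF2 :: "nat \<Rightarrow> 'a::alg_closed_field set" where
  "GF2 k = {x. x ^ (2 ^ k) = x}"

text \<open>
  The trace from \<open>GF2 k\<close> to the prime field, as the sum of the Galois conjugates.  On \<open>GF2 k\<close> its
  value is the image in \<open>'a\<close> of a unique \<^typ>\<open>bit\<close>.
\<close>

definition GF2_trace :: "nat \<Rightarrow> 'a::alg_closed_field \<Rightarrow> bit" where
  "GF2_trace k x = (THE c. of_bit c = (\<Sum>i<k. x ^ (2 ^ i)))"

definition splitting_field_over :: "'a::alg_closed_field set \<Rightarrow> 'a poly \<Rightarrow> 'a set" where
  "splitting_field_over K p = generate_field ring_of_type_algebra (K \<union> {x. poly p x = 0})"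

definition epsilon_n :: "nat \<Rightarrow> 'a::alg_closed_field poly \<Rightarrow> nat \<Rightarrow> int" where
  "epsilon_n m f n =
     qf_epsilon (\<lambda>c x. of_bit c * x) (GF2 (m * n)) (\<lambda>x. GF2_trace (m * n) (poly f x))"

text \<open>Integer-valued, so that \<open>v2 N - 1\<close> is not truncated at 0.\<close>

abbreviation v2 :: "nat \<Rightarrow> int" where
  "v2 n \<equiv> int (multiplicity 2 n)"

end

theory Submission
  imports Defs "HOL-Number_Theory.Residues"
begin

text \<open>
  Write \<open>F n\<close> for the field with \<open>2^(m n)\<close> elements, \<open>q n\<close> for the trace form of \<open>f\<close> on it, and \<open>W\<close> for the
  space of roots of \<open>Rt\<close>, of order \<open>2^(2 d)\<close>. The radical of \<open>q n\<close> is \<open>W \<inter> F n\<close>. By the classification of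
  quadratic forms the sum of \<open>(-1)^(q n x)\<close> over \<open>F n\<close> is \<open>T n * 2^(m n / 2)\<close>, where \<open>T n\<close> is \<open>eps n\<close> times the
  square root of the order of the radical. Since \<open>m\<close> is even, this is an identity between integers.

  For \<open>w\<close> in \<open>W\<close> the bilinear expression \<open>x R(w) + w R(x)\<close> has the form \<open>g(w,x)^2 + g(w,x)\<close> with \<open>g\<close> biadditive
  and compatible with Frobenius. Hence the translation by \<open>w\<close> lifts to the curve \<open>y^2 + y = f(x)\<close> as the map
  \<open>(x, y) \<mapsto> (x + w, y + g(w,x) + e)\<close>, where \<open>e^2 + e = f(w)\<close>. The pairs \<open>(w, e)\<close> form an extraspecial 2-group with
  squaring map \<open>kappa w = g(w,w)\<close>, a quadratic form on \<open>W\<close>. In cohomological terms \<open>- T n\<close> is the trace of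
  a normalised power of Frobenius on the irreducible representation of this group. The proof replaces the representation
  by three elementary facts.

  \<^item> Doubling (\<open>T_double\<close>): \<open>T (2 n)\<close> is the sum of \<open>(-1)^(q n w + kappa w)\<close> over \<open>W \<inter> F n\<close>. The subfield \<open>F n\<close> is
  totally singular in \<open>F (2 n)\<close>, so only its orthogonal space contributes to the sum for \<open>F (2 n)\<close>.
  \<^item> Congruence (\<open>T_cong\<close>): \<open>T (n p)\<close> and \<open>T n\<close> agree modulo an odd prime \<open>p\<close>. The group generated by Frobenius
  over \<open>F n\<close> acts on \<open>F (n p)\<close> with fixed points \<open>F n\<close> and orbits of length \<open>p\<close> elsewhere.
  \<^item> Ellipticity (\<open>sum_chi_kappa_W\<close>): the sum of \<open>(-1)^(kappa w)\<close> over \<open>W\<close> is \<open>- 2^d\<close>. It is \<open>2^d\<close> or \<open>- 2^d\<close>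
  by doubling over a field that contains \<open>W\<close>, and the first value would give a polynomial more roots than its degree allows.

  Now let \<open>M\<close> satisfy \<open>W \<subseteq> F M\<close> and \<open>eps M \<noteq> 0\<close>; parts (i) and (ii) use \<open>M = N\<close>, part (iii) uses \<open>M = 2 N\<close>.
  If \<open>n / gcd(n, M)\<close> is odd, then \<open>n\<close> is reached from \<open>gcd(n, M)\<close> by multiplication with odd primes that do not
  enlarge \<open>W \<inter> F n\<close>, and the congruence shows \<open>eps n = eps (gcd n M)\<close>. If it is even, then \<open>M / gcd(n, M)\<close> is odd,
  doubling computes \<open>eps n\<close> from \<open>kappa\<close> alone, and the congruence compares the quotient of \<open>eps n\<close> and \<open>eps (2 n)\<close>
  with its value at \<open>M\<close>, which is \<open>- eps M\<close> because \<open>kappa\<close> is elliptic. This gives \<open>eps n = - eps M * eps (gcd n M)\<close>.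

  It remains to see that \<open>eps M = 1\<close> forces \<open>eps n = 0\<close> when \<open>n\<close> is less divisible by 2 than \<open>M\<close>. By the congruence one
  may take \<open>M = 2^i n\<close> with \<open>i > 0\<close>, and \<open>eps_split_of_nonzero\<close> shows that \<open>eps n \<noteq> 0\<close> implies \<open>eps M = -1\<close>. If
  \<open>eps n \<noteq> 0\<close>, the Frobenius \<open>x \<mapsto> x^(2^(m n))\<close> fixes all lifts \<open>(w, e)\<close> with \<open>w\<close> in \<open>W \<inter> F n\<close>. An isotropic subspace \<open>U\<close> with a
  Frobenius-stable lift is enlarged as long as possible without losing this property modulo \<open>U\<close>. For a maximal \<open>U\<close> a
  parity argument shows that Frobenius acts trivially on the orthogonal space of \<open>U\<close> modulo \<open>U\<close>. Then \<open>q (M/2)\<close> is the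
  pairing with a vector \<open>u\<close> of \<open>U\<close>, and doubling identifies \<open>T M\<close> with the sum of \<open>kappa\<close> translated by \<open>u\<close>, which is \<open>- 2^d\<close>.
\<close>

section \<open>Character sums of quadratic forms over the field with two elements\<close>

text \<open>
  Field arithmetic on bits is used here; the rewriting of sums and products to bitwise operations is turned off.
\<close>

declare add_bit_eq_xor [simp del] mult_bit_eq_and [simp del]

lemma UNIV_bit: "UNIV = {0, 1 :: bit}"
  using bit_not_zero_iff by auto

lemma card_UNIV_bit: "card (UNIV :: bit set) = 2"
  by (simp add: UNIV_bit)

definition F2_space :: "'v::ab_group_add set \<Rightarrow> bool" where
  "F2_space V \<longleftrightarrow> finite V \<and> 0 \<in> V \<and> (\<forall>x\<in>V. \<forall>y\<in>V. x + y \<in> V) \<and> (\<forall>x\<in>V. x + x = 0)"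

definition additive_on :: "'v::ab_group_add set \<Rightarrow> ('v \<Rightarrow> bit) \<Rightarrow> bool" where
  "additive_on V l \<longleftrightarrow> (\<forall>x\<in>V. \<forall>y\<in>V. l (x + y) = l x + l y)"

definition quadratic_on :: "'v::ab_group_add set \<Rightarrow> ('v \<Rightarrow> bit) \<Rightarrow> bool" where
  "quadratic_on V q \<longleftrightarrow> (\<forall>z\<in>V. additive_on V (\<lambda>x. polarisation q x z))"

definition perp :: "'v::ab_group_add set \<Rightarrow> ('v \<Rightarrow> bit) \<Rightarrow> 'v set \<Rightarrow> 'v set" where
  "perp V q U = {x \<in> V. \<forall>u\<in>U. polarisation q x u = 0}"

definition chi :: "bit \<Rightarrow> int" where
  "chi b = (if b = 0 then 1 else -1)"

lemma chi_0 [simp]: "chi 0 = 1" and chi_1 [simp]: "chi 1 = -1"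
  by (simp_all add: chi_def)

lemma bit_double [simp]: "a + a = (0::bit)"
  by (cases a) simp_all

lemma bit_double_left [simp]: "a + (a + b) = (b::bit)"
  by (cases a; cases b) simp_all

lemma bit_add_eq_0_iff: "a + b = 0 \<longleftrightarrow> a = (b::bit)"
  by (cases a; cases b) simp_all

lemma chi_add: "chi (a + b) = chi a * chi b"
  by (cases a; cases b) simp_all

lemma chi_square [simp]: "chi a * chi a = 1"
  by (cases a) simp_all

lemma F2_spaceD:
  assumes "F2_space V"
  shows "finite V" "0 \<in> V" "\<And>x y. x \<in> V \<Longrightarrow> y \<in> V \<Longrightarrow> x + y \<in> V" "\<And>x. x \<in> V \<Longrightarrow> x + x = 0"
  using assms by (auto simp: F2_space_def)

lemma F2_space_cancel:
  assumes "F2_space V" "x \<in> V"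
  shows "x + (x + y) = y" "(y + x) + x = y"
  using F2_spaceD(4)[OF assms] by (simp_all add: add.assoc flip: add.assoc[of x x y])

lemma F2_space_card_pos: "F2_space V \<Longrightarrow> card V > 0"
  by (auto simp: F2_space_def card_gt_0_iff)

lemma F2_space_translate:
  assumes "F2_space V" "a \<in> V"
  shows "bij_betw (\<lambda>x. x + a) V V"
  by (rule bij_betw_byWitness[where f' = "\<lambda>x. x + a"])
     (auto simp: F2_space_cancel[OF assms] F2_spaceD[OF assms(1)] assms)

lemma sum_translate:
  assumes "F2_space V" "a \<in> V"
  shows "(\<Sum>x\<in>V. f (x + a)) = (\<Sum>x\<in>V. f x)"
  by (rule sum.reindex_bij_betw[OF F2_space_translate[OF assms]])

lemma additive_onD: "additive_on V l \<Longrightarrow> x \<in> V \<Longrightarrow> y \<in> V \<Longrightarrow> l (x + y) = l x + l y"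
  by (simp add: additive_on_def)

lemma additive_on_0: "additive_on V l \<Longrightarrow> 0 \<in> V \<Longrightarrow> l 0 = 0"
  using additive_onD[of V l 0 0] by simp

lemma additive_on_subset: "additive_on V l \<Longrightarrow> U \<subseteq> V \<Longrightarrow> additive_on U l"
  by (auto simp: additive_on_def)

lemma additive_on_add:
  "additive_on V k \<Longrightarrow> additive_on V l \<Longrightarrow> additive_on V (\<lambda>x. k x + l x)"
  by (auto simp: additive_on_def algebra_simps)

text \<open>
  A nontrivial character sums to zero: translating by a vector where the character is \<open>-1\<close> negates the sum.
\<close>

lemma sum_chi_additive:
  assumes V: "F2_space V" and l: "additive_on V l"
  shows "(\<Sum>x\<in>V. chi (l x)) = (if \<forall>x\<in>V. l x = 0 then int (card V) else 0)"
proof (cases "\<forall>x\<in>V. l x = 0")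
  case True
  then show ?thesis by simp
next
  case False
  then obtain a where a: "a \<in> V" "l a = 1" by auto
  have "(\<Sum>x\<in>V. chi (l x)) = (\<Sum>x\<in>V. chi (l (x + a)))"
    using sum_translate[OF V a(1), of "\<lambda>x. chi (l x)"] by simp
  also have "\<dots> = (\<Sum>x\<in>V. - chi (l x))"
    by (intro sum.cong refl) (simp only: additive_onD[OF l _ a(1)] a(2) chi_add, simp)
  finally have "(\<Sum>x\<in>V. chi (l x)) = 0" by (simp add: sum_negf)
  with False show ?thesis by (simp only: if_False)
qed

text \<open>
  If \<open>l\<close> differed from every \<open>b _ u\<close>, the double
  sum of \<open>(-1)^(l x + b x u)\<close> would vanish when \<open>x\<close> is summed first. Summing over \<open>u\<close> first leaves only the \<open>x\<close>
  orthogonal to \<open>U\<close>, where \<open>l\<close> is zero, and gives a positive number.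
\<close>

lemma functional_eq_pairing:
  assumes V: "F2_space V" and U: "F2_space U"
    and b1: "\<And>u. u \<in> U \<Longrightarrow> additive_on V (\<lambda>x. b x u)"
    and b2: "\<And>x. x \<in> V \<Longrightarrow> additive_on U (b x)"
    and l: "additive_on V l"
    and van: "\<And>x. x \<in> V \<Longrightarrow> (\<forall>u\<in>U. b x u = 0) \<Longrightarrow> l x = 0"
  shows "\<exists>u\<in>U. \<forall>x\<in>V. l x = b x u"
proof (rule ccontr)
  assume no: "\<not> ?thesis"
  have "(\<Sum>u\<in>U. \<Sum>x\<in>V. chi (l x + b x u)) = 0"
  proof (rule sum.neutral, safe)
    fix u assume u: "u \<in> U"
    from no u obtain x where "x \<in> V" "l x \<noteq> b x u" by blast
    then have "\<not> (\<forall>x\<in>V. l x + b x u = 0)" by (auto simp only: bit_add_eq_0_iff)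
    then show "(\<Sum>x\<in>V. chi (l x + b x u)) = 0"
      by (subst sum_chi_additive[OF V additive_on_add[OF l b1[OF u]]]) auto
  qed
  moreover have "(\<Sum>u\<in>U. \<Sum>x\<in>V. chi (l x + b x u))
      = (\<Sum>x\<in>V. chi (l x) * (\<Sum>u\<in>U. chi (b x u)))"
    by (subst sum.swap) (simp add: chi_add sum_distrib_left)
  also have "\<dots> = (\<Sum>x\<in>V. if \<forall>u\<in>U. b x u = 0 then int (card U) else 0)"
    by (intro sum.cong refl) (auto simp: sum_chi_additive[OF U b2] van)
  also have "\<dots> = int (card U) * int (card {x \<in> V. \<forall>u\<in>U. b x u = 0})"
    using F2_spaceD(1)[OF V] by (simp flip: sum.inter_filter)
  moreover have "0 \<in> {x \<in> V. \<forall>u\<in>U. b x u = 0}"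
    using F2_spaceD(2)[OF V] additive_on_0[OF b1] by auto
  ultimately show False
    using F2_space_card_pos[OF U] F2_spaceD(1)[OF V] by auto
qed

lemma polarisation_commute: "polarisation q x y = polarisation q y x"
  by (simp add: polarisation_def add.commute add.left_commute)

lemma quadratic_onD:
  "quadratic_on V q \<Longrightarrow> x \<in> V \<Longrightarrow> y \<in> V \<Longrightarrow> z \<in> V \<Longrightarrow>
     polarisation q (x + y) z = polarisation q x z + polarisation q y z"
  by (simp add: quadratic_on_def additive_on_def)

lemma quadratic_onD':
  "quadratic_on V q \<Longrightarrow> x \<in> V \<Longrightarrow> y \<in> V \<Longrightarrow> z \<in> V \<Longrightarrow>
     polarisation q z (x + y) = polarisation q z x + polarisation q z y"
  by (simp add: quadratic_onD polarisation_commute[of q z])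

lemma quadratic_on_subset: "quadratic_on V q \<Longrightarrow> U \<subseteq> V \<Longrightarrow> quadratic_on U q"
  by (auto simp: quadratic_on_def additive_on_def subset_iff)

lemma quadratic_add: "q (x + y) = q x + q y + polarisation q x y"
  unfolding polarisation_def by (cases "q x"; cases "q y"; cases "q (x + y)") simp_all

lemma quadratic_on_0:
  assumes "quadratic_on V q" "0 \<in> V" shows "q 0 = 0"
  using quadratic_onD[OF assms(1) assms(2) assms(2) assms(2)]
  by (simp add: polarisation_def)

lemma polarisation_0:
  assumes "quadratic_on V q" "0 \<in> V" "x \<in> V"
  shows "polarisation q 0 x = 0" "polarisation q x 0 = 0"
  using quadratic_on_0[OF assms(1,2)] by (simp_all add: polarisation_def)

lemma polarisation_self:
  assumes "F2_space V" "quadratic_on V q" "x \<in> V"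
  shows "polarisation q x x = 0"
  using quadratic_on_0[OF assms(2)] F2_spaceD[OF assms(1)] assms(3) by (simp add: polarisation_def)

lemma polarisation_additive:
  assumes "quadratic_on V q" "x \<in> V"
  shows "additive_on V (polarisation q x)" "additive_on V (\<lambda>y. polarisation q y x)"
  using assms by (auto simp: additive_on_def quadratic_onD quadratic_onD')

lemma F2_space_annihilator:
  assumes "F2_space V" "\<And>i. i \<in> I \<Longrightarrow> additive_on V (l i)"
  shows "F2_space {x \<in> V. \<forall>i\<in>I. l i x = 0}"
  using assms by (auto simp: F2_space_def additive_on_0[OF assms(2)] additive_onD[OF assms(2)])

lemma perp_F2_space:
  assumes "F2_space V" "quadratic_on V q" "U \<subseteq> V"
  shows "F2_space (perp V q U)"
  unfolding perp_def
  by (rule F2_space_annihilator) (use assms polarisation_additive in blast)+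

lemma perp_self: "perp V q V = polar_radical V q"
  by (simp add: perp_def polar_radical_def)

lemma radical_F2_space:
  "F2_space V \<Longrightarrow> quadratic_on V q \<Longrightarrow> F2_space (polar_radical V q)"
  using perp_F2_space[of V q V] by (simp add: perp_self)

text \<open>
  Averaging over the translations by a totally singular subspace kills all cosets outside its orthogonal space.
\<close>

lemma sum_chi_singular_subspace:
  assumes V: "F2_space V" and q: "quadratic_on V q"
    and U: "F2_space U" "U \<subseteq> V" and sing: "\<And>u. u \<in> U \<Longrightarrow> q u = 0"
  shows "(\<Sum>x\<in>V. chi (q x)) = (\<Sum>x\<in>perp V q U. chi (q x))"
proof -
  have "int (card U) * (\<Sum>x\<in>V. chi (q x)) = (\<Sum>u\<in>U. \<Sum>x\<in>V. chi (q (x + u)))"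
    using U(2) by (simp add: sum_translate[OF V, of _ "\<lambda>x. chi (q x)"] subset_iff)
  also have "\<dots> = (\<Sum>u\<in>U. \<Sum>x\<in>V. chi (q x) * chi (polarisation q x u))"
    by (intro sum.cong refl) (simp add: quadratic_add[of q] sing chi_add)
  also have "\<dots> = (\<Sum>x\<in>V. chi (q x) * (\<Sum>u\<in>U. chi (polarisation q x u)))"
    by (subst sum.swap) (simp add: sum_distrib_left)
  also have "\<dots> = (\<Sum>x\<in>V. if \<forall>u\<in>U. polarisation q x u = 0 then int (card U) * chi (q x) else 0)"
    by (intro sum.cong refl)
       (auto simp: sum_chi_additive[OF U(1) additive_on_subset[OF polarisation_additive(1)[OF q] U(2)]])
  also have "\<dots> = int (card U) * (\<Sum>x\<in>perp V q U. chi (q x))"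
    using F2_spaceD(1)[OF V]
    by (simp add: perp_def sum_distrib_left flip: sum.inter_filter)
  finally show ?thesis using F2_space_card_pos[OF U(1)] by simp
qed

text \<open>
  Substituting \<open>y = z + x\<close> in the double sum turns \<open>q x + q y\<close> into \<open>q z\<close> plus a linear character of \<open>x\<close>, which is
  trivial exactly for \<open>z\<close> in the radical.
\<close>

lemma sum_chi_square:
  assumes V: "F2_space V" and q: "quadratic_on V q"
  shows "(\<Sum>x\<in>V. chi (q x))\<^sup>2 = int (card V) * (\<Sum>x\<in>polar_radical V q. chi (q x))"
proof -
  have "(\<Sum>x\<in>V. chi (q x))\<^sup>2 = (\<Sum>x\<in>V. \<Sum>y\<in>V. chi (q x) * chi (q y))"
    by (simp add: power2_eq_square sum_product)
  also have "\<dots> = (\<Sum>x\<in>V. \<Sum>z\<in>V. chi (q x) * chi (q (z + x)))"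
    by (intro sum.cong refl sum_translate[OF V, of _ "\<lambda>y. chi (q x) * chi (q y)" for x, symmetric])
  also have "\<dots> = (\<Sum>x\<in>V. \<Sum>z\<in>V. chi (q z) * chi (polarisation q z x))"
    by (intro sum.cong refl) (simp add: quadratic_add[of q] chi_add mult.assoc mult.left_commute)
  also have "\<dots> = (\<Sum>z\<in>V. chi (q z) * (\<Sum>x\<in>V. chi (polarisation q z x)))"
    by (subst sum.swap) (simp add: sum_distrib_left)
  also have "\<dots> = (\<Sum>z\<in>V. if \<forall>x\<in>V. polarisation q z x = 0 then int (card V) * chi (q z) else 0)"
    by (intro sum.cong refl)
       (auto simp: sum_chi_additive[OF V polarisation_additive(1)[OF q]])
  also have "\<dots> = int (card V) * (\<Sum>x\<in>polar_radical V q. chi (q x))"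
    using F2_spaceD(1)[OF V]
    by (simp add: polar_radical_def sum_distrib_left flip: sum.inter_filter)
  finally show ?thesis .
qed

lemma sum_chi_radical:
  assumes V: "F2_space V" and q: "quadratic_on V q"
  shows "(\<Sum>x\<in>polar_radical V q. chi (q x))
       = (if \<forall>x\<in>polar_radical V q. q x = 0 then int (card (polar_radical V q)) else 0)"
proof (rule sum_chi_additive[OF radical_F2_space[OF assms]])
  show "additive_on (polar_radical V q) q"
    by (auto simp: additive_on_def quadratic_add[of q] polar_radical_def)
qed

lemma sum_chi_eq_card: "finite A \<Longrightarrow> (\<Sum>x\<in>A. chi (h x)) = 2 * int (card {x\<in>A. h x = 0}) - int (card A)"
proof -
  assume A: "finite A"
  have "(\<Sum>x\<in>A. chi (h x)) = (\<Sum>x\<in>A. (if h x = 0 then 2 else 0) - 1)"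
    by (intro sum.cong refl) (simp add: chi_def)
  also have "\<dots> = (\<Sum>x\<in>{x\<in>A. h x = 0}. 2) - int (card A)"
    using A by (simp add: sum_subtractf flip: sum.inter_filter)
  finally show ?thesis by simp
qed

text \<open>
  A plane spanned by \<open>x\<close> and \<open>y\<close> with pairing 1 splits off orthogonally. Since the pairing is alternating, the
  coordinates of \<open>z\<close> along \<open>x\<close> and \<open>y\<close> are its pairings with \<open>y\<close> and with \<open>x\<close>; \<open>pr\<close> is the projection to the complement.
\<close>

lemma plane_split:
  fixes x y :: "'v::ab_group_add"
  assumes V: "F2_space V" and q: "quadratic_on V q" and xy: "x \<in> V" "y \<in> V"
    and b: "polarisation q x y = 1"
  defines "V' \<equiv> perp V q {x, y}"
  defines "pt \<equiv> \<lambda>a b. (if a = 1 then x else 0) + (if b = (1::bit) then y else 0)"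
  defines "pr \<equiv> \<lambda>z. z + pt (polarisation q z y) (polarisation q z x)"
  shows "F2_space V'" and "V' \<subseteq> V" and "polar_radical V' q = polar_radical V q"
    and "bij_betw (\<lambda>z. (pr z, polarisation q z y, polarisation q z x)) V (V' \<times> UNIV)"
    and "\<And>z w. z \<in> V \<Longrightarrow> w \<in> V \<Longrightarrow> pr (z + w) = pr z + pr w"
    and "\<And>z. z \<in> V \<Longrightarrow> q z = q (pr z) + q (pt (polarisation q z y) (polarisation q z x))"
proof -
  show V'V: "V' \<subseteq> V" by (auto simp: V'_def perp_def)
  show V': "F2_space V'" unfolding V'_def by (rule perp_F2_space[OF V q]) (use xy in auto)
  have yx: "polarisation q y x = 1" using b by (simp add: polarisation_commute)
  have xx: "polarisation q x x = 0" and yy: "polarisation q y y = 0"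
    using polarisation_self[OF V q] xy by auto
  note mem = F2_spaceD[OF V]
  have pt: "pt a c \<in> V" for a c using xy mem by (auto simp: pt_def)
  have polx: "polarisation q (pt a c) x = c" and poly: "polarisation q (pt a c) y = a" for a c
    using xy mem b yx xx yy polarisation_0[OF q]
    by (cases a; cases c; simp add: pt_def quadratic_onD[OF q])+
  have pt_add: "pt (a + a') (c + c') = pt a c + pt a' c'" for a a' c c'
    using mem(4)[OF xy(1)] mem(4)[OF xy(2)]
    by (cases a; cases a'; cases c; cases c'; simp add: pt_def algebra_simps F2_space_cancel[OF V xy(1)] F2_space_cancel[OF V xy(2)])
  have prV': "pr z \<in> V'" if "z \<in> V" for z
    using that pt mem xy polx poly
    by (simp add: V'_def perp_def pr_def quadratic_onD[OF q])
  have pol_add: "polarisation q (z + pt a c) y = polarisation q z y + a"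
    "polarisation q (z + pt a c) x = polarisation q z x + c" if "z \<in> V" for z a c
    using that pt xy by (simp_all add: quadratic_onD[OF q] polx poly)
  have V'0: "polarisation q z x = 0" "polarisation q z y = 0" if "z \<in> V'" for z
    using that by (auto simp: V'_def perp_def)
  show "bij_betw (\<lambda>z. (pr z, polarisation q z y, polarisation q z x)) V (V' \<times> UNIV)"
  proof (rule bij_betw_byWitness[where f' = "\<lambda>(z, a, c). z + pt a c"])
    show "\<forall>z\<in>V. (case (pr z, polarisation q z y, polarisation q z x) of (z, a, c) \<Rightarrow> z + pt a c) = z"
      using F2_space_cancel[OF V pt] by (simp add: pr_def)
    show "\<forall>t\<in>V' \<times> UNIV. (pr (case t of (z, a, c) \<Rightarrow> z + pt a c),
           polarisation q (case t of (z, a, c) \<Rightarrow> z + pt a c) y,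
           polarisation q (case t of (z, a, c) \<Rightarrow> z + pt a c) x) = t"
      using V'V by (auto simp: pr_def pol_add subset_iff V'0 F2_space_cancel[OF V pt] mem(4)[OF pt])
    show "(\<lambda>z. (pr z, polarisation q z y, polarisation q z x)) ` V \<subseteq> V' \<times> UNIV"
      using prV' by auto
    show "(\<lambda>(z, a, c). z + pt a c) ` (V' \<times> UNIV) \<subseteq> V"
      using V'V pt mem by auto
  qed
  show "pr (z + w) = pr z + pr w" if "z \<in> V" "w \<in> V" for z w
    using that xy by (simp add: pr_def quadratic_onD[OF q] pt_add algebra_simps)
  have orth: "polarisation q z (pt a c) = 0" if "z \<in> V'" for z a c
    using that V'V xy mem V'0 polarisation_0[OF q]
    by (cases a; cases c; simp add: pt_def quadratic_onD'[OF q] subset_iff)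
  have dec: "z = pr z + pt (polarisation q z y) (polarisation q z x)" if "z \<in> V" for z
    by (simp add: pr_def F2_space_cancel[OF V pt])
  show "q z = q (pr z) + q (pt (polarisation q z y) (polarisation q z x))" if z: "z \<in> V" for z
    by (subst dec[OF z], subst quadratic_add[of q]) (simp add: orth prV' z)
  show "polar_radical V' q = polar_radical V q"
  proof (intro equalityI subsetI)
    fix z assume z: "z \<in> polar_radical V' q"
    then have zV': "z \<in> V'" and z0: "\<And>w. w \<in> V' \<Longrightarrow> polarisation q z w = 0"
      by (auto simp: polar_radical_def)
    have "polarisation q z w = 0" if w: "w \<in> V" for w
    proof -
      have "polarisation q z w = polarisation q z (pr w + pt (polarisation q w y) (polarisation q w x))"
        by (rule arg_cong[OF dec[OF w]])
      also have "\<dots> = polarisation q z (pr w) + polarisation q z (pt (polarisation q w y) (polarisation q w x))"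
        by (rule quadratic_onD'[OF q]) (use prV'[OF w] V'V pt zV' in auto)
      also have "\<dots> = 0" using z0[OF prV'[OF w]] orth[OF zV'] by simp
      finally show ?thesis .
    qed
    then show "z \<in> polar_radical V q" using zV' V'V by (auto simp: polar_radical_def)
  next
    fix z assume "z \<in> polar_radical V q"
    then show "z \<in> polar_radical V' q"
      using xy V'V by (auto simp: polar_radical_def V'_def perp_def)
  qed
qed

lemma card_plane_split:
  assumes V: "F2_space V" and q: "quadratic_on V q" and xy: "x \<in> V" "y \<in> V"
    and b: "polarisation q x y = 1"
  shows "card V = 4 * card (perp V q {x, y})"
  using bij_betw_same_card[OF plane_split(4)[OF assms]]
  by (simp add: card_cartesian_product card_UNIV_bit flip: UNIV_Times_UNIV)

text \<open>
  The rank of an alternating form is even: each split plane divides the order by 4 and keeps the radical.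
\<close>

lemma card_times_card_radical_square:
  assumes "F2_space V" "quadratic_on V q"
  shows "\<exists>t. card V * card (polar_radical V q) = t\<^sup>2"
  using assms
proof (induction "card V" arbitrary: V rule: less_induct)
  case less
  note V = less.prems(1) and q = less.prems(2)
  show ?case
  proof (cases "polar_radical V q = V")
    case True
    then show ?thesis by (auto simp: power2_eq_square)
  next
    case False
    then obtain x y where "x \<in> V" "y \<in> V" "polarisation q x y \<noteq> 0"
      unfolding polar_radical_def by blast
    then have xy: "x \<in> V" "y \<in> V" "polarisation q x y = 1" by simp_all
    let ?V' = "perp V q {x, y}"
    note sp = plane_split[OF V q xy]
    have c: "card V = 4 * card ?V'" by (rule card_plane_split[OF V q xy])
    then have "card ?V' < card V" using F2_space_card_pos[OF V] by simp
    then obtain t where "card ?V' * card (polar_radical ?V' q) = t\<^sup>2"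
      using less.hyps sp(1) quadratic_on_subset[OF q sp(2)] by blast
    then have "card V * card (polar_radical V q) = (2 * t)\<^sup>2"
      by (simp add: c sp(3))
    then show ?thesis by blast
  qed
qed

section \<open>Classification and the invariant\<close>

definition coordinates_on ::
  "('v::ab_group_add \<Rightarrow> nat \<Rightarrow> bit) \<Rightarrow> 'v set \<Rightarrow> nat \<Rightarrow> bool" where
  "coordinates_on \<phi> V k \<longleftrightarrow> bij_betw \<phi> V (coord_space k) \<and>
     (\<forall>x\<in>V. \<forall>y\<in>V. \<forall>i. \<phi> (x + y) i = \<phi> x i + \<phi> y i)"

lemma isometric_to_coord_iff:
  fixes s :: "bit \<Rightarrow> 'v::ab_group_add \<Rightarrow> 'v"
  assumes s: "vector_space s" and V: "F2_space V"
  shows "isometric_to_coord s V q k Q \<longleftrightarrow>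
           (\<exists>\<phi>. coordinates_on \<phi> V k \<and> (\<forall>x\<in>V. Q (\<phi> x) = q x))"
proof -
  interpret vector_space s by fact
  have "\<phi> (s c x) i = c * \<phi> x i" if "coordinates_on \<phi> V k" "x \<in> V" for \<phi> c x i
  proof -
    have "\<phi> (0 + 0) i = \<phi> 0 i + \<phi> 0 i"
      using that F2_spaceD(2)[OF V] unfolding coordinates_on_def by blast
    then have "\<phi> 0 i = 0" by simp
    then show ?thesis by (cases c) simp_all
  qed
  then show ?thesis
    unfolding isometric_to_coord_def coordinates_on_def by blast
qed

lemma F2_space_subspace:
  fixes s :: "bit \<Rightarrow> 'v::ab_group_add \<Rightarrow> 'v"
  assumes s: "vector_space s" and V: "F2_space V"
  shows "module.subspace s V"
proof -
  interpret vector_space s by fact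
  have "s c x \<in> V" if "x \<in> V" for c x
    using that F2_spaceD(2)[OF V] by (cases c) simp_all
  then show ?thesis using F2_spaceD[OF V] by (auto simp: subspace_def)
qed

text \<open>
  Coordinates with respect to a basis; this also supplies the dimension from the order.
\<close>

lemma F2_space_coordinates:
  fixes s :: "bit \<Rightarrow> 'v::ab_group_add \<Rightarrow> 'v"
  assumes s: "vector_space s" and V: "F2_space V"
  shows "\<exists>\<phi>. coordinates_on \<phi> V (vector_space.dim s V)"
proof -
  interpret vector_space s by fact
  have sub: "subspace V" by (rule F2_space_subspace[OF assms])
  obtain B where B: "B \<subseteq> V" "independent B" "V \<subseteq> span B" "card B = dim V"
    using basis_exists by blast
  have fB: "finite B" using B(1) F2_spaceD(1)[OF V] by (rule finite_subset)
  have VB: "V = span B" using B(1,3) sub by (simp add: span_minimal subset_antisym)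
  define k where "k = dim V"
  obtain e where e: "bij_betw e {0..<k} B"
    using ex_bij_betw_nat_finite[OF fB] B(4) by (auto simp: k_def)
  have eB: "e i \<in> B" if "i < k" for i using e that by (auto simp: bij_betw_def)
  define \<phi> where "\<phi> x i = (if i < k then representation B x (e i) else 0)" for x i
  define \<psi> where "\<psi> v = (\<Sum>i<k. s (v i) (e i))" for v
  have \<psi>V: "\<psi> v \<in> V" for v
    unfolding \<psi>_def VB by (intro span_sum span_scale span_base) (simp add: eB)
  have 1: "\<psi> (\<phi> x) = x" if "x \<in> V" for x
  proof -
    have "\<psi> (\<phi> x) = (\<Sum>i\<in>{0..<k}. s (representation B x (e i)) (e i))"
      by (simp add: \<psi>_def \<phi>_def lessThan_atLeast0)
    also have "\<dots> = (\<Sum>b\<in>B. s (representation B x b) b)"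
      by (rule sum.reindex_bij_betw[OF e])
    also have "\<dots> = x"
      by (rule sum_representation_eq[OF B(2) _ fB]) (use that VB in auto)
    finally show ?thesis .
  qed
  have 2: "\<phi> (\<psi> v) = v" if v: "v \<in> coord_space k" for v
  proof
    fix i
    show "\<phi> (\<psi> v) i = v i"
    proof (cases "i < k")
      case False
      then show ?thesis using v by (simp add: \<phi>_def coord_space_def)
    next
      case True
      have "\<phi> (\<psi> v) i = (\<Sum>j<k. representation B (s (v j) (e j)) (e i))"
        using True unfolding \<phi>_def \<psi>_def
        by (subst representation_sum[OF B(2)]) (auto intro: span_scale span_base eB)
      also have "\<dots> = (\<Sum>j<k. if j = i then v j else 0)"
      proof (intro sum.cong refl)
        fix j assume j: "j \<in> {..<k}"
        then have "e j = e i \<longleftrightarrow> j = i"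
          using e True by (auto simp: bij_betw_def inj_on_eq_iff)
        then show "representation B (s (v j) (e j)) (e i) = (if j = i then v j else 0)"
          using j by (auto simp: representation_scale[OF B(2)] representation_basis[OF B(2)] span_base eB)
      qed
      also have "\<dots> = v i" using True by simp
      finally show ?thesis .
    qed
  qed
  have "bij_betw \<phi> V (coord_space k)"
    by (rule bij_betw_byWitness[where f' = \<psi>])
       (use 1 2 \<psi>V in \<open>auto simp: coord_space_def \<phi>_def\<close>)
  moreover have "\<forall>x\<in>V. \<forall>y\<in>V. \<forall>i. \<phi> (x + y) i = \<phi> x i + \<phi> y i"
    using VB by (auto simp: \<phi>_def representation_add[OF B(2)])
  ultimately show ?thesis by (auto simp: coordinates_on_def k_def)
qed

text \<open>
  The two new coordinates are inserted at the positions \<open>r\<close> and \<open>r + 1\<close>, immediately after the coordinates that enter a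
  standard form of rank \<open>r\<close>. This extends both standard forms by a product and leaves the special summand of the
  elliptic form at the positions 0 and 1.
\<close>

definition insert_pair :: "nat \<Rightarrow> (nat \<Rightarrow> bit) \<Rightarrow> bit \<Rightarrow> bit \<Rightarrow> nat \<Rightarrow> bit" where
  "insert_pair r v a b i =
     (if i < r then v i else if i = r then a else if i = Suc r then b else v (i - 2))"

lemma insert_pair_bij:
  assumes "r \<le> k"
  shows "bij_betw (\<lambda>(v, a, b). insert_pair r v a b) (coord_space k \<times> UNIV) (coord_space (k + 2))"
proof (rule bij_betw_byWitness[where f' = "\<lambda>w. (\<lambda>i. if i < r then w i else w (i + 2), w r, w (Suc r))"])
  have "insert_pair r (\<lambda>i. if i < r then w i else w (i + 2)) (w r) (w (Suc r)) = w" for w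
  proof
    fix i
    have "i < r \<or> i = r \<or> i = Suc r \<or> i = (i - 2) + 2 \<and> i - 2 \<ge> r" by linarith
    then consider "i < r" | "i = r" | "i = Suc r" | j where "i = j + 2" "j \<ge> r" by metis
    then show "insert_pair r (\<lambda>i. if i < r then w i else w (i + 2)) (w r) (w (Suc r)) i = w i"
      by cases (auto simp: insert_pair_def)
  qed
  then show "\<forall>w\<in>coord_space (k + 2). (case (\<lambda>i. if i < r then w i else w (i + 2), w r, w (Suc r))
      of (v, a, b) \<Rightarrow> insert_pair r v a b) = w" by simp
qed (use assms in \<open>auto simp: insert_pair_def coord_space_def fun_eq_iff\<close>)

lemma sum_coord_space_insert_pair:
  assumes "r \<le> k"
  shows "(\<Sum>v\<in>coord_space (k + 2). F v)
       = (\<Sum>v\<in>coord_space k. \<Sum>a\<in>UNIV. \<Sum>b\<in>UNIV. F (insert_pair r v a b))"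
proof -
  have "(\<Sum>v\<in>coord_space (k + 2). F v)
      = (\<Sum>t\<in>coord_space k \<times> UNIV. F (case t of (v, a, b) \<Rightarrow> insert_pair r v a b))"
    by (rule sum.reindex_bij_betw[OF insert_pair_bij[OF assms], symmetric])
  also have "\<dots> = (\<Sum>v\<in>coord_space k. \<Sum>t\<in>UNIV. F (case t of (a, b) \<Rightarrow> insert_pair r v a b))"
    by (subst sum.cartesian_product) (simp add: split_beta)
  also have "\<dots> = (\<Sum>v\<in>coord_space k. \<Sum>a\<in>UNIV. \<Sum>b\<in>UNIV. F (insert_pair r v a b))"
    by (subst sum.cartesian_product) (simp add: split_beta flip: UNIV_Times_UNIV)
  finally show ?thesis .
qed

lemma coord_space_Suc_bij:
  "bij_betw (\<lambda>(v, a). v(k := a)) (coord_space k \<times> UNIV) (coord_space (Suc k))"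
  by (rule bij_betw_byWitness[where f' = "\<lambda>w. (w(k := 0), w k)"])
     (auto simp: coord_space_def Suc_le_eq fun_upd_idem_iff)

lemma finite_card_coord_space: "finite (coord_space k) \<and> card (coord_space k) = 2 ^ k"
proof (induction k)
  case 0
  have "coord_space 0 = {\<lambda>_. 0}" by (auto simp: coord_space_def)
  then show ?case by simp
next
  case (Suc k)
  then show ?case
    using bij_betw_same_card[OF coord_space_Suc_bij[of k]] bij_betw_finite[OF coord_space_Suc_bij[of k]]
    by (simp add: card_cartesian_product card_UNIV_bit UNIV_bit)
qed

lemma card_F2_space:
  fixes s :: "bit \<Rightarrow> 'v::ab_group_add \<Rightarrow> 'v"
  assumes "vector_space s" "F2_space V"
  shows "card V = 2 ^ vector_space.dim s V"
  using F2_space_coordinates[OF assms] finite_card_coord_space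
  by (auto simp: coordinates_on_def dest: bij_betw_same_card)

lemma hyperbolic_form_insert_pair:
  assumes "even r"
  shows "hyperbolic_form (r + 2) (insert_pair r v a b) = hyperbolic_form r v + a * b"
proof -
  from assms obtain t where t: "r = 2 * t" by auto
  then show ?thesis by (simp add: hyperbolic_form_def insert_pair_def)
qed

lemma elliptic_form_insert_pair:
  assumes "even r" "r \<ge> 2"
  shows "elliptic_form (r + 2) (insert_pair r v a b) = elliptic_form r v + a * b"
proof -
  from assms obtain t where t: "r = 2 * t" "t \<ge> 1" by auto
  then show ?thesis by (simp add: elliptic_form_def insert_pair_def add.assoc del: power_bit_unfold)
qed

lemma elliptic_form_2: "elliptic_form 2 (insert_pair 0 v a b) = a + b + a * b"
  by (cases a; cases b; simp add: elliptic_form_def insert_pair_def)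

text \<open>
  Every further hyperbolic pair multiplies the sum by \<open>1 + 1 + 1 - 1 = 2\<close>.
\<close>

lemma sum_chi_hyperbolic_pos:
  assumes "even r" "r \<le> k"
  shows "(\<Sum>v\<in>coord_space k. chi (hyperbolic_form r v)) > 0"
proof -
  have "2 * t \<le> k \<Longrightarrow> (\<Sum>v\<in>coord_space k. chi (hyperbolic_form (2 * t) v)) > 0" for t
  proof (induction t arbitrary: k)
    case 0
    then show ?case using finite_card_coord_space[of k] by (simp add: hyperbolic_form_def)
  next
    case (Suc t)
    then obtain k' where k': "k = k' + 2" "2 * t \<le> k'"
      by (metis add_2_eq_Suc' le_Suc_ex mult_Suc_right add.commute add.assoc le_add1)
    have two: "2 * Suc t = 2 * t + 2" by simp
    have "(\<Sum>v\<in>coord_space k. chi (hyperbolic_form (2 * Suc t) v))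
        = 2 * (\<Sum>v\<in>coord_space k'. chi (hyperbolic_form (2 * t) v))"
      unfolding k'(1) two sum_coord_space_insert_pair[OF k'(2)]
        hyperbolic_form_insert_pair[OF dvd_triv_left] chi_add
      by (simp add: UNIV_bit sum_distrib_left)
    then show ?case using Suc.IH[OF k'(2)] by simp
  qed
  then show ?thesis using assms by (metis evenE)
qed

text \<open>
  The anisotropic plane contributes \<open>1 - 1 - 1 - 1 = -2\<close>, and each hyperbolic pair a factor 2.
\<close>

lemma sum_chi_elliptic_neg:
  assumes "even r" "2 \<le> r" "r \<le> k"
  shows "(\<Sum>v\<in>coord_space k. chi (elliptic_form r v)) < 0"
proof -
  have "2 * Suc t \<le> k \<Longrightarrow> (\<Sum>v\<in>coord_space k. chi (elliptic_form (2 * Suc t) v)) < 0" for t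
  proof (induction t arbitrary: k)
    case 0
    then obtain k' where k': "k = k' + 2" by (metis add.commute le_Suc_ex mult_1_right One_nat_def)
    have "(\<Sum>v\<in>coord_space k. chi (elliptic_form 2 v)) = - 2 * 2 ^ k'"
      unfolding k' sum_coord_space_insert_pair[OF zero_le] elliptic_form_2
      using finite_card_coord_space[of k'] by (simp add: UNIV_bit)
    then show ?case by simp
  next
    case (Suc t)
    then obtain k' where k': "k = k' + 2" "2 * Suc t \<le> k'"
      by (metis add_2_eq_Suc' le_Suc_ex mult_Suc_right add.commute add.assoc le_add1)
    have two: "2 * Suc (Suc t) = 2 * Suc t + 2" and two_le: "2 \<le> 2 * Suc t" by simp_all
    have "(\<Sum>v\<in>coord_space k. chi (elliptic_form (2 * Suc (Suc t)) v))
        = 2 * (\<Sum>v\<in>coord_space k'. chi (elliptic_form (2 * Suc t) v))"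
      unfolding k'(1) two sum_coord_space_insert_pair[OF k'(2)]
        elliptic_form_insert_pair[OF dvd_triv_left two_le] chi_add
      by (simp add: UNIV_bit sum_distrib_left)
    then show ?case using Suc.IH[OF k'(2)] by simp
  qed
  from this[of "r div 2 - 1"] show ?thesis using assms by (auto elim!: evenE)
qed

text \<open>
  Coordinates of a complement of a plane extend to the whole space, with the plane placed at an arbitrary position \<open>r\<close>.
\<close>

lemma plane_coordinates:
  assumes V: "F2_space V" and q: "quadratic_on V q" and xy: "x \<in> V" "y \<in> V"
    and b: "polarisation q x y = 1"
    and \<phi>: "coordinates_on \<phi> (perp V q {x, y}) k" and r: "r \<le> k"
  shows "\<exists>\<phi>'. coordinates_on \<phi>' V (k + 2) \<and>
           (\<forall>z\<in>V. \<exists>z'\<in>perp V q {x, y}. \<exists>a c. \<phi>' z = insert_pair r (\<phi> z') a c \<and>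
              q z = q z' + (a * q x + c * q y + a * c))"
proof -
  define V' where "V' = perp V q {x, y}"
  define pt where "pt a b = (if a = 1 then x else 0) + (if b = (1::bit) then y else 0)" for a b :: bit
  define pr where "pr z = z + pt (polarisation q z y) (polarisation q z x)" for z
  note sp = plane_split[OF V q xy b, folded pt_def V'_def, folded pr_def]
  define \<phi>' where "\<phi>' z = insert_pair r (\<phi> (pr z)) (polarisation q z y) (polarisation q z x)" for z
  have bij: "bij_betw \<phi> V' (coord_space k)"
    and add: "\<And>x y i. x \<in> V' \<Longrightarrow> y \<in> V' \<Longrightarrow> \<phi> (x + y) i = \<phi> x i + \<phi> y i"
    using \<phi> by (auto simp: coordinates_on_def V'_def)
  have prV': "pr z \<in> V'" if "z \<in> V" for z
    using sp(4) that by (auto simp: bij_betw_def)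
  have "bij_betw (\<lambda>(z, t). (\<phi> z, t)) (V' \<times> (UNIV :: (bit \<times> bit) set)) (coord_space k \<times> UNIV)"
    using bij_betw_map_prod[OF bij bij_betw_id[of UNIV]] by (simp add: map_prod_def id_def)
  from bij_betw_trans[OF bij_betw_trans[OF sp(4) this] insert_pair_bij[OF r]]
  have bij': "bij_betw \<phi>' V (coord_space (k + 2))"
    by (simp add: o_def \<phi>'_def[abs_def])
  have add': "\<phi>' (z + w) i = \<phi>' z i + \<phi>' w i" if "z \<in> V" "w \<in> V" for z w i
    using that xy by (simp add: \<phi>'_def insert_pair_def sp(5) add prV' quadratic_onD[OF q])
  have q0: "q 0 = 0" by (rule quadratic_on_0[OF q F2_spaceD(2)[OF V]])
  have qpt: "q (pt a c) = a * q x + c * q y + a * c" for a c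
    by (cases a; cases c; simp add: pt_def q0 quadratic_add[of q] b)
  have "\<forall>z\<in>V. \<exists>z'\<in>V'. \<exists>a c. \<phi>' z = insert_pair r (\<phi> z') a c \<and>
              q z = q z' + (a * q x + c * q y + a * c)"
    using prV' sp(6) qpt \<phi>'_def by metis
  then show ?thesis using bij' add' unfolding V'_def coordinates_on_def by blast
qed

text \<open>
  If some vector outside the radical is singular, a hyperbolic plane through it splits off and induction applies.
  Otherwise all vectors outside the radical have value 1, and then the complement of any nondegenerate plane is the
  radical: a vector \<open>z\<close> of the complement outside the radical would give \<open>q (x + z) = q x + q z = 0\<close>. So two anisotropic planes
  never have to be combined.
\<close>

lemma quadratic_form_classification:
  fixes s :: "bit \<Rightarrow> 'v::ab_group_add \<Rightarrow> 'v"
  assumes s: "vector_space s" and V: "F2_space V" and q: "quadratic_on V q"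
    and "\<forall>x\<in>polar_radical V q. q x = 0"
  shows "\<exists>r \<phi>. even r \<and> r \<le> vector_space.dim s V \<and>
           card (polar_radical V q) * 2 ^ r = card V \<and> coordinates_on \<phi> V (vector_space.dim s V) \<and>
           ((\<forall>x\<in>V. hyperbolic_form r (\<phi> x) = q x) \<or>
            (r \<ge> 2 \<and> (\<forall>x\<in>V. elliptic_form r (\<phi> x) = q x)))"
  using V q assms(4)
proof (induction "card V" arbitrary: V rule: less_induct)
  case less
  note V = less.prems(1) and q = less.prems(2) and rad = less.prems(3)
  let ?dim = "vector_space.dim s"
  have dim_split: "?dim V = ?dim (perp V q {x, y}) + 2"
    if "x \<in> V" "y \<in> V" "polarisation q x y = 1" for x y
  proof -
    have "(2::nat) ^ ?dim V = 4 * 2 ^ ?dim (perp V q {x, y})"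
      using card_plane_split[OF V q that] card_F2_space[OF s V]
        card_F2_space[OF s plane_split(1)[OF V q that]] by simp
    also have "\<dots> = 2 ^ (?dim (perp V q {x, y}) + 2)" by simp
    finally show ?thesis by (simp only: power_inject_exp)
  qed
  show ?case
  proof (cases "\<exists>x\<in>V - polar_radical V q. q x = 0")
    case True
    then obtain x y where xy: "x \<in> V" "y \<in> V" and "polarisation q x y \<noteq> 0" and qx: "q x = 0"
      unfolding polar_radical_def by blast
    then have b: "polarisation q x y = 1" by simp
    obtain y' where y': "y' \<in> V" "polarisation q x y' = 1" "q y' = 0"
    proof (cases "q y = 0")
      case True
      then show ?thesis using that xy b by blast
    next
      case False
      then have "q (y + x) = 0"
        using qx b by (simp add: quadratic_add[of q] polarisation_commute[of q y x])
      moreover have "polarisation q x (y + x) = 1"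
        using b xy by (simp add: quadratic_onD'[OF q] polarisation_self[OF V q])
      ultimately show ?thesis using that xy F2_spaceD(3)[OF V] by blast
    qed
    let ?V' = "perp V q {x, y'}"
    note sp = plane_split[OF V q xy(1) y'(1,2)]
    have c: "card V = 4 * card ?V'" by (rule card_plane_split[OF V q xy(1) y'(1,2)])
    then have "card ?V' < card V" using F2_space_card_pos[OF V] by simp
    from less.hyps[OF this sp(1) quadratic_on_subset[OF q sp(2)]] rad sp(3)
    obtain r \<phi> where r: "even r" "r \<le> ?dim ?V'" "card (polar_radical ?V' q) * 2 ^ r = card ?V'"
      "coordinates_on \<phi> ?V' (?dim ?V')"
      "(\<forall>x\<in>?V'. hyperbolic_form r (\<phi> x) = q x) \<or>
            (r \<ge> 2 \<and> (\<forall>x\<in>?V'. elliptic_form r (\<phi> x) = q x))"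
      by auto
    from plane_coordinates[OF V q xy(1) y'(1,2) r(4,2)] obtain \<phi>' where
      \<phi>': "coordinates_on \<phi>' V (?dim ?V' + 2)"
      "\<And>z. z \<in> V \<Longrightarrow> \<exists>z'\<in>?V'. \<exists>a c. \<phi>' z = insert_pair r (\<phi> z') a c \<and> q z = q z' + a * c"
      using qx y'(3) by auto
    have "(\<forall>x\<in>V. hyperbolic_form (r + 2) (\<phi>' x) = q x) \<or>
            (r + 2 \<ge> 2 \<and> (\<forall>x\<in>V. elliptic_form (r + 2) (\<phi>' x) = q x))"
      using r(5)
    proof
      assume "\<forall>x\<in>?V'. hyperbolic_form r (\<phi> x) = q x"
      then show ?thesis using \<phi>'(2) hyperbolic_form_insert_pair[OF r(1)] by metis
    next
      assume "r \<ge> 2 \<and> (\<forall>x\<in>?V'. elliptic_form r (\<phi> x) = q x)"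
      then have "\<forall>x\<in>V. elliptic_form (r + 2) (\<phi>' x) = q x"
        using \<phi>'(2) elliptic_form_insert_pair[OF r(1)] by metis
      then show ?thesis by simp
    qed
    moreover have "card (polar_radical V q) * 2 ^ (r + 2) = card V"
      using r(3) c sp(3) by simp
    ultimately show ?thesis
      using \<phi>'(1) r(1,2) dim_split[OF xy(1) y'(1,2)]
      by (intro exI[of _ "r + 2"] exI[of _ \<phi>']) simp
  next
    case False
    then have one: "q x = 1" if "x \<in> V" "x \<notin> polar_radical V q" for x
      using that by auto
    show ?thesis
    proof (cases "polar_radical V q = V")
      case True
      obtain \<phi> where "coordinates_on \<phi> V (?dim V)" using F2_space_coordinates[OF s V] by blast
      then show ?thesis using True rad
        by (intro exI[of _ 0] exI[of _ \<phi>]) (simp add: hyperbolic_form_def)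
    next
      case False
      then obtain x y where xy: "x \<in> V" "y \<in> V" "polarisation q x y \<noteq> 0"
        unfolding polar_radical_def by blast
      then have b: "polarisation q x y = 1" by simp
      let ?V' = "perp V q {x, y}"
      note sp = plane_split[OF V q xy(1,2) b]
      have nr: "z \<notin> polar_radical V q" if "z \<in> V" "w \<in> V" "polarisation q z w = 1" for z w
        using that by (auto simp: polar_radical_def)
      have qx: "q x = 1" by (rule one[OF xy(1) nr[OF xy(1,2) b]])
      have qy: "q y = 1" using one xy(2) nr[OF xy(2,1)] b by (simp add: polarisation_commute)
      have V'rad: "?V' = polar_radical V q"
      proof (intro equalityI subsetI, rule ccontr)
        fix z assume z: "z \<in> ?V'" "z \<notin> polar_radical V q"
        then have zV: "z \<in> V" and z0: "polarisation q x z = 0" "polarisation q y z = 0"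
          by (auto simp: perp_def polarisation_commute)
        have xz: "x + z \<in> V" using F2_spaceD(3)[OF V] xy zV by blast
        have "polarisation q (x + z) y = 1"
          using z0 zV xy b by (simp add: quadratic_onD[OF q] polarisation_commute[of q z y])
        then have "q (x + z) = 1" using one xz nr[OF xz xy(2)] by blast
        then have "q z = 0" using qx z0 by (simp add: quadratic_add[of q])
        then show False using one[OF zV z(2)] by simp
      next
        fix z assume "z \<in> polar_radical V q"
        then show "z \<in> ?V'" using sp(2,3) by (auto simp: polar_radical_def)
      qed
      obtain \<phi> where \<phi>: "coordinates_on \<phi> ?V' (?dim ?V')" using F2_space_coordinates[OF s sp(1)] by blast
      from plane_coordinates[OF V q xy(1,2) b \<phi>, of 0] obtain \<phi>' where
        \<phi>': "coordinates_on \<phi>' V (?dim ?V' + 2)"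
        "\<And>z. z \<in> V \<Longrightarrow> \<exists>z'\<in>?V'. \<exists>a c. \<phi>' z = insert_pair 0 (\<phi> z') a c \<and> q z = q z' + (a + c + a * c)"
        using qx qy by auto
      have "\<forall>z\<in>V. elliptic_form 2 (\<phi>' z) = q z"
        using \<phi>'(2) V'rad rad elliptic_form_2 by (metis add_0)
      then show ?thesis
        using \<phi>'(1) card_plane_split[OF V q xy(1,2) b] V'rad dim_split[OF xy(1,2) b]
        by (intro exI[of _ 2] exI[of _ \<phi>']) simp
    qed
  qed
qed

text \<open>
  By \<open>sum_chi_square\<close> the sum is 0 if \<open>q\<close> is not zero on the radical, and otherwise has the stated absolute value. Its sign
  separates the two standard forms and is the invariant.
\<close>

theorem sum_chi_quadratic_form:
  fixes s :: "bit \<Rightarrow> 'v::ab_group_add \<Rightarrow> 'v"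
  assumes s: "vector_space s" and V: "F2_space V" and q: "quadratic_on V q"
  defines "k \<equiv> vector_space.dim s V" and "c \<equiv> vector_space.dim s (polar_radical V q)"
  shows "(\<Sum>x\<in>V. chi (q x)) = qf_epsilon s V q * 2 ^ ((k + c) div 2)"
    and "(if \<exists>x\<in>polar_radical V q. q x \<noteq> 0 then qf_epsilon s V q = 0
          else qf_epsilon s V q \<in> {1, -1} \<and> even (k + c))"
proof -
  let ?S = "\<Sum>x\<in>V. chi (q x)"
  have cV: "card V = 2 ^ k" unfolding k_def by (rule card_F2_space[OF s V])
  have cR: "card (polar_radical V q) = 2 ^ c"
    unfolding c_def by (rule card_F2_space[OF s radical_F2_space[OF V q]])
  have sq: "?S\<^sup>2 = (if \<forall>x\<in>polar_radical V q. q x = 0 then 2 ^ (k + c) else 0)"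
    using sum_chi_square[OF V q] sum_chi_radical[OF V q] by (simp add: cV cR power_add)
  have "?S = qf_epsilon s V q * 2 ^ ((k + c) div 2) \<and>
     (if \<exists>x\<in>polar_radical V q. q x \<noteq> 0 then qf_epsilon s V q = 0
          else qf_epsilon s V q \<in> {1, -1} \<and> even (k + c))"
  proof (cases "\<exists>x\<in>polar_radical V q. q x \<noteq> 0")
    case True
    then have "qf_epsilon s V q = 0" by (simp add: qf_epsilon_def)
    moreover have "\<not> (\<forall>x\<in>polar_radical V q. q x = 0)" using True by blast
    then have "?S\<^sup>2 = 0" using sq by (simp only: if_False)
    then have "?S = 0" by simp
    ultimately show ?thesis using True by (simp only: if_True) simp
  next
    case False
    then have rad: "\<forall>x\<in>polar_radical V q. q x = 0" by blast
    from quadratic_form_classification[OF s V q rad] obtain r \<phi> where r: "even r" "r \<le> k"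
      "card (polar_radical V q) * 2 ^ r = card V" and \<phi>: "coordinates_on \<phi> V k"
      and cl: "(\<forall>x\<in>V. hyperbolic_form r (\<phi> x) = q x) \<or>
            (r \<ge> 2 \<and> (\<forall>x\<in>V. elliptic_form r (\<phi> x) = q x))"
      unfolding k_def by blast
    have "(2::nat) ^ (c + r) = 2 ^ k" using r(3) by (simp add: cV cR power_add)
    then have kc: "k = c + r" by (simp only: power_inject_exp)
    then have ev: "even (k + c)" using r(1) by simp
    have kr: "k - c = r" using kc by simp
    have eps: "qf_epsilon s V q = (if isometric_to_coord s V q k (hyperbolic_form r) then 1
         else if r \<ge> 2 \<and> isometric_to_coord s V q k (elliptic_form r) then - 1 else undefined)"
      unfolding qf_epsilon_def Let_def using False kr
      by (simp only: k_def[symmetric] c_def[symmetric] if_False kr)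
    have red: "?S = (\<Sum>v\<in>coord_space k. chi (Q v))"
      if "coordinates_on \<psi> V k" "\<forall>x\<in>V. Q (\<psi> x) = q x" for \<psi> Q
    proof -
      have "?S = (\<Sum>x\<in>V. chi (Q (\<psi> x)))" using that(2) by simp
      also have "\<dots> = (\<Sum>v\<in>coord_space k. chi (Q v))"
        using that(1) sum.reindex_bij_betw[of \<psi> V "coord_space k" "\<lambda>v. chi (Q v)"]
        by (simp add: coordinates_on_def)
      finally show ?thesis .
    qed
    have sgn: "sgn ?S = qf_epsilon s V q \<and> qf_epsilon s V q \<in> {1, -1}"
    proof (cases "isometric_to_coord s V q k (hyperbolic_form r)")
      case True
      then obtain \<psi> where "coordinates_on \<psi> V k" "\<forall>x\<in>V. hyperbolic_form r (\<psi> x) = q x"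
        by (auto simp: isometric_to_coord_iff[OF s V])
      from red[OF this] sum_chi_hyperbolic_pos[OF r(1,2)] have "?S > 0" by simp
      then show ?thesis using True eps by simp
    next
      case False
      then have el: "r \<ge> 2" "\<forall>x\<in>V. elliptic_form r (\<phi> x) = q x"
        using cl \<phi> unfolding isometric_to_coord_iff[OF s V] by blast+
      then have "isometric_to_coord s V q k (elliptic_form r)"
        using \<phi> unfolding isometric_to_coord_iff[OF s V] by blast
      moreover from red[OF \<phi> el(2)] sum_chi_elliptic_neg[OF r(1) el(1) r(2)] have "?S < 0" by simp
      ultimately show ?thesis using False eps el(1) by simp
    qed
    have "?S\<^sup>2 = (2 ^ ((k + c) div 2))\<^sup>2"
      using sq rad ev by (simp flip: power_mult)
    then have "\<bar>?S\<bar> = 2 ^ ((k + c) div 2)"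
      by (metis abs_power2 power2_eq_iff_nonneg abs_ge_zero power2_abs zero_le_numeral zero_le_power)
    then have "?S = qf_epsilon s V q * 2 ^ ((k + c) div 2)"
      using sgn by (metis sgn_mult_abs)
    then show ?thesis using False sgn ev by (simp only: if_False)
  qed
  then show "?S = qf_epsilon s V q * 2 ^ ((k + c) div 2)"
    and "(if \<exists>x\<in>polar_radical V q. q x \<noteq> 0 then qf_epsilon s V q = 0
          else qf_epsilon s V q \<in> {1, -1} \<and> even (k + c))" by blast+
qed

section \<open>Finite fields of characteristic two and their traces\<close>

lemma card_roots_separable:
  fixes p :: "'a::alg_closed_field poly"
  assumes "p \<noteq> 0" "\<And>x. poly p x = 0 \<Longrightarrow> poly (pderiv p) x \<noteq> 0"
  shows "card {x. poly p x = 0} = degree p"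
  using assms
proof (induction "degree p" arbitrary: p)
  case 0
  then obtain c where "p = [:c:]" by (metis degree_eq_zeroE)
  then show ?case using 0 by simp
next
  case (Suc n)
  then obtain x where x: "poly p x = 0"
    using alg_closed_imp_poly_has_root[of p] by auto
  then obtain q where p: "p = [:-x, 1:] * q"
    by (metis dvdE poly_eq_0_iff_dvd)
  have q0: "q \<noteq> 0" using Suc.prems p by auto
  then have deg: "degree p = Suc (degree q)" by (simp add: p degree_mult_eq del: mult_pCons_left)
  have der: "poly (pderiv p) y = poly q y + (y - x) * poly (pderiv q) y" for y
  proof -
    have "pderiv [:-x, 1:] = 1" by (simp add: pderiv_pCons)
    then have "pderiv p = [:-x, 1:] * pderiv q + q" unfolding p pderiv_mult by simp
    then show ?thesis by (simp only: poly_add poly_mult) (simp add: algebra_simps)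
  qed
  have qx: "poly q x \<noteq> 0" using Suc.prems(2)[OF x] der[of x] by simp
  have "card {y. poly q y = 0} = degree q"
  proof (rule Suc.hyps(1))
    show "n = degree q" using Suc.hyps(2) deg by simp
    fix y assume y: "poly q y = 0"
    then have "poly (pderiv p) y \<noteq> 0" using Suc.prems(2)[of y] by (simp add: p)
    then show "poly (pderiv q) y \<noteq> 0" using der[of y] y by auto
  qed (use q0 in auto)
  moreover have "{y. poly p y = 0} = insert x {y. poly q y = 0}" by (auto simp: p)
  ultimately show ?case using qx poly_roots_finite[OF q0] deg by simp
qed

text \<open>
  The trace polynomial, defined on the whole algebraically closed field. On elements outside \<open>GF2 k\<close> its values need
  not lie in the prime field, and these values are used.
\<close>

definition tr :: "nat \<Rightarrow> 'a::comm_semiring_1 \<Rightarrow> 'a" where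
  "tr k x = (\<Sum>i<k. x ^ 2 ^ i)"

text \<open>
  Only applied to 0 and 1, where it is the inverse of the embedding of bits.
\<close>

definition to_bit :: "'a::zero \<Rightarrow> bit" where
  "to_bit x = (if x = 0 then 0 else 1)"

lemma to_bit_0_1 [simp]: "to_bit 0 = 0" "to_bit (1::'a::zero_neq_one) = 1"
  by (simp_all add: to_bit_def)

text \<open>
  The argument of the locale only names the field.
\<close>

locale char_two =
  fixes type_arg :: "'a::alg_closed_field itself"
  assumes char2: "CHAR('a) = 2"
begin

lemma add_self [simp]: "x + x = (0::'a)"
  using minus_CHAR_2[OF char2, of x x] by simp

lemma add_self_left [simp]: "x + (x + y) = (y::'a)"
  by (simp flip: add.assoc)

lemma add_eq_0: "x + y = 0 \<longleftrightarrow> x = (y::'a)"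
  by (metis add_self add_self_left add.right_neutral)

lemma frob_add: "(x + y) ^ 2 ^ k = x ^ 2 ^ k + (y::'a) ^ 2 ^ k"
  by (rule freshmans_dream') (simp_all add: char2)

lemma square_add: "(x + y)\<^sup>2 = x\<^sup>2 + (y::'a)\<^sup>2"
  using frob_add[of x y 1] by simp

lemma frob_sum: "(sum h A :: 'a) ^ 2 ^ k = (\<Sum>i\<in>A. h i ^ 2 ^ k)"
  by (rule freshmans_dream_sum') (simp_all add: char2)

lemma square_sum: "(sum h A :: 'a)\<^sup>2 = (\<Sum>i\<in>A. (h i)\<^sup>2)"
  using frob_sum[of h A 1] by simp

lemma frob_inj: "x ^ 2 ^ k = y ^ 2 ^ k \<longleftrightarrow> x = (y::'a)"
proof
  assume "x ^ 2 ^ k = y ^ 2 ^ k"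
  then have "(x + y) ^ 2 ^ k = 0" by (simp add: frob_add)
  then have "x + y = 0" by simp
  then show "x = y" by (simp add: add_eq_0)
qed simp

lemma frob_frob: "((x::'a) ^ 2 ^ i) ^ 2 ^ j = x ^ 2 ^ (i + j)"
  by (simp add: power_add flip: power_mult)

lemma GF2_closed:
  assumes "(x::'a) \<in> GF2 k" "y \<in> GF2 k"
  shows "x + y \<in> GF2 k" "x * y \<in> GF2 k" "x ^ n \<in> GF2 k"
  using assms
  by (auto simp: GF2_def frob_add power_mult_distrib power_mult[symmetric] mult.commute[of n])
     (simp add: power_mult)

lemma GF2_0_1 [simp]: "(0::'a) \<in> GF2 k" "1 \<in> GF2 k"
  by (simp_all add: GF2_def)

lemma GF2_mult_subset: "(x::'a) \<in> GF2 j \<Longrightarrow> x \<in> GF2 (j * t)"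
proof (induction t)
  case (Suc t)
  then show ?case using frob_frob[of x j "j * t"] by (simp add: GF2_def)
qed (simp add: GF2_def)

text \<open>
  By a Bezout identity \<open>j u = k v + gcd j k\<close> the Frobenius for \<open>gcd j k\<close> fixes \<open>x\<close>.
\<close>

lemma GF2_gcd:
  assumes "j > 0" "(x::'a) \<in> GF2 j" "x \<in> GF2 k"
  shows "x \<in> GF2 (gcd j k)"
proof -
  obtain u v where uv: "j * u = k * v + gcd j k"
    using bezout_nat[of j k] assms(1) by auto
  have "x = x ^ 2 ^ (k * v + gcd j k)"
    using GF2_mult_subset[OF assms(2), of u] uv by (simp add: GF2_def)
  also have "\<dots> = (x ^ 2 ^ (k * v)) ^ 2 ^ gcd j k" by (simp add: frob_frob)
  also have "x ^ 2 ^ (k * v) = x" using GF2_mult_subset[OF assms(3), of v] by (simp add: GF2_def)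
  finally show ?thesis by (simp add: GF2_def)
qed

lemma card_GF2:
  assumes "k > 0"
  shows "finite (GF2 k :: 'a set)" "card (GF2 k :: 'a set) = 2 ^ k"
proof -
  define p :: "'a poly" where "p = Polynomial.monom 1 (2 ^ k) + Polynomial.monom 1 1"
  have roots: "GF2 k = {x. poly p x = 0}"
    by (simp add: GF2_def p_def poly_monom add_eq_0)
  have lt: "(1::nat) < 2 ^ k" using assms by (intro one_less_power) auto
  then have deg: "degree p = 2 ^ k"
    unfolding p_def by (subst degree_add_eq_left) (simp_all add: degree_monom_eq)
  then have p0: "p \<noteq> 0" using lt by (metis degree_0 less_numeral_extra(1) not_less_zero power_eq_0_iff zero_less_numeral zero_less_power)
  have "of_nat (2 ^ k) = (0::'a)"
    using assms by (subst of_nat_eq_0_iff_char_dvd) (simp add: char2)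
  then have "pderiv p = 1"
    using assms by (simp add: p_def pderiv_add pderiv_monom monom_0 power_0_left)
  then show "finite (GF2 k :: 'a set)" "card (GF2 k :: 'a set) = 2 ^ k"
    using card_roots_separable[OF p0] poly_roots_finite[OF p0] by (simp_all add: roots deg)
qed

lemma F2_space_GF2: "k > 0 \<Longrightarrow> F2_space (GF2 k :: 'a set)"
  by (auto simp: F2_space_def card_GF2 GF2_closed)

lemma of_bit_vector_space: "vector_space (\<lambda>c x. of_bit c * (x::'a))"
proof
  show "of_bit (c + e) * x = of_bit c * x + of_bit e * x" for c e and x :: 'a
    by (cases c; cases e) simp_all
  show "of_bit c * (of_bit e * x) = of_bit (c * e) * x" for c e and x :: 'a
    by (cases c; cases e) simp_all
qed (simp_all add: algebra_simps)

lemma tr_add: "tr k (x + y) = tr k x + tr k (y::'a)"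
  by (simp add: tr_def frob_add sum.distrib)

lemma tr_0 [simp]: "tr k (0::'a) = 0"
  by (simp add: tr_def power_0_left)

text \<open>
  The sum telescopes. This turns every Artin-Schreier identity below into a Frobenius coboundary.
\<close>

lemma tr_artin_schreier: "tr k (x\<^sup>2 + x) = x ^ 2 ^ k + (x::'a)"
proof (induction k)
  case (Suc k)
  have "(x\<^sup>2 + x) ^ 2 ^ k = x ^ 2 ^ Suc k + x ^ 2 ^ k"
    by (simp add: frob_add flip: power_mult)
  moreover have "tr (Suc k) (x\<^sup>2 + x) = tr k (x\<^sup>2 + x) + (x\<^sup>2 + x) ^ 2 ^ k" by (simp add: tr_def)
  ultimately have "tr (Suc k) (x\<^sup>2 + x) = (x ^ 2 ^ k + x) + (x ^ 2 ^ Suc k + x ^ 2 ^ k)"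
    unfolding Suc.IH by metis
  then show ?case by (simp only: add.commute[of _ x] add.left_commute add.assoc add_self add_self_left) (simp add: algebra_simps)
qed (simp add: tr_def)

lemma tr_square: "(tr k x)\<^sup>2 = tr k ((x::'a)\<^sup>2)"
  by (simp add: tr_def square_sum mult.commute flip: power_mult)

lemma tr_frob: "(tr k x) ^ 2 ^ j = tr k ((x::'a) ^ 2 ^ j)"
  by (simp add: tr_def frob_sum frob_frob add.commute)

lemma tr_fixed: "(tr k x)\<^sup>2 + tr k x = x ^ 2 ^ k + (x::'a)"
  using tr_artin_schreier[of k x] by (simp add: tr_square tr_add)

lemma tr_append: "tr (j + k) x = tr j x + tr k ((x::'a) ^ 2 ^ j)"
proof (induction k)
  case (Suc k)
  then show ?case by (simp add: tr_def frob_frob algebra_simps)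
qed (simp add: tr_def)

lemma bit_val_iff: "x \<in> {0, 1} \<longleftrightarrow> x\<^sup>2 + x = (0::'a)"
proof -
  have "x\<^sup>2 + x = x * (x + 1)" by (simp add: algebra_simps power2_eq_square)
  then show ?thesis by (auto simp: add_eq_0)
qed

lemma bit_val_add: "x \<in> {0, 1} \<Longrightarrow> y \<in> {0, 1} \<Longrightarrow> x + y \<in> {0, 1::'a}"
  by auto

lemma to_bit_add: "x \<in> {0, 1} \<Longrightarrow> y \<in> {0, 1} \<Longrightarrow> to_bit (x + y) = to_bit x + to_bit (y::'a)"
  by auto

lemma to_bit_eq_0: "to_bit x = 0 \<longleftrightarrow> x = (0::'a)"
  by (simp add: to_bit_def)

lemma tr_bit_val: "(x::'a) \<in> GF2 k \<Longrightarrow> tr k x \<in> {0, 1}"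
  using tr_fixed[of k x] unfolding bit_val_iff by (simp add: GF2_def)

lemma GF2_trace_eq:
  assumes "(x::'a) \<in> GF2 k"
  shows "GF2_trace k x = to_bit (tr k x)"
proof -
  have "of_bit c = y \<longleftrightarrow> c = to_bit y" if "y \<in> {0, 1::'a}" for c y
    using that by (cases c) auto
  then show ?thesis
    using tr_bit_val[OF assms] by (simp add: GF2_trace_def flip: tr_def)
qed

lemma tr_conj: "(x::'a) \<in> GF2 k \<Longrightarrow> tr k (x ^ 2 ^ j) = tr k x"
  by (metis tr_frob bit_val_iff insert_iff power_one power_0_left singletonD tr_bit_val power_eq_0_iff zero_neq_numeral zero_power)

text \<open>
  The trace polynomial has degree \<open>2^(k - 1)\<close>, too small to vanish on the whole field.
\<close>

lemma tr_nondegenerate: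
  assumes k: "k > 0" and x: "(x::'a) \<noteq> 0" "x \<in> GF2 k"
  shows "\<exists>y\<in>GF2 k. tr k (x * y) \<noteq> 0"
proof (rule ccontr)
  assume no: "\<not> ?thesis"
  have "tr k z = 0" if z: "z \<in> GF2 k" for z :: 'a
  proof -
    have "inverse x \<in> GF2 k" using x(2) by (simp add: GF2_def power_inverse)
    then have "inverse x * z \<in> GF2 k" using z GF2_closed by blast
    then show ?thesis using no x(1) by (auto simp flip: mult.assoc)
  qed
  define p :: "'a poly" where "p = (\<Sum>i<k. Polynomial.monom 1 (2 ^ i))"
  have "poly p z = tr k z" for z by (simp add: p_def tr_def poly_sum poly_monom)
  then have sub: "GF2 k \<subseteq> {z. poly p z = 0}" using \<open>\<And>z. z \<in> GF2 k \<Longrightarrow> tr k z = 0\<close> by auto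
  have "coeff p (2 ^ (k - 1)) = (\<Sum>i<k. if i = k - 1 then 1 else 0)"
    by (simp add: p_def coeff_sum)
  also have "\<dots> = 1" using k by simp
  finally have p0: "p \<noteq> 0" by auto
  have "degree p \<le> 2 ^ (k - 1)"
    unfolding p_def by (rule degree_sum_le) (auto simp: degree_monom_eq)
  moreover have "card (GF2 k :: 'a set) \<le> degree p"
    using card_mono[OF poly_roots_finite[OF p0] sub] card_poly_roots_bound[OF p0] by linarith
  moreover have "(2::nat) ^ (k - 1) < 2 ^ k" using k by (intro power_strict_increasing) auto
  ultimately show False using card_GF2(2)[OF k] by linarith
qed

lemma frob_surj_GF2:
  assumes "k > 0" shows "(\<lambda>x. x ^ 2 ^ j) ` (GF2 k :: 'a set) = GF2 k"
  by (rule endo_inj_surj) (auto simp: assms card_GF2 GF2_closed inj_on_def frob_inj)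

end

section \<open>The trace forms and the root space\<close>

locale artin_schreier_form = char_two type_arg for type_arg :: "'a::alg_closed_field itself" +
  fixes m d :: nat and a :: "nat \<Rightarrow> 'a"
  assumes m_pos: "m > 0" and m_even: "even m" and d_pos: "d > 0"
    and a_GF2: "\<And>i. i \<le> d \<Longrightarrow> a i \<in> GF2 m" and a_d: "a d \<noteq> 0"
begin

definition R :: "'a \<Rightarrow> 'a" where
  "R x = (\<Sum>i\<le>d. a i * x ^ 2 ^ i)"

definition f :: "'a \<Rightarrow> 'a" where
  "f x = x * R x"

definition Rt :: "'a \<Rightarrow> 'a" where
  "Rt x = (\<Sum>i\<le>d. a i ^ 2 ^ d * x ^ 2 ^ (d + i) + a i ^ 2 ^ (d - i) * x ^ 2 ^ (d - i))"

text \<open>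
  The coefficients of the additive polynomial \<open>g w\<close>, obtained by comparing coefficients in
  \<open>g(w,x)^2 + g(w,x) = x R(w) + w R(x)\<close>. The recursion is solvable with \<open>d\<close> coefficients exactly if the next value
  \<open>g_coeff d w\<close> is 0, and this value is \<open>Rt w\<close>.
\<close>

primrec g_coeff :: "nat \<Rightarrow> 'a \<Rightarrow> 'a" where
  "g_coeff 0 w = (\<Sum>i<d. a (Suc i) * w ^ 2 ^ Suc i)"
| "g_coeff (Suc i) w = (g_coeff i w)\<^sup>2 + a (Suc i) * w"

definition g :: "'a \<Rightarrow> 'a \<Rightarrow> 'a" where
  "g w x = (\<Sum>i<d. g_coeff i w * x ^ 2 ^ i)"

abbreviation F :: "nat \<Rightarrow> 'a set" where
  "F n \<equiv> GF2 (m * n)"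

definition W :: "'a set" where
  "W = {x. Rt x = 0}"

text \<open>
  On \<open>F n\<close> this is the form of the statement; the value \<open>to_bit\<close> agrees there with the trace to the prime field.
\<close>

definition q :: "nat \<Rightarrow> 'a \<Rightarrow> bit" where
  "q n x = to_bit (tr (m * n) (f x))"

text \<open>
  The squaring map of the extraspecial group of lifts of translations by \<open>W\<close>; its polarisation is the commutator
  pairing.
\<close>

definition kappa :: "'a \<Rightarrow> bit" where
  "kappa w = to_bit (g w w)"

abbreviation frob :: "nat \<Rightarrow> 'a \<Rightarrow> 'a" where
  "frob n x \<equiv> x ^ 2 ^ (m * n)"

lemma R_split: "R x = a 0 * x + (\<Sum>i<d. a (Suc i) * x ^ 2 ^ Suc i)"
  unfolding R_def lessThan_Suc_atMost[symmetric] by (subst sum.lessThan_Suc_shift) simp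

lemma R_add: "R (x + y) = R x + R y"
  by (simp add: R_def frob_add algebra_simps sum.distrib)

lemma Rt_add: "Rt (x + y) = Rt x + Rt y"
  by (simp add: Rt_def frob_add algebra_simps sum.distrib)

lemma Rt_0: "Rt 0 = 0"
  using Rt_add[of 0 0] by simp

lemma f_add: "f (x + y) = f x + f y + (x * R y + y * R x)"
  by (simp add: f_def R_add algebra_simps)

lemma f_0: "f 0 = 0" by (simp add: f_def)

lemma g_coeff_add: "g_coeff i (w + x) = g_coeff i w + g_coeff i x"
  by (induction i)
     (simp_all add: frob_add square_add algebra_simps sum.distrib del: power_Suc)

lemma g_add_left: "g (w + w') x = g w x + g w' x"
  by (simp add: g_def g_coeff_add algebra_simps sum.distrib)

lemma g_add_right: "g w (x + y) = g w x + g w y"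
  by (simp add: g_def frob_add algebra_simps sum.distrib)

lemma g_0 [simp]: "g 0 x = 0" "g w 0 = 0"
  using g_add_left[of 0 0 x] g_add_right[of w 0 0] by simp_all

lemma g_coeff_closed_form:
  "g_coeff i w = (\<Sum>k<i. (a (Suc k) * w) ^ 2 ^ (i - Suc k)) + (g_coeff 0 w) ^ 2 ^ i"
proof (induction i)
  case (Suc i)
  have "(\<Sum>k<Suc i. (a (Suc k) * w) ^ 2 ^ (Suc i - Suc k))
      = (\<Sum>k<i. ((a (Suc k) * w) ^ 2 ^ (i - Suc k))\<^sup>2) + a (Suc i) * w"
  proof -
    have "(a (Suc k) * w) ^ 2 ^ (Suc i - Suc k) = ((a (Suc k) * w) ^ 2 ^ (i - Suc k))\<^sup>2" if "k < i" for k
    proof -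
      have "Suc i - Suc k = Suc (i - Suc k)" using that by simp
      then show ?thesis by (simp add: mult.commute[of 2] flip: power_mult)
    qed
    then show ?thesis by simp
  qed
  moreover have "g_coeff 0 w ^ 2 ^ Suc i = (g_coeff 0 w ^ 2 ^ i)\<^sup>2"
    by (simp add: mult.commute[of 2] del: g_coeff.simps flip: power_mult)
  ultimately show ?case
    by (simp only: g_coeff.simps(2) Suc square_add square_sum) (simp add: algebra_simps del: g_coeff.simps)
qed simp

lemma g_coeff_d_eq_Rt: "g_coeff d w = Rt w"
proof -
  have "Rt w = (\<Sum>i\<in>{..<Suc d}. a i ^ 2 ^ d * w ^ 2 ^ (d + i) + a i ^ 2 ^ (d - i) * w ^ 2 ^ (d - i))"
    by (simp add: Rt_def lessThan_Suc_atMost)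
  also have "\<dots> = (\<Sum>i<d. a (Suc i) ^ 2 ^ d * w ^ 2 ^ (d + Suc i)
      + a (Suc i) ^ 2 ^ (d - Suc i) * w ^ 2 ^ (d - Suc i))"
    by (subst sum.lessThan_Suc_shift) simp
  also have "\<dots> = (\<Sum>i<d. a (Suc i) ^ 2 ^ d * w ^ 2 ^ (d + Suc i))
      + (\<Sum>i<d. (a (Suc i) * w) ^ 2 ^ (d - Suc i))"
    by (simp add: sum.distrib power_mult_distrib)
  also have "(\<Sum>i<d. a (Suc i) ^ 2 ^ d * w ^ 2 ^ (d + Suc i)) = (g_coeff 0 w) ^ 2 ^ d"
    by (simp add: frob_sum power_mult_distrib frob_frob add.commute[of d] del: power_Suc add_Suc_right)
  finally show ?thesis by (subst g_coeff_closed_form) (simp add: add.commute)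
qed

lemma telescope: "(\<Sum>i<n. h (Suc i)) + (\<Sum>i<n. h i) = h n + (h 0 :: 'a)"
  by (induction n) (simp_all add: algebra_simps)

text \<open>
  Squaring shifts the coefficients by one place, so \<open>g^2 + g\<close> telescopes and only the boundary terms \<open>g_coeff 0\<close> and
  \<open>g_coeff d\<close> remain besides \<open>w R(x)\<close>.
\<close>

lemma g_artin_schreier: "(g w x)\<^sup>2 + g w x = x * R w + w * R x + Rt w * x ^ 2 ^ d"
proof -
  have "(g w x)\<^sup>2 = (\<Sum>i<d. (g_coeff i w)\<^sup>2 * x ^ 2 ^ Suc i)"
    by (simp add: g_def square_sum power_mult_distrib mult.commute[of 2] flip: power_mult)
  also have "\<dots> = (\<Sum>i<d. g_coeff (Suc i) w * x ^ 2 ^ Suc i + w * (a (Suc i) * x ^ 2 ^ Suc i))"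
    by (intro sum.cong refl) (simp add: algebra_simps)
  also have "\<dots> = (\<Sum>i<d. g_coeff (Suc i) w * x ^ 2 ^ Suc i) + w * (\<Sum>i<d. a (Suc i) * x ^ 2 ^ Suc i)"
    by (simp only: sum.distrib sum_distrib_left)
  also have "(\<Sum>i<d. a (Suc i) * x ^ 2 ^ Suc i) = R x + a 0 * x"
    by (simp add: R_split algebra_simps)
  finally have "(g w x)\<^sup>2 + g w x = w * (R x + a 0 * x)
      + ((\<Sum>i<d. g_coeff (Suc i) w * x ^ 2 ^ Suc i) + (\<Sum>i<d. g_coeff i w * x ^ 2 ^ i))"
    by (simp only: g_def add.commute add.left_commute)
  also have "(\<Sum>i<d. g_coeff (Suc i) w * x ^ 2 ^ Suc i) + (\<Sum>i<d. g_coeff i w * x ^ 2 ^ i)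
      = Rt w * x ^ 2 ^ d + g_coeff 0 w * x"
    using telescope[of "\<lambda>i. g_coeff i w * x ^ 2 ^ i" d] by (simp add: g_coeff_d_eq_Rt del: g_coeff.simps)
  also have "g_coeff 0 w = R w + a 0 * w"
    by (simp add: R_split algebra_simps)
  finally show ?thesis by (simp add: algebra_simps)
qed

lemma a_frob: "i \<le> d \<Longrightarrow> frob n (a i) = a i"
  using GF2_mult_subset[OF a_GF2] by (simp add: GF2_def)

lemma R_frob: "R (frob n x) = frob n (R x)"
  by (simp add: R_def frob_sum power_mult_distrib a_frob frob_frob add.commute)

lemma f_frob: "f (frob n x) = frob n (f x)"
  by (simp add: f_def R_frob power_mult_distrib)

lemma power_swap: "((y::'a) ^ i) ^ j = (y ^ j) ^ i"
  by (metis power_mult mult.commute)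

lemma Rt_frob: "Rt (frob n x) = frob n (Rt x)"
proof -
  have fr: "frob n (a i ^ j) = a i ^ j" if "i \<le> d" for i j
    using a_frob[OF that] by (metis power_swap)
  show ?thesis
    unfolding Rt_def frob_sum
    by (intro sum.cong refl) (simp add: frob_add power_mult_distrib fr power_swap[of x "2 ^ (m * n)"])
qed

lemma g_coeff_frob: "i \<le> d \<Longrightarrow> g_coeff i (frob n w) = frob n (g_coeff i w)"
proof (induction i)
  case 0
  show ?case
    unfolding g_coeff.simps frob_sum
    by (intro sum.cong refl) (simp add: power_mult_distrib a_frob power_swap[of w "2 ^ (m * n)"])
next
  case (Suc i)
  then show ?case by (simp add: frob_add power_mult_distrib a_frob power_swap[of _ 2])
qed

lemma g_frob: "g (frob n w) (frob n x) = frob n (g w x)"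
  unfolding g_def frob_sum
  by (intro sum.cong refl) (simp add: power_mult_distrib g_coeff_frob power_swap[of x "2 ^ (m * n)"])

lemma R_closed: "x \<in> F n \<Longrightarrow> R x \<in> F n" and f_closed: "x \<in> F n \<Longrightarrow> f x \<in> F n"
  and Rt_closed: "x \<in> F n \<Longrightarrow> Rt x \<in> F n"
  using R_frob[of x n] f_frob[of x n] Rt_frob[of x n] by (simp_all add: GF2_def)

lemma g_closed: "w \<in> F n \<Longrightarrow> x \<in> F n \<Longrightarrow> g w x \<in> F n"
  using g_frob[of w n x] by (simp add: GF2_def)

lemma F_pos: "n > 0 \<Longrightarrow> m * n > 0"
  using m_pos by simp

lemmas F_F2_space = F2_space_GF2[OF F_pos]

lemma WD: "w \<in> W \<Longrightarrow> Rt w = 0" by (simp add: W_def)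

lemma W_frob: "frob n w \<in> W \<longleftrightarrow> w \<in> W"
  by (simp add: W_def Rt_frob)

lemma f_add_W:
  assumes "w \<in> W"
  shows "f (w + x) = f w + f x + ((g w x)\<^sup>2 + g w x)"
  by (simp only: f_add g_artin_schreier WD[OF assms] mult_zero_left add_0_right add.commute[of "x * R w"])

text \<open>
  Translation by \<open>W\<close> changes the trace of \<open>f\<close> by a Frobenius coboundary.
\<close>

lemma tr_f_add_W:
  assumes "w \<in> W"
  shows "tr k (f (w + x)) = tr k (f w) + tr k (f x) + ((g w x) ^ 2 ^ k + g w x)"
  by (simp only: f_add_W[OF assms] tr_add[of _ _ "(g w x)\<^sup>2 + g w x"] tr_artin_schreier tr_add[of _ "f w"])

lemma g_self_bit_val: "w \<in> W \<Longrightarrow> g w w \<in> {0, 1}"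
  unfolding bit_val_iff by (simp add: g_artin_schreier WD)

lemma g_comm_bit_val:
  assumes "w \<in> W" "x \<in> W"
  shows "g w x + g x w \<in> {0, 1}"
proof -
  have "(g w x + g x w)\<^sup>2 + (g w x + g x w) = ((g w x)\<^sup>2 + g w x) + ((g x w)\<^sup>2 + g x w)"
    by (simp add: square_add algebra_simps)
  also have "\<dots> = (x * R w + w * R x) + (w * R x + x * R w)"
    by (simp only: g_artin_schreier WD[OF assms(1)] WD[OF assms(2)] mult_zero_left add_0_right)
  also have "\<dots> = 0" by (simp add: add.commute)
  finally show ?thesis unfolding bit_val_iff .
qed

definition Rt_poly :: "'a poly" where
  "Rt_poly = (\<Sum>i\<le>d. Polynomial.monom (a i ^ 2 ^ d) (2 ^ (d + i))
                + Polynomial.monom (a i ^ 2 ^ (d - i)) (2 ^ (d - i)))"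

lemma poly_Rt_poly: "poly Rt_poly x = Rt x"
  by (simp add: Rt_poly_def Rt_def poly_sum poly_monom)

lemma coeff_Rt_poly:
  "coeff Rt_poly j = (\<Sum>i\<le>d. (if 2 ^ (d + i) = j then a i ^ 2 ^ d else 0)
      + (if 2 ^ (d - i) = j then a i ^ 2 ^ (d - i) else 0))"
  by (simp add: Rt_poly_def coeff_sum)

lemma degree_Rt_poly: "Polynomial.degree Rt_poly = 2 ^ (2 * d)"
proof (rule antisym)
  show "Polynomial.degree Rt_poly \<le> 2 ^ (2 * d)"
    unfolding Rt_poly_def
    by (intro degree_sum_le degree_add_le order.trans[OF degree_monom_le]) (auto intro: power_increasing)
  have "coeff Rt_poly (2 ^ (2 * d)) = (\<Sum>i\<le>d. if i = d then a d ^ 2 ^ d else 0)"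
    unfolding coeff_Rt_poly
    by (intro sum.cong refl) (use d_pos in \<open>auto simp: power_inject_exp\<close>)
  then have "coeff Rt_poly (2 ^ (2 * d)) \<noteq> 0" using a_d by simp
  then show "2 ^ (2 * d) \<le> Polynomial.degree Rt_poly" by (rule le_degree)
qed

lemma pderiv_sum: "pderiv (sum h A) = (\<Sum>i\<in>A. pderiv (h i :: 'a poly))"
  by (induction A rule: infinite_finite_induct) (simp_all add: pderiv_add)

lemma pderiv_Rt_poly: "pderiv Rt_poly = [:a d:]"
proof -
  have 2: "(2::'a) = 0" using add_self[of 1] unfolding one_add_one .
  have "pderiv Rt_poly = (\<Sum>i\<le>d. if i = d then [:a d:] else 0)"
    unfolding Rt_poly_def pderiv_sum
  proof (intro sum.cong refl)
    fix i assume "i \<in> {..d}"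
    then have "i \<le> d" by simp
    then show "pderiv (Polynomial.monom (a i ^ 2 ^ d) (2 ^ (d + i))
                + Polynomial.monom (a i ^ 2 ^ (d - i)) (2 ^ (d - i)))
             = (if i = d then [:a d:] else 0)"
      using d_pos by (auto simp: pderiv_add pderiv_monom 2 power_0_left monom_0)
  qed
  then show ?thesis by simp
qed

text \<open>
  \<open>Rt\<close> has degree \<open>2^(2 d)\<close> and constant derivative \<open>a d\<close>, coming from its linear term.
\<close>

lemma card_W: "finite W" "card W = 2 ^ (2 * d)"
proof -
  have p0: "Rt_poly \<noteq> 0" using degree_Rt_poly by auto
  show "finite W" using poly_roots_finite[OF p0] by (simp add: W_def poly_Rt_poly)
  show "card W = 2 ^ (2 * d)"
    using card_roots_separable[OF p0] a_d by (simp add: W_def poly_Rt_poly pderiv_Rt_poly degree_Rt_poly)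
qed

lemma W_F2_space: "F2_space W"
  using card_W(1) by (auto simp: F2_space_def W_def Rt_add Rt_0)

lemma kappa_polar:
  assumes "w \<in> W" "x \<in> W"
  shows "polarisation kappa w x = to_bit (g w x + g x w)"
proof -
  have wx: "w + x \<in> W" using assms F2_spaceD(3)[OF W_F2_space] by blast
  have "polarisation kappa w x = to_bit (g (w + x) (w + x) + g w w + g x x)"
    unfolding polarisation_def kappa_def
    using g_self_bit_val[OF assms(1)] g_self_bit_val[OF assms(2)] g_self_bit_val[OF wx]
    by (simp only: to_bit_add bit_val_add)
  also have "g (w + x) (w + x) + g w w + g x x = g w x + g x w"
    by (simp add: g_add_left g_add_right algebra_simps)
  finally show ?thesis .
qed

lemma kappa_quadratic: "quadratic_on W kappa"
  unfolding quadratic_on_def additive_on_def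
proof (intro ballI)
  fix z x y assume *: "z \<in> W" "x \<in> W" "y \<in> W"
  have xy: "x + y \<in> W" using * F2_spaceD(3)[OF W_F2_space] by blast
  have "g (x + y) z + g z (x + y) = (g x z + g z x) + (g y z + g z y)"
    by (simp add: g_add_left g_add_right algebra_simps)
  then show "polarisation kappa (x + y) z = polarisation kappa x z + polarisation kappa y z"
    using * xy g_comm_bit_val by (simp only: kappa_polar to_bit_add)
qed

lemma kappa_frob: "w \<in> W \<Longrightarrow> kappa (frob n w) = kappa w"
  using g_self_bit_val[of w] m_pos by (auto simp: kappa_def g_frob power_0_left)

lemma kappa_polar_frob:
  assumes "w \<in> W" "x \<in> W"
  shows "polarisation kappa (frob n w) (frob n x) = polarisation kappa w x"
  using assms F2_spaceD(3)[OF W_F2_space, of w x] by (simp add: polarisation_def kappa_frob flip: frob_add)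

lemma tr_f_bit_val: "x \<in> F n \<Longrightarrow> tr (m * n) (f x) \<in> {0, 1}"
  by (rule tr_bit_val[OF f_closed])

text \<open>
  The two sides differ by the trace of \<open>g^2 + g\<close>, which vanishes on \<open>F n\<close>. This is the adjoint form of the pairing.
\<close>

lemma tr_polar:
  assumes "x \<in> F n" "y \<in> F n"
  shows "tr (m * n) (x * R y + y * R x) = tr (m * n) (Rt x * y ^ 2 ^ d)"
proof -
  have "tr (m * n) ((g x y)\<^sup>2 + g x y) = 0"
    using g_closed[OF assms] by (simp add: tr_artin_schreier GF2_def)
  then have "tr (m * n) (x * R y + y * R x) + tr (m * n) (Rt x * y ^ 2 ^ d) = 0"
    by (simp only: g_artin_schreier tr_add[of _ _ "Rt x * y ^ 2 ^ d"] add.commute[of "y * R x"])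
  then show ?thesis by (simp only: add_eq_0)
qed

lemma q_polar:
  assumes "x \<in> F n" "y \<in> F n"
  shows "polarisation (q n) x y = to_bit (tr (m * n) (x * R y + y * R x))"
proof -
  have xy: "x + y \<in> F n" using assms by (rule GF2_closed)
  have "polarisation (q n) x y = to_bit (tr (m * n) (f (x + y)) + tr (m * n) (f x) + tr (m * n) (f y))"
    unfolding polarisation_def q_def
    using tr_f_bit_val[OF assms(1)] tr_f_bit_val[OF assms(2)] tr_f_bit_val[OF xy]
    by (simp only: to_bit_add bit_val_add)
  also have "tr (m * n) (f (x + y)) + tr (m * n) (f x) + tr (m * n) (f y)
      = tr (m * n) (f (x + y) + f x + f y)" by (simp add: tr_add)
  also have "f (x + y) + f x + f y = x * R y + y * R x"
    by (simp add: f_add algebra_simps)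
  finally show ?thesis .
qed

lemma polar_closed: "x \<in> F n \<Longrightarrow> y \<in> F n \<Longrightarrow> x * R y + y * R x \<in> F n"
  by (intro GF2_closed R_closed)

lemma q_quadratic: "quadratic_on (F n) (q n)"
  unfolding quadratic_on_def additive_on_def
proof (intro ballI)
  fix z x y assume *: "z \<in> F n" "x \<in> F n" "y \<in> F n"
  have xy: "x + y \<in> F n" using * GF2_closed by blast
  have "(x + y) * R z + z * R (x + y) = (x * R z + z * R x) + (y * R z + z * R y)"
    by (simp add: R_add algebra_simps)
  moreover have "to_bit (tr (m * n) ((x * R z + z * R x) + (y * R z + z * R y)))
     = to_bit (tr (m * n) (x * R z + z * R x)) + to_bit (tr (m * n) (y * R z + z * R y))"
    unfolding tr_add[of _ "x * R z + z * R x"]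
    by (rule to_bit_add) (use * polar_closed tr_bit_val in blast)+
  ultimately show "polarisation (q n) (x + y) z = polarisation (q n) x z + polarisation (q n) y z"
    using * xy by (simp only: q_polar)
qed

lemma q_radical:
  assumes n: "n > 0"
  shows "polar_radical (F n) (q n) = W \<inter> F n"
proof (intro equalityI subsetI IntI)
  fix x assume x: "x \<in> polar_radical (F n) (q n)"
  then show xF: "x \<in> F n" by (simp add: polar_radical_def)
  have "tr (m * n) (Rt x * z) = 0" if z: "z \<in> F n" for z
  proof -
    obtain y where y: "y \<in> F n" "z = y ^ 2 ^ d"
      using frob_surj_GF2[OF F_pos[OF n], of d] z by blast
    have "to_bit (tr (m * n) (x * R y + y * R x)) = 0"
      using x y by (simp add: polar_radical_def flip: q_polar)
    then show ?thesis using tr_polar[OF xF y(1)] y(2) by (simp only: to_bit_eq_0)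
  qed
  then show "x \<in> W"
    using tr_nondegenerate[OF F_pos[OF n] _ Rt_closed[OF xF]] by (auto simp: W_def)
next
  fix x assume "x \<in> W \<inter> F n"
  then show "x \<in> polar_radical (F n) (q n)"
    by (auto simp: polar_radical_def q_polar tr_polar WD)
qed

abbreviation W_in :: "nat \<Rightarrow> 'a set" where "W_in n \<equiv> W \<inter> F n"

lemma W_in_F2_space: "n > 0 \<Longrightarrow> F2_space (W_in n)"
  using F2_spaceD[OF W_F2_space] F2_spaceD[OF F_F2_space[of n]] by (simp add: F2_space_def)

definition eps :: "nat \<Rightarrow> int" where
  "eps n = qf_epsilon (\<lambda>c x. of_bit c * x) (F n) (q n)"

definition rad_dim :: "nat \<Rightarrow> nat" where
  "rad_dim n = vector_space.dim (\<lambda>c x. of_bit c * x) (W_in n)"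

text \<open>
  \<open>S n\<close> is the exponential sum of \<open>f\<close> over \<open>F n\<close>; \<open>T n\<close> below is its normalisation by \<open>2^(m n / 2)\<close>. The halved
  exponent in \<open>T n\<close> is exact whenever \<open>eps n\<close> is nonzero.
\<close>

definition S :: "nat \<Rightarrow> int" where
  "S n = (\<Sum>x\<in>F n. chi (q n x))"

definition T :: "nat \<Rightarrow> int" where
  "T n = eps n * 2 ^ (rad_dim n div 2)"

lemma card_W_in: "n > 0 \<Longrightarrow> card (W_in n) = 2 ^ rad_dim n"
  unfolding rad_dim_def by (rule card_F2_space[OF of_bit_vector_space W_in_F2_space])

lemma dim_F:
  assumes n: "n > 0" shows "vector_space.dim (\<lambda>c x. of_bit c * x) (F n) = m * n"
proof -
  have "card (F n) = 2 ^ vector_space.dim (\<lambda>c x. of_bit c * x) (F n)"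
    by (rule card_F2_space[OF of_bit_vector_space F_F2_space[OF n]])
  then have "2 ^ vector_space.dim (\<lambda>c x. of_bit c * x) (F n) = (2::nat) ^ (m * n)"
    using card_GF2(2)[OF F_pos[OF n]] by simp
  then show ?thesis by (simp only: power_inject_exp)
qed

lemma S_eq_T:
  assumes n: "n > 0" shows "S n = T n * 2 ^ (m div 2 * n)"
proof -
  obtain h where h: "m = 2 * h" using m_even by blast
  have e: "(m * n + rad_dim n) div 2 = h * n + rad_dim n div 2" by (simp add: h)
  have "S n = eps n * 2 ^ ((m * n + rad_dim n) div 2)"
    unfolding S_def eps_def rad_dim_def
    using sum_chi_quadratic_form(1)[OF of_bit_vector_space F_F2_space[OF n] q_quadratic]
    by (simp only: dim_F[OF n] q_radical[OF n])
  moreover have "m div 2 = h" using h by simp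
  ultimately show ?thesis by (simp only: e T_def power_add mult.assoc mult.commute[of "2 ^ (h * n)"])
qed

lemma eps_cases:
  assumes n: "n > 0"
  shows "eps n = 0 \<and> (\<exists>w\<in>W_in n. q n w \<noteq> 0) \<or>
         eps n \<in> {1, -1} \<and> (\<forall>w\<in>W_in n. q n w = 0) \<and> even (rad_dim n)"
proof -
  have "if \<exists>x\<in>W_in n. q n x \<noteq> 0 then eps n = 0 else eps n \<in> {1, -1} \<and> even (m * n + rad_dim n)"
    unfolding eps_def rad_dim_def
    using sum_chi_quadratic_form(2)[OF of_bit_vector_space F_F2_space[OF n] q_quadratic]
    by (simp only: dim_F[OF n] q_radical[OF n])
  then show ?thesis using m_even by (cases "\<exists>x\<in>W_in n. q n x \<noteq> 0") (auto simp del: bit_not_zero_iff)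
qed

lemma eps_neq_0_iff: "n > 0 \<Longrightarrow> eps n \<noteq> 0 \<longleftrightarrow> (\<forall>w\<in>W_in n. q n w = 0)"
  using eps_cases[of n] by auto

end

section \<open>Doubling the degree and odd prime degrees\<close>

lemma funpow_mult_id:
  assumes "\<And>x. x \<in> A \<Longrightarrow> s x \<in> A" "\<And>x. x \<in> A \<Longrightarrow> (s ^^ p) x = x" "x \<in> A"
  shows "(s ^^ (p * v)) x = x"
  using assms(3)
proof (induction v)
  case (Suc v)
  then show ?case using assms(2) by (simp add: funpow_add)
qed simp

text \<open>
  Orbits under a map of prime order \<open>p\<close> have length 1 or \<open>p\<close>. The induction removes one orbit of length \<open>p\<close> at a time.
\<close>

lemma sum_mod_fixed_points:
  fixes h :: "'x \<Rightarrow> int"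
  assumes p: "prime p" and A: "finite A"
    and s: "\<And>x. x \<in> A \<Longrightarrow> s x \<in> A" "\<And>x. x \<in> A \<Longrightarrow> (s ^^ p) x = x"
    and h: "\<And>x. x \<in> A \<Longrightarrow> h (s x) = h x"
  shows "[(\<Sum>x\<in>A. h x) = (\<Sum>x\<in>{x\<in>A. s x = x}. h x)] (mod int p)"
  using A s h
proof (induction "card A" arbitrary: A rule: less_induct)
  case less
  note fin = less.prems(1) and sA = less.prems(2) and sp = less.prems(3) and hX = less.prems(4)
  have spow: "(s ^^ i) x \<in> A" if "x \<in> A" for i x
    using that by (induction i) (simp_all add: sA)
  show ?case
  proof (cases "\<exists>x\<in>A. s x \<noteq> x")
    case False
    then have "{x\<in>A. s x = x} = A" by blast
    then show ?thesis by simp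
  next
    case True
    then obtain x where x: "x \<in> A" "s x \<noteq> x" by blast
    define Orb where "Orb = (\<lambda>i. (s ^^ i) x) ` {..<p}"
    have p0: "p > 0" using p by (rule prime_gt_0_nat)
    have OA: "Orb \<subseteq> A" using spow[OF x(1)] by (auto simp: Orb_def)
    have modp: "(s ^^ i) x = (s ^^ (i mod p)) x" for i
    proof -
      have "(s ^^ i) x = (s ^^ (i mod p + p * (i div p))) x" by simp
      also have "\<dots> = (s ^^ (i mod p)) ((s ^^ (p * (i div p))) x)"
        by (simp only: funpow_add o_def)
      finally show ?thesis by (simp only: funpow_mult_id[OF sA sp x(1)])
    qed
    have Orb_all: "(s ^^ i) x \<in> Orb" for i
      using modp[of i] p0 by (auto simp: Orb_def)
    have free: "(s ^^ k) y \<noteq> y" if k: "0 < k" "k < p" and y: "y \<in> A" "s y \<noteq> y" for k y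
    proof
      assume k_fix: "(s ^^ k) y = y"
      have "coprime k p" using p k by (metis coprime_commute nat_dvd_not_less prime_imp_coprime)
      then obtain u v where "k * u = p * v + 1"
        using bezout_nat[of k p] k(1) by (auto simp: coprime_iff_gcd_eq_1)
      then have "(s ^^ (k * u)) y = s ((s ^^ (p * v)) y)" by simp
      moreover have "(s ^^ (k * u)) y = y" by (induction u) (simp_all add: funpow_add k_fix)
      ultimately show False using funpow_mult_id[OF sA sp y(1)] y(2) by simp
    qed
    have inj: "inj_on (\<lambda>i. (s ^^ i) x) {..<p}"
    proof -
      have "(s ^^ i) x \<noteq> (s ^^ j) x" if "i < j" "j < p" for i j
      proof
        assume eq: "(s ^^ i) x = (s ^^ j) x"
        have "(s ^^ (j - i)) x = (s ^^ (p - i)) ((s ^^ j) x)"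
        proof -
          have "p - i + j = (j - i) + p" using that by simp
          then have "(s ^^ (p - i)) ((s ^^ j) x) = (s ^^ (j - i)) ((s ^^ p) x)"
            by (metis funpow_add o_apply)
          then show ?thesis using sp x(1) by simp
        qed
        also have "\<dots> = (s ^^ (p - i + i)) x" by (simp only: funpow_add o_apply eq)
        also have "\<dots> = x" using that sp[OF x(1)] by simp
        finally show False using free[of "j - i" x] that x by simp
      qed
      then show ?thesis by (intro inj_onI) (metis lessThan_iff linorder_neqE_nat)
    qed
    have cOrb: "card Orb = p" unfolding Orb_def using card_image[OF inj] by simp
    have hOrb: "h y = h x" if "y \<in> Orb" for y
    proof -
      have "h ((s ^^ i) x) = h x" for i by (induction i) (simp_all add: hX spow[OF x(1)])
      then show ?thesis using that by (auto simp: Orb_def)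
    qed
    have nofix: "s y \<noteq> y" if "y \<in> Orb" for y
    proof
      assume y: "s y = y"
      from that obtain i where i: "y = (s ^^ i) x" "i < p" by (auto simp: Orb_def)
      have "(s ^^ k) y = y" for k by (induction k) (simp_all add: y)
      moreover have "(s ^^ (p - i)) y = x"
        using i sp[OF x(1)] by (simp add: flip: funpow_add[THEN fun_cong, simplified])
      ultimately show False using x(2) y by metis
    qed
    define Y where "Y = A - Orb"
    have YA: "Y \<subseteq> A" by (simp add: Y_def)
    have sY: "s y \<in> Y" if y: "y \<in> Y" for y
    proof -
      have yX: "y \<in> A" using y YA by blast
      have "s y \<notin> Orb"
      proof
        assume "s y \<in> Orb"
        then obtain i where "s y = (s ^^ i) x" by (auto simp: Orb_def)
        then have "(s ^^ (p - 1)) (s y) = (s ^^ (p - 1 + i)) x" by (simp only: funpow_add o_apply)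
        moreover have "(s ^^ (p - 1)) (s y) = (s ^^ p) y"
          using p0 by (metis Suc_diff_1 funpow_Suc_right o_apply)
        ultimately have "y = (s ^^ (p - 1 + i)) x" using sp[OF yX] by simp
        then show False using Orb_all y by (auto simp: Y_def)
      qed
      then show ?thesis using sA[OF yX] by (simp add: Y_def)
    qed
    have "Orb \<noteq> {}" using cOrb p0 by auto
    then have "card Y < card A" unfolding Y_def
      using fin OA by (metis Diff_subset card_seteq finite_subset linorder_not_less double_diff Diff_cancel subset_refl)
    from less.hyps[OF this] have IH: "[(\<Sum>x\<in>Y. h x) = (\<Sum>x\<in>{x\<in>Y. s x = x}. h x)] (mod int p)"
      using fin sY sp hX YA by (auto intro: finite_subset)
    have "{x\<in>Y. s x = x} = {x\<in>A. s x = x}" using nofix by (auto simp: Y_def)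
    moreover have "(\<Sum>x\<in>A. h x) = (\<Sum>x\<in>Y. h x) + int p * h x"
      using sum.subset_diff[OF OA fin, of h] hOrb cOrb by (simp add: Y_def)
    ultimately show ?thesis using IH by (simp add: cong_def)
  qed
qed

context artin_schreier_form
begin

lemma tr_double: "tr (m * (2 * n)) x = tr (m * n) (x + frob n x)"
proof -
  have "m * (2 * n) = m * n + m * n" by simp
  then show ?thesis using tr_append[of "m * n" "m * n" x] by (simp only: tr_add)
qed

lemma frob_double: "frob (2 * n) x = frob n (frob n x)"
  unfolding frob_frob by (simp add: mult_2 distrib_left)

lemma F_double: "x \<in> F n \<Longrightarrow> x \<in> F (2 * n)"
  using GF2_mult_subset[of x "m * n" 2] by (simp add: ac_simps)

lemma F_mult: "x \<in> F n \<Longrightarrow> x \<in> F (n * t)"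
  using GF2_mult_subset[of x "m * n" t] by (simp add: ac_simps)

lemma frob_add_self_closed:
  assumes "x \<in> F (2 * n)" shows "x + frob n x \<in> F n"
  using assms by (simp add: GF2_def frob_add frob_double[symmetric] add.commute)

text \<open>
  The polynomial \<open>x^(2^(m n)) + x + w\<close> has a root in the algebraically closed field.
\<close>

lemma artin_schreier_solvable: "n > 0 \<Longrightarrow> \<exists>x::'a. x + frob n x = w"
proof -
  assume n: "n > 0"
  define p :: "'a poly" where "p = Polynomial.monom 1 (2 ^ (m * n)) + (Polynomial.monom 1 1 + [:w:])"
  have lt: "(1::nat) < 2 ^ (m * n)" using F_pos[OF n] by (intro one_less_power) auto
  have "Polynomial.degree (Polynomial.monom (1::'a) 1 + [:w:]) \<le> 1"
    by (intro degree_add_le) (simp_all add: degree_monom_le)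
  then have "Polynomial.degree p = 2 ^ (m * n)"
    using lt unfolding p_def by (subst degree_add_eq_left) (simp_all add: degree_monom_eq)
  then obtain x where "poly p x = 0"
    using alg_closed_imp_poly_has_root[of p] by auto
  then have "(x + frob n x) + w = 0" by (simp add: p_def poly_monom algebra_simps)
  then show ?thesis by (auto simp only: add_eq_0)
qed

text \<open>
  With \<open>w = x + frob n x\<close> the trace from \<open>F (2 n)\<close> is the trace of \<open>f x + f (x + w)\<close>. By the Artin-Schreier identity for \<open>g\<close> it
  is the trace of \<open>f w\<close> plus the coboundary of \<open>g(w,x)\<close>, and this coboundary is \<open>g(w,w)\<close>.
\<close>

lemma q_doubled:
  assumes x: "x \<in> F (2 * n)" and w: "x + frob n x \<in> W_in n"
  shows "q (2 * n) x = q n (x + frob n x) + kappa (x + frob n x)"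
proof -
  define w' where "w' = x + frob n x"
  have wW: "w' \<in> W" and wF: "w' \<in> F n" using w by (simp_all add: w'_def)
  have fx: "frob n x = w' + x" by (simp add: w'_def add.commute)
  have "frob n (g w' x) = g (frob n w') (frob n x)" by (simp add: g_frob)
  also have "frob n w' = w'" using wF by (simp add: GF2_def)
  finally have fg: "frob n (g w' x) = g w' w' + g w' x" by (simp only: fx g_add_right)
  have "f x + frob n (f x) = f x + f (w' + x)" by (simp only: f_frob[symmetric] fx)
  also have "\<dots> = f w' + ((g w' x)\<^sup>2 + g w' x)"
    by (simp only: f_add_W[OF wW]) (simp add: algebra_simps)
  finally have "tr (m * (2 * n)) (f x) = tr (m * n) (f w') + (frob n (g w' x) + g w' x)"
    by (simp only: tr_double tr_add[of _ "f w'"] tr_artin_schreier)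
  also have "\<dots> = tr (m * n) (f w') + g w' w'"
    by (simp only: fg add.assoc add_self add_0_right)
  finally show ?thesis
    unfolding q_def kappa_def w'_def[symmetric]
    by (simp only: to_bit_add[OF tr_f_bit_val[OF wF] g_self_bit_val[OF wW]])
qed

text \<open>
  \<open>F n\<close> is totally singular in \<open>F (2 n)\<close>, and its orthogonal space is the preimage of \<open>W \<inter> F n\<close> under the surjective map
  \<open>x \<mapsto> x + frob n x\<close> to \<open>F n\<close>, whose fibres are cosets of \<open>F n\<close>.
\<close>

theorem T_double:
  assumes n: "n > 0"
  shows "T (2 * n) = (\<Sum>w\<in>W_in n. chi (q n w + kappa w))"
proof -
  have n2: "2 * n > 0" using n by simp
  note V = F_F2_space[OF n2] and U = F_F2_space[OF n]
  have sub: "F n \<subseteq> F (2 * n)" using F_double by blast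
  have sing: "q (2 * n) u = 0" if "u \<in> F n" for u
    using f_closed[OF that] by (simp add: q_def tr_double GF2_def)
  let ?P = "perp (F (2 * n)) (q (2 * n)) (F n)"
  have pol: "polarisation (q (2 * n)) x u = polarisation (q n) (x + frob n x) u"
    if x: "x \<in> F (2 * n)" and u: "u \<in> F n" for x u
  proof -
    have "frob n (x * R u + u * R x) = frob n x * R u + u * R (frob n x)"
      using u R_closed[OF u] by (simp add: frob_add power_mult_distrib R_frob GF2_def)
    then have "(x * R u + u * R x) + frob n (x * R u + u * R x)
        = (x + frob n x) * R u + u * R (x + frob n x)"
      by (simp add: R_add algebra_simps)
    then show ?thesis
      unfolding q_polar[OF x F_double[OF u]] q_polar[OF frob_add_self_closed[OF x] u] tr_double
      by (simp only:)
  qed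
  have P: "?P = {x \<in> F (2 * n). x + frob n x \<in> W_in n}"
    unfolding q_radical[OF n, symmetric] perp_def polar_radical_def
    using pol frob_add_self_closed by auto
  have fibre: "card {x \<in> ?P. x + frob n x = w} = 2 ^ (m * n)" if w: "w \<in> W_in n" for w
  proof -
    obtain x0 where x0: "x0 + frob n x0 = w" using artin_schreier_solvable[OF n] by blast
    have "frob n w = w" using w by (simp add: GF2_def)
    moreover have fx0: "frob n x0 = w + x0" using x0 by (metis add.commute add_self_left)
    ultimately have x0F: "x0 \<in> F (2 * n)" by (simp add: GF2_def frob_double frob_add)
    have "{x \<in> ?P. x + frob n x = w} = (\<lambda>u. u + x0) ` F n"
    proof (intro equalityI subsetI)
      fix x assume x: "x \<in> {x \<in> ?P. x + frob n x = w}"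
      have "frob n x = x + (x + frob n x)" by (simp only: add_self_left)
      also have "x + frob n x = w" using x by blast
      finally have "frob n (x + x0) = (x + w) + (w + x0)" by (simp only: frob_add fx0)
      then have "x + x0 \<in> F n" by (simp add: GF2_def add.assoc)
      moreover have "x = (x + x0) + x0" by (simp add: add.assoc)
      ultimately show "x \<in> (\<lambda>u. u + x0) ` F n" by blast
    next
      fix x assume "x \<in> (\<lambda>u. u + x0) ` F n"
      then obtain u where u: "u \<in> F n" "x = u + x0" by blast
      have "x \<in> F (2 * n)" using F_double[OF u(1)] x0F u(2) GF2_closed by blast
      moreover have "x + frob n x = w" using u(1) by (simp add: u(2) GF2_def frob_add fx0 algebra_simps)
      ultimately show "x \<in> {x \<in> ?P. x + frob n x = w}" using w by (simp add: P)
    qed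
    moreover have "inj_on (\<lambda>u. u + x0) (F n)" by (simp add: inj_on_def)
    ultimately show ?thesis by (simp add: card_image card_GF2(2)[OF F_pos[OF n]])
  qed
  have finP: "finite ?P" using F2_spaceD(1)[OF V] by (simp add: perp_def)
  have "S (2 * n) = (\<Sum>x\<in>?P. chi (q (2 * n) x))"
    unfolding S_def by (rule sum_chi_singular_subspace[OF V q_quadratic U sub sing])
  also have "\<dots> = (\<Sum>w\<in>W_in n. \<Sum>x\<in>{x \<in> ?P. x + frob n x = w}. chi (q (2 * n) x))"
    by (rule sum.group[OF finP F2_spaceD(1)[OF W_in_F2_space[OF n]], symmetric]) (auto simp: P)
  also have "\<dots> = (\<Sum>w\<in>W_in n. \<Sum>x\<in>{x \<in> ?P. x + frob n x = w}. chi (q n w + kappa w))"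
    by (intro sum.cong refl) (use P q_doubled in auto)
  also have "\<dots> = 2 ^ (m * n) * (\<Sum>w\<in>W_in n. chi (q n w + kappa w))"
    by (simp add: fibre sum_distrib_left)
  finally have "T (2 * n) * 2 ^ (m div 2 * (2 * n)) = (\<Sum>w\<in>W_in n. chi (q n w + kappa w)) * 2 ^ (m * n)"
    unfolding S_eq_T[OF n2, symmetric] by (simp only: mult.commute)
  moreover have "m div 2 * (2 * n) = m * n" using m_even by auto
  ultimately show ?thesis by simp
qed

lemma of_nat_parity: "(of_nat t :: 'a) = (if even t then 0 else 1)"
  by (induction t) auto

lemma tr_multiple: "x \<in> GF2 k \<Longrightarrow> tr (k * t) (x::'a) = of_nat t * tr k x"
proof (induction t)
  case (Suc t)
  have "tr (k * Suc t) x = tr k x + tr (k * t) (x ^ 2 ^ k)"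
    using tr_append[of k "k * t" x] by simp
  also have "x ^ 2 ^ k = x" using Suc.prems by (simp add: GF2_def)
  finally show ?case using Suc by (simp add: algebra_simps)
qed (simp add: tr_def)

lemma q_odd_multiple:
  assumes "x \<in> F n" "odd t"
  shows "q (n * t) x = q n x"
  using tr_multiple[OF f_closed[OF assms(1)], of t] assms(2)
  by (simp add: q_def of_nat_parity flip: mult.assoc)

lemma frob_iter: "((frob n) ^^ i) x = frob (n * i) x"
proof (induction i)
  case (Suc i)
  then show ?case using frob_frob[of x "m * (n * i)" "m * n"] by (simp add: algebra_simps)
qed simp

text \<open>
  The orbit count gives the congruence for \<open>S\<close>. It passes to \<open>T\<close> because the normalising factor for \<open>n p\<close> is the \<open>p\<close>-th
  power of the one for \<open>n\<close>, an integer as \<open>m\<close> is even, so that Fermat's little theorem applies.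
\<close>

theorem T_cong:
  assumes n: "n > 0" and p: "prime p" "odd p"
  shows "[T (n * p) = T n] (mod int p)"
proof -
  have np: "n * p > 0" using n p(1) by (simp add: prime_gt_0_nat)
  have 1: "[S (n * p) = (\<Sum>x\<in>{x \<in> F (n * p). frob n x = x}. chi (q (n * p) x))] (mod int p)"
    unfolding S_def
  proof (rule sum_mod_fixed_points[OF p(1) F2_spaceD(1)[OF F_F2_space[OF np]]])
    fix x assume x: "x \<in> F (n * p)"
    show "frob n x \<in> F (n * p)" by (rule GF2_closed(3)[OF x x])
    show "(frob n ^^ p) x = x" using x by (simp add: frob_iter GF2_def)
    show "chi (q (n * p) (frob n x)) = chi (q (n * p) x)"
      by (simp add: q_def f_frob tr_conj f_closed[OF x])
  qed
  have fixF: "{x \<in> F (n * p). frob n x = x} = F n"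
    using F_mult by (auto simp: GF2_def)
  have "(\<Sum>x\<in>F n. chi (q (n * p) x)) = S n"
    unfolding S_def by (intro sum.cong refl) (simp add: q_odd_multiple p(2))
  with 1 fixF have S: "[S (n * p) = S n] (mod int p)" by simp
  define y :: nat where "y = 2 ^ (m div 2 * n)"
  have p2: "p \<noteq> 2" using p(2) by auto
  have cop: "coprime y p"
    unfolding y_def using p p2 by (simp add: coprime_power_left_iff coprime_commute primes_coprime)
  have "[y ^ p = y] (mod p)"
  proof -
    have "\<not> p dvd y" using cop p(1) by (metis coprime_common_divisor_nat dvd_refl not_prime_1)
    then have "[y ^ (p - 1) * y = 1 * y] (mod p)"
      using fermat_theorem[OF p(1)] by (intro cong_mult) auto
    moreover have "y ^ (p - 1) * y = y ^ p"
      using prime_gt_0_nat[OF p(1)] by (simp add: power_eq_if mult.commute)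
    ultimately show ?thesis by simp
  qed
  then have yp: "[int y ^ p = int y] (mod int p)" by (simp flip: of_nat_power add: cong_int_iff)
  have Sn: "S n = T n * int y" using S_eq_T[OF n] by (simp add: y_def)
  have Snp: "S (n * p) = T (n * p) * int y ^ p"
    using S_eq_T[OF np] by (simp add: y_def mult.assoc flip: power_mult)
  have "[T (n * p) * int y = T (n * p) * int y ^ p] (mod int p)"
    using yp by (intro cong_mult cong_refl) (rule cong_sym)
  also have "[T (n * p) * int y ^ p = T n * int y] (mod int p)"
    using S by (simp add: Sn Snp)
  finally show ?thesis
    using cop by (simp add: cong_mult_rcancel)
qed

section \<open>The form on the root space is not hyperbolic\<close>

primrec g_coeff_poly :: "nat \<Rightarrow> 'a poly" where
  "g_coeff_poly 0 = (\<Sum>i<d. Polynomial.monom (a (Suc i)) (2 ^ Suc i))"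
| "g_coeff_poly (Suc i) = (g_coeff_poly i)\<^sup>2 + Polynomial.monom (a (Suc i)) 1"

definition kappa_poly :: "'a poly" where
  "kappa_poly = (\<Sum>i<d. g_coeff_poly i * Polynomial.monom 1 (2 ^ i))"

lemma poly_g_coeff_poly: "poly (g_coeff_poly i) w = g_coeff i w"
  by (induction i) (simp_all add: poly_sum poly_monom)

lemma poly_kappa_poly: "poly kappa_poly w = g w w"
  by (simp add: kappa_poly_def g_def poly_sum poly_monom poly_g_coeff_poly)

lemma degree_g_coeff_poly: "Polynomial.degree (g_coeff_poly i) \<le> 2 ^ (d + i)"
proof (induction i)
  case 0
  show ?case unfolding g_coeff_poly.simps
    by (intro degree_sum_le) (auto intro!: order.trans[OF degree_monom_le] power_increasing simp del: power_Suc)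
next
  case (Suc i)
  have "Polynomial.degree ((g_coeff_poly i)\<^sup>2) \<le> 2 ^ (d + i) * 2"
    using degree_power_le[of "g_coeff_poly i" 2] Suc by linarith
  then show ?case unfolding g_coeff_poly.simps
    by (intro degree_add_le) (auto intro!: order.trans[OF degree_monom_le] simp: mult.commute)
qed

text \<open>
  The bound equals the number of zeros that a nondegenerate hyperbolic form on \<open>W\<close> would have.
\<close>

lemma degree_kappa_poly: "Polynomial.degree kappa_poly \<le> 2 ^ (2 * d - 1) + 2 ^ (d - 1)"
  unfolding kappa_poly_def
proof (rule degree_sum_le)
  fix i assume "i \<in> {..<d}"
  then have i: "d + i \<le> 2 * d - 1" "i \<le> d - 1" by auto
  have "Polynomial.degree (g_coeff_poly i * Polynomial.monom 1 (2 ^ i)) \<le> 2 ^ (d + i) + 2 ^ i"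
    using degree_mult_le[of "g_coeff_poly i" "Polynomial.monom 1 (2 ^ i)"] degree_g_coeff_poly[of i]
    by (simp add: degree_monom_eq)
  also have "\<dots> \<le> 2 ^ (2 * d - 1) + 2 ^ (d - 1)"
    using i by (intro add_mono power_increasing) auto
  finally show "Polynomial.degree (g_coeff_poly i * Polynomial.monom 1 (2 ^ i)) \<le> 2 ^ (2 * d - 1) + 2 ^ (d - 1)" .
qed simp

text \<open>
  The zero \<open>w = 0\<close> is multiple, which costs one more root than the degree bound leaves.
\<close>

lemma X_square_dvd_kappa_poly: "[:0, 1:]\<^sup>2 dvd kappa_poly"
  unfolding kappa_poly_def
proof (rule dvd_sum)
  fix i
  have "poly (g_coeff_poly i) 0 = 0" using g_coeff_add[of i 0 0] by (simp add: poly_g_coeff_poly)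
  then have "[:0, 1:] dvd g_coeff_poly i" by (simp add: poly_eq_0_iff_dvd)
  moreover have "[:0, 1:] dvd Polynomial.monom (1::'a) (2 ^ i)"
    using poly_eq_0_iff_dvd[of "Polynomial.monom (1::'a) (2 ^ i)" 0] by (simp add: poly_monom power_0_left)
  ultimately show "[:0, 1:]\<^sup>2 dvd g_coeff_poly i * Polynomial.monom 1 (2 ^ i)"
    unfolding power2_eq_square by (rule mult_dvd_mono)
qed

text \<open>
  A sum of \<open>2^d\<close> would mean \<open>2^(2 d - 1) + 2^(d - 1)\<close> distinct zeros of a polynomial of at most this degree with
  a multiple zero.
\<close>

lemma sum_chi_kappa_W_neq: "(\<Sum>w\<in>W. chi (kappa w)) \<noteq> 2 ^ d"
proof
  assume K: "(\<Sum>w\<in>W. chi (kappa w)) = 2 ^ d"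
  define Z where "Z = {w\<in>W. kappa w = 0}"
  have pw: "(2::nat) ^ (2 * d) = 2 * 2 ^ (2 * d - 1)" "(2::nat) ^ d = 2 * 2 ^ (d - 1)"
    using d_pos by (simp_all flip: power_Suc)
  have "2 * int (card Z) = 2 ^ d + 2 ^ (2 * d)"
    using K sum_chi_eq_card[OF card_W(1), of kappa] by (simp add: Z_def card_W(2))
  then have "int (2 * card Z) = int (2 ^ d + 2 ^ (2 * d))" by simp
  then have "2 * card Z = 2 ^ d + 2 ^ (2 * d)" by (simp only: of_nat_eq_iff)
  then have cZ: "card Z = 2 ^ (2 * d - 1) + 2 ^ (d - 1)" using pw by simp
  have Zr: "poly kappa_poly w = 0" if "w \<in> Z" for w
    using that by (simp add: Z_def poly_kappa_poly kappa_def to_bit_eq_0)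
  obtain h where h: "kappa_poly = [:0, 1:]\<^sup>2 * h" using X_square_dvd_kappa_poly by (auto elim: dvdE)
  show False
  proof (cases "h = 0")
    case True
    then have "kappa w = 0" for w using poly_kappa_poly[of w] h by (simp add: kappa_def)
    then have "Z = W" by (auto simp: Z_def)
    then have "(2::nat) ^ (2 * d - 1) = 2 ^ (d - 1)" using cZ card_W(2) pw by simp
    then show False using d_pos by (simp only: power_inject_exp) 
  next
    case False
    then have "Polynomial.degree kappa_poly = 2 + Polynomial.degree h"
      unfolding h by (subst degree_mult_eq) (simp_all add: degree_power_eq)
    then have dh: "Polynomial.degree h + 2 \<le> card Z" using degree_kappa_poly cZ by simp
    have "Z \<subseteq> insert 0 {w. poly h w = 0}" using Zr by (auto simp: h)
    then have "card Z \<le> card (insert 0 {w. poly h w = 0})"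
      by (rule card_mono[rotated]) (simp add: poly_roots_finite[OF False])
    also have "\<dots> \<le> 1 + Polynomial.degree h"
      using card_poly_roots_bound[OF False] poly_roots_finite[OF False] by (simp add: card_insert_if)
    finally show False using dh by simp
  qed
qed

end

section \<open>Isotropic subspaces with a Frobenius-stable lift\<close>

lemma card_index_two:
  fixes V V' :: "'v::ab_group_add set"
  assumes V: "F2_space V" and V': "F2_space V'" "V' \<subseteq> V" and a: "a \<in> V" "a \<notin> V'"
    and ind: "\<And>x. x \<in> V \<Longrightarrow> x \<notin> V' \<Longrightarrow> x + a \<in> V'"
  shows "card V = 2 * card V'"
proof -
  have "V - V' = (\<lambda>x. x + a) ` V'"
  proof (intro equalityI subsetI)
    fix x assume x: "x \<in> V - V'"
    then have "x + a \<in> V'" using ind by blast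
    moreover have "x = (x + a) + a" by (rule F2_space_cancel(2)[OF V a(1), symmetric])
    ultimately show "x \<in> (\<lambda>x. x + a) ` V'" by blast
  next
    fix x assume "x \<in> (\<lambda>x. x + a) ` V'"
    then obtain y where y: "y \<in> V'" "x = y + a" by blast
    have "y + x = a" unfolding y(2) by (rule F2_space_cancel(1)[OF V'(1) y(1)])
    then have "x \<notin> V'" using F2_spaceD(3)[OF V'(1) y(1), of x] a(2) by auto
    moreover have "x \<in> V" unfolding y(2) by (rule F2_spaceD(3)[OF V _ a(1)]) (use y V' in blast)
    ultimately show "x \<in> V - V'" by blast
  qed
  moreover have "card ((\<lambda>x. x + a) ` V') = card V'"
    by (rule card_image) (simp add: inj_on_def)
  ultimately have "card (V - V') = card V'" by simp
  moreover have "card V' \<le> card V" using V' F2_spaceD(1)[OF V] by (simp add: card_mono)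
  moreover have "card (V - V') = card V - card V'"
    by (rule card_Diff_subset[OF F2_spaceD(1)[OF V'(1)] V'(2)])
  ultimately show ?thesis by linarith
qed

lemma F2_space_adjoin:
  fixes U :: "'v::ab_group_add set"
  assumes V: "F2_space V" and U: "F2_space U" "U \<subseteq> V" and a: "a \<in> V"
  shows "F2_space (U \<union> (\<lambda>u. u + a) ` U)"
  unfolding F2_space_def
proof (intro conjI ballI)
  note mem = F2_spaceD[OF U(1)]
  show "finite (U \<union> (\<lambda>u. u + a) ` U)" using mem(1) by simp
  show "0 \<in> U \<union> (\<lambda>u. u + a) ` U" using mem(2) by simp
  fix x assume x: "x \<in> U \<union> (\<lambda>u. u + a) ` U"
  then have "x \<in> V" using F2_spaceD(3)[OF V _ a] U(2) by blast
  then show "x + x = 0" by (rule F2_spaceD(4)[OF V])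
  fix y assume y: "y \<in> U \<union> (\<lambda>u. u + a) ` U"
  have in1: "u + v \<in> U \<union> (\<lambda>u. u + a) ` U" if "u \<in> U" "v \<in> U" for u v
    using mem(3)[OF that] by blast
  have in2: "u + v + a \<in> U \<union> (\<lambda>u. u + a) ` U" if "u \<in> U" "v \<in> U" for u v
    using mem(3)[OF that] by blast
  have eq1: "(u + a) + (v + a) = u + v" for u v
  proof -
    have "(u + a) + (v + a) = (u + v) + (a + a)" by (simp add: ac_simps)
    then show ?thesis by (simp add: F2_spaceD(4)[OF V a])
  qed
  have eq2: "u + (v + a) = u + v + a" "(u + a) + v = u + v + a" for u v by (simp_all add: ac_simps)
  consider "x \<in> U" "y \<in> U" | v where "x \<in> U" "v \<in> U" "y = v + a"
    | u where "u \<in> U" "y \<in> U" "x = u + a" | u v where "u \<in> U" "v \<in> U" "x = u + a" "y = v + a"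
    using x y by blast
  then show "x + y \<in> U \<union> (\<lambda>u. u + a) ` U"
  proof cases
    case 1
    then show ?thesis by (rule in1)
  next
    case (2 v)
    show ?thesis unfolding 2(3) eq2(1) by (rule in2[OF 2(1,2)])
  next
    case (3 u)
    show ?thesis unfolding 3(3) eq2(2) by (rule in2[OF 3(1,2)])
  next
    case (4 u v)
    show ?thesis unfolding 4(3,4) eq1 by (rule in1[OF 4(1,2)])
  qed
qed

context artin_schreier_form
begin

abbreviation pair :: "'a \<Rightarrow> 'a \<Rightarrow> bit" where
  "pair \<equiv> polarisation kappa"

lemma pair_commute: "pair x y = pair y x"
  by (rule polarisation_commute)

lemma W_add: "x \<in> W \<Longrightarrow> y \<in> W \<Longrightarrow> x + y \<in> W"
  by (rule F2_spaceD(3)[OF W_F2_space])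

lemma pair_add:
  "x \<in> W \<Longrightarrow> y \<in> W \<Longrightarrow> z \<in> W \<Longrightarrow> pair (x + y) z = pair x z + pair y z"
  "x \<in> W \<Longrightarrow> y \<in> W \<Longrightarrow> z \<in> W \<Longrightarrow> pair z (x + y) = pair z x + pair z y"
  using quadratic_onD[OF kappa_quadratic] quadratic_onD'[OF kappa_quadratic] by blast+

lemma pair_eq_0_iff: "x \<in> W \<Longrightarrow> y \<in> W \<Longrightarrow> pair x y = 0 \<longleftrightarrow> g x y = g y x"
  by (simp only: kappa_polar to_bit_eq_0 add_eq_0)

lemma frob_image_eq:
  assumes "finite U" "\<And>u. u \<in> U \<Longrightarrow> frob n u \<in> U"
  shows "frob n ` U = U"
  by (rule endo_inj_surj) (use assms in \<open>auto simp: inj_on_def frob_inj\<close>)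

abbreviation orth :: "'a set \<Rightarrow> 'a set" where
  "orth U \<equiv> perp W kappa U"

text \<open>
  The vectors of the orthogonal space of \<open>U\<close> whose class modulo \<open>U\<close> is fixed by \<open>frob n\<close>.
\<close>

definition frob_fixed :: "nat \<Rightarrow> 'a set \<Rightarrow> 'a set" where
  "frob_fixed n U = {w \<in> orth U. w + frob n w \<in> U}"

text \<open>
  The map \<open>u \<mapsto> (u, s u)\<close> is a homomorphism from \<open>U\<close> to the extraspecial group.
\<close>

definition lift :: "'a set \<Rightarrow> ('a \<Rightarrow> 'a) \<Rightarrow> bool" where
  "lift U s \<longleftrightarrow> F2_space U \<and> U \<subseteq> W \<and> (\<forall>u\<in>U. (s u)\<^sup>2 + s u = f u) \<and>
     (\<forall>u\<in>U. \<forall>v\<in>U. s (u + v) = s u + s v + g u v)"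

text \<open>
  For \<open>e\<close> with \<open>e^2 + e = f w\<close> one has \<open>frob n e = e + tr (m n) (f w)\<close>, independently of the choice of \<open>e\<close>. The defect compares the
  image of \<open>(w, e)\<close> under \<open>frob n\<close> with its product by the lift of \<open>w + frob n w\<close>: it is 0 if they agree and 1 if they differ by the
  central involution.
\<close>

definition defect :: "nat \<Rightarrow> ('a \<Rightarrow> 'a) \<Rightarrow> 'a \<Rightarrow> 'a" where
  "defect n s w = tr (m * n) (f w) + s (w + frob n w) + g (w + frob n w) w"

lemma liftD:
  assumes "lift U s"
  shows "F2_space U" "U \<subseteq> W" "\<And>u. u \<in> U \<Longrightarrow> (s u)\<^sup>2 + s u = f u"
    "\<And>u v. u \<in> U \<Longrightarrow> v \<in> U \<Longrightarrow> s (u + v) = s u + s v + g u v"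
  using assms by (auto simp: lift_def)

lemma lift_0: "lift U s \<Longrightarrow> s 0 = 0"
  using liftD(4)[of U s 0 0] F2_spaceD(2)[OF liftD(1)] by simp

lemma lift_singular:
  assumes "lift U s" "u \<in> U" shows "g u u = 0" "kappa u = 0"
  using liftD(4)[OF assms(1) assms(2) assms(2)] lift_0[OF assms(1)] by (simp_all add: kappa_def)

lemma lift_isotropic:
  assumes "lift U s" "u \<in> U" "v \<in> U" shows "pair u v = 0"
proof -
  have "s u + s v + g u v = s u + s v + g v u"
    using liftD(4)[OF assms] liftD(4)[OF assms(1,3,2)] by (simp add: ac_simps)
  then have "g u v = g v u" by simp
  then show ?thesis using assms liftD(2)[OF assms(1)] by (simp add: pair_eq_0_iff subset_iff)
qed

lemma lift_subset_orth: "lift U s \<Longrightarrow> U \<subseteq> orth U"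
  unfolding perp_def using lift_isotropic[of U s] liftD(2)[of U s] by blast

lemma orth_W: "w \<in> orth U \<Longrightarrow> w \<in> W"
  by (simp add: perp_def)

lemma orth_F2_space: "U \<subseteq> W \<Longrightarrow> F2_space (orth U)"
  by (rule perp_F2_space[OF W_F2_space kappa_quadratic])

lemma orth_pair: "w \<in> orth U \<Longrightarrow> u \<in> U \<Longrightarrow> pair w u = 0"
  by (simp add: perp_def)

lemma frob_fixed_F2_space:
  assumes "lift U s" shows "F2_space (frob_fixed n U)"
proof -
  note U = liftD(1)[OF assms] and H = orth_F2_space[OF liftD(2)[OF assms]]
  have "x + y + frob n (x + y) = (x + frob n x) + (y + frob n y)" for x y
    by (simp add: frob_add algebra_simps)
  then have add: "x + y + frob n (x + y) \<in> U" if "x + frob n x \<in> U" "y + frob n y \<in> U" for x y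
    using F2_spaceD(3)[OF U that] by metis
  show ?thesis
    using F2_spaceD[OF U] F2_spaceD[OF H] add
    unfolding F2_space_def frob_fixed_def by (simp add: power_0_left)
qed

lemma defect_bit_val:
  assumes l: "lift U s" and w: "w \<in> W" and a: "w + frob n w \<in> U"
  shows "defect n s w \<in> {0, 1}"
proof -
  define b where "b = w + frob n w"
  have bW: "b \<in> W" and bU: "b \<in> U" using a liftD(2)[OF l] by (auto simp: b_def)
  have fw: "frob n w = w + b" by (simp add: b_def)
  have "(defect n s w)\<^sup>2 + defect n s w
      = ((tr (m * n) (f w))\<^sup>2 + tr (m * n) (f w)) + ((s b)\<^sup>2 + s b) + ((g b w)\<^sup>2 + g b w)"
    by (simp add: defect_def square_add b_def algebra_simps)
  also have "(tr (m * n) (f w))\<^sup>2 + tr (m * n) (f w) = f (w + b) + f w"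
    by (simp only: tr_fixed f_frob[symmetric] fw)
  also have "f (w + b) + f w = f b + (w * R b + b * R w)"
    by (simp add: f_add algebra_simps)
  also have "(s b)\<^sup>2 + s b = f b" by (rule liftD(3)[OF l bU])
  also have "(g b w)\<^sup>2 + g b w = w * R b + b * R w"
    by (simp only: g_artin_schreier WD[OF bW] mult_zero_left add_0_right)
  finally show ?thesis unfolding bit_val_iff by (simp add: algebra_simps)
qed

text \<open>
  The cocycle terms cancel because \<open>w\<close> is orthogonal to the vector \<open>w' + frob n w'\<close> of \<open>U\<close>.
\<close>

lemma defect_add:
  assumes l: "lift U s" and w: "w \<in> orth U" "w' \<in> orth U"
    and a: "w + frob n w \<in> U" "w' + frob n w' \<in> U"
  shows "defect n s (w + w') = defect n s w + defect n s w'"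
proof -
  define b where "b = w + frob n w"
  define c where "c = w' + frob n w'"
  have fw: "frob n w = w + b" "frob n w' = w' + c" by (simp_all add: b_def c_def)
  have wW: "w \<in> W" "w' \<in> W" using w orth_W by auto
  have bU: "b \<in> U" "c \<in> U" using a by (simp_all add: b_def c_def)
  then have bW: "b \<in> W" "c \<in> W" using liftD(2)[OF l] by auto
  have sym: "g w c = g c w"
    using orth_pair[OF w(1) bU(2)] wW bW by (simp add: pair_eq_0_iff)
  have bc: "w + w' + frob n (w + w') = b + c" by (simp add: frob_add fw algebra_simps)
  have "frob n (g w w') = g (w + b) (w' + c)" by (simp only: g_frob[symmetric] fw)
  then have "tr (m * n) (f (w + w')) = tr (m * n) (f w) + tr (m * n) (f w')
      + (g (w + b) (w' + c) + g w w')"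
    by (simp only: tr_f_add_W[OF wW(1)])
  then show ?thesis
    unfolding defect_def bc liftD(4)[OF l bU] b_def[symmetric] c_def[symmetric]
    by (simp add: g_add_left g_add_right sym algebra_simps)
qed

text \<open>
  The lift of \<open>U\<close> is stable under \<open>frob n\<close>, and \<open>frob n\<close> acts trivially on the lifts of the vectors that it fixes modulo
  \<open>U\<close>, up to the lift of \<open>U\<close> itself. The last condition says that the fixed space of \<open>frob n\<close> on the orthogonal space modulo \<open>U\<close> has
  even dimension; it carries the parity information from \<open>m\<close> even.
\<close>

definition admissible :: "nat \<Rightarrow> 'a set \<Rightarrow> ('a \<Rightarrow> 'a) \<Rightarrow> bool" where
  "admissible n U s \<longleftrightarrow> lift U s \<and> (\<forall>u\<in>U. u + frob n u \<in> U) \<and>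
     (\<forall>w\<in>frob_fixed n U. defect n s w = 0) \<and> (\<exists>t. card (frob_fixed n U) * card U = t\<^sup>2)"

text \<open>
  For \<open>U = 0\<close> the condition on the defect says that \<open>q n\<close> vanishes on \<open>W \<inter> F n\<close>, and the parity condition that the radical of
  \<open>q n\<close> has even dimension.
\<close>

lemma admissible_trivial:
  assumes n: "n > 0" and eps: "eps n \<noteq> 0"
  shows "admissible n {0} (\<lambda>_. 0)"
proof -
  have l: "lift {0} (\<lambda>_. 0)"
    by (auto simp: lift_def F2_space_def W_def Rt_0 f_0)
  have "pair w 0 = 0" if "w \<in> W" for w
    by (rule polarisation_0[OF kappa_quadratic _ that]) (simp add: W_def Rt_0)
  then have P: "frob_fixed n {0} = W_in n"
    by (auto simp: frob_fixed_def perp_def GF2_def add_eq_0)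
  have q0: "\<forall>w\<in>W_in n. q n w = 0" and ev: "even (rad_dim n)" using eps eps_cases[OF n] by auto
  from ev have "card (frob_fixed n {0}) * card {0::'a} = (2 ^ (rad_dim n div 2))\<^sup>2"
    by (simp add: P card_W_in[OF n] flip: power_mult)
  moreover have "\<forall>w\<in>frob_fixed n {0}. defect n (\<lambda>_. 0) w = 0"
    using q0 by (auto simp: P defect_def GF2_def q_def to_bit_eq_0)
  moreover have "\<forall>u\<in>{0}. u + frob n u \<in> {0::'a}" by (simp add: power_0_left)
  ultimately show ?thesis using l unfolding admissible_def by blast
qed

text \<open>
  A singular vector \<open>w0\<close> orthogonal to \<open>U\<close> lifts to an element \<open>(w0, e0)\<close> of order at most 2 commuting with the lift of \<open>U\<close>; the
  products of both define the new lift.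
\<close>

lemma lift_extend:
  assumes l: "lift U s" and w0: "w0 \<in> orth U" "w0 \<notin> U" and k0: "kappa w0 = 0"
    and e0: "e0\<^sup>2 + e0 = f w0"
  defines "U1 \<equiv> U \<union> (\<lambda>u. u + w0) ` U"
  defines "s1 \<equiv> \<lambda>x. if x \<in> U then s x else e0 + s (x + w0) + g (x + w0) w0"
  shows "lift U1 s1" and "\<And>u. u \<in> U \<Longrightarrow> s1 (u + w0) = e0 + s u + g u w0"
proof -
  note U = liftD(1)[OF l] and UW = liftD(2)[OF l]
  have w0W: "w0 \<in> W" by (rule orth_W[OF w0(1)])
  have notU: "u + w0 \<notin> U" if "u \<in> U" for u
  proof
    assume "u + w0 \<in> U"
    then have "u + (u + w0) \<in> U" using F2_spaceD(3)[OF U that] by blast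
    then show False using w0(2) by simp
  qed
  show s1w: "s1 (u + w0) = e0 + s u + g u w0" if "u \<in> U" for u
    using notU[OF that] by (simp add: s1_def add.assoc)
  have s1u: "s1 u = s u" if "u \<in> U" for u using that by (simp add: s1_def)
  have g0: "g w0 w0 = 0" using k0 by (simp add: kappa_def to_bit_eq_0)
  have sym: "g w0 u = g u w0" if "u \<in> U" for u
    using orth_pair[OF w0(1) that] that UW w0W by (simp add: pair_eq_0_iff subset_iff)
  have U1: "F2_space U1" unfolding U1_def by (rule F2_space_adjoin[OF W_F2_space U UW w0W])
  have U1W: "U1 \<subseteq> W" using UW w0W W_add by (auto simp: U1_def)
  have U1E: "x \<in> U \<or> (\<exists>u\<in>U. x = u + w0)" if "x \<in> U1" for x
    using that unfolding U1_def by blast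
  have eq: "(s1 x)\<^sup>2 + s1 x = f x" if xU: "x \<in> U1" for x
  proof (cases "x \<in> U")
    case True
    then show ?thesis by (simp add: s1u liftD(3)[OF l])
  next
    case False
    then obtain u where u: "u \<in> U" "x = u + w0" using U1E[OF xU] by blast
    have uW: "u \<in> W" using u UW by blast
    have "(s1 x)\<^sup>2 + s1 x = (e0\<^sup>2 + e0) + ((s u)\<^sup>2 + s u) + ((g u w0)\<^sup>2 + g u w0)"
      by (simp add: u(2) s1w[OF u(1)] square_add algebra_simps)
    also have "\<dots> = f x"
      by (simp only: e0 liftD(3)[OF l u(1)] u(2) f_add_W[OF uW]) (simp add: algebra_simps)
    finally show ?thesis .
  qed
  have hom: "s1 (x + y) = s1 x + s1 y + g x y" if xy: "x \<in> U1" "y \<in> U1" for x y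
  proof -
    have Uadd: "u + v \<in> U" if "u \<in> U" "v \<in> U" for u v using F2_spaceD(3)[OF U that] .
    consider (a) "x \<in> U" "y \<in> U" | (b) u where "x \<in> U" "u \<in> U" "y = u + w0"
      | (c) u where "y \<in> U" "u \<in> U" "x = u + w0"
      | (d) u v where "u \<in> U" "v \<in> U" "x = u + w0" "y = v + w0"
      using U1E[OF xy(1)] U1E[OF xy(2)] by blast
    then show ?thesis
    proof cases
      case a
      then show ?thesis by (simp add: s1u Uadd liftD(4)[OF l])
    next
      case b
      have "x + y = (x + u) + w0" by (simp add: b add.assoc)
      then show ?thesis
        by (simp only: s1w[OF Uadd[OF b(1,2)]] b(3) s1w[OF b(2)] s1u[OF b(1)] liftD(4)[OF l b(1,2)])
           (simp add: g_add_left g_add_right algebra_simps)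
    next
      case c
      have "x + y = (u + y) + w0" by (simp add: c ac_simps)
      then show ?thesis
        by (simp only: s1w[OF Uadd[OF c(2,1)]] c(3) s1w[OF c(2)] s1u[OF c(1)] liftD(4)[OF l c(2,1)])
           (simp add: g_add_left g_add_right sym[OF c(1)] algebra_simps)
    next
      case d
      have "x + y = u + v" by (simp add: d ac_simps)
      then show ?thesis
        by (simp only: s1u[OF Uadd[OF d(1,2)]] d(3,4) s1w[OF d(1)] s1w[OF d(2)] liftD(4)[OF l d(1,2)])
           (simp add: g_add_left g_add_right sym[OF d(2)] g0 algebra_simps)
    qed
  qed
  show "lift U1 s1" using U1 U1W eq hom by (simp add: lift_def)
qed

end

section \<open>Forms with split root space\<close>

lemma square_double_square: "t\<^sup>2 = 2 * s\<^sup>2 \<Longrightarrow> s = (0::nat)"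
proof (rule ccontr)
  assume eq: "t\<^sup>2 = 2 * s\<^sup>2" and s: "s \<noteq> 0"
  have t: "t \<noteq> 0"
  proof
    assume "t = 0"
    with eq s show False by simp
  qed
  have "multiplicity 2 (t\<^sup>2) = multiplicity 2 (2 * s\<^sup>2)" by (simp only: eq)
  then have "2 * multiplicity 2 t = Suc (2 * multiplicity 2 s)"
    using s t by (simp add: prime_elem_multiplicity_mult_distrib prime_elem_multiplicity_power_distrib)
  then show False by presburger
qed

lemma gcd_scaled: "coprime a b \<Longrightarrow> gcd (g * a) (g * b) = (g::nat)"
  by (metis coprime_imp_gcd_eq_1 gcd_mult_distrib_nat mult.right_neutral)

text \<open>
  Induction along the prime factors of an odd number, staying among its divisors.
\<close>

lemma odd_multiple_induct [consumes 1, case_names one step]: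
  fixes t :: nat
  assumes "odd t" "Q 1" "\<And>s p. prime p \<Longrightarrow> odd p \<Longrightarrow> s * p dvd t \<Longrightarrow> Q s \<Longrightarrow> Q (s * p)"
  shows "Q t"
proof -
  have "s dvd t \<Longrightarrow> Q s" for s
  proof (induction s rule: less_induct)
    case (less s)
    have od: "odd s" using less.prems assms(1) by (meson dvd_trans)
    show ?case
    proof (cases "s = 1")
      case True
      then show ?thesis using assms(2) by simp
    next
      case False
      then obtain p where p: "prime p" "p dvd s" by (metis prime_factor_nat)
      then obtain r where r: "s = r * p" by (metis dvdE mult.commute)
      have "s > 0" using od by (simp add: odd_pos)
      then have "r < s" using r prime_gt_1_nat[OF p(1)] by simp
      moreover have "r dvd t" using r less.prems by (metis dvd_mult_left)
      ultimately have "Q r" by (rule less.IH)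
      moreover have "odd p" using od p(2) by (meson dvd_trans)
      ultimately show ?thesis using assms(3)[OF p(1)] r less.prems by simp
    qed
  qed
  then show ?thesis by simp
qed

lemma small_cong:
  assumes "[x = y] (mod int p)" "prime p" "odd p" "x \<in> {-1, 0, 1}" "y \<in> {-1, 0, 1}"
  shows "x = y"
proof -
  have "p \<noteq> 2" using assms(3) by auto
  then have p: "int p > 2" using prime_ge_2_nat[OF assms(2)] by linarith
  have "int p dvd x - y" using assms(1) by (simp add: cong_iff_dvd_diff)
  moreover have "\<bar>x - y\<bar> < int p" using assms(4,5) p by auto
  ultimately show ?thesis by (metis dvd_imp_le_int eq_iff_diff_eq_0 abs_of_nonneg not_le of_nat_0_le_iff)
qed

lemma coprime_two_power: "prime p \<Longrightarrow> odd p \<Longrightarrow> coprime (2 ^ e :: int) (int p)"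
proof -
  assume "prime p" "odd p"
  then have "coprime (2 ^ e) p" by (simp add: coprime_power_left_iff)
  then show ?thesis by (metis coprime_int_iff of_nat_numeral of_nat_power)
qed

text \<open>
  The degrees \<open>M\<close> to which the statement is reduced: \<open>N\<close>, or \<open>2 N\<close> when the invariant of \<open>N\<close> is zero.
\<close>

locale split_form = artin_schreier_form type_arg m d a
  for type_arg :: "'a::alg_closed_field itself" and m d a +
  fixes M :: nat
  assumes M_pos: "M > 0" and W_F: "W \<subseteq> F M" and eps_M: "eps M \<noteq> 0"
begin

lemma W_in_M: "W_in M = W"
  using W_F by blast

lemma W_in_gcd:
  assumes n: "n > 0" shows "W_in n = W_in (gcd n M)"
proof (intro equalityI subsetI)
  fix x assume x: "x \<in> W_in n"
  then have "x \<in> GF2 (gcd (m * n) (m * M))"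
    using GF2_gcd[OF F_pos[OF n]] W_F by blast
  then show "x \<in> W_in (gcd n M)" using x by (simp add: gcd_mult_distrib_nat)
next
  fix x assume x: "x \<in> W_in (gcd n M)"
  obtain t where "n = gcd n M * t" by (metis dvdE gcd_dvd1)
  then show "x \<in> W_in n" using x F_mult[of x "gcd n M" t] by simp
qed

lemma q_M: "w \<in> W \<Longrightarrow> q M w = 0"
  using eps_M eps_neq_0_iff[OF M_pos] W_in_M by simp

text \<open>
  For positive \<open>n\<close> this says that \<open>n\<close> is at least as divisible by 2 as \<open>M\<close>.
\<close>

definition odd_cofactor :: "nat \<Rightarrow> bool" where
  "odd_cofactor n \<longleftrightarrow> n > 0 \<and> odd (M div gcd n M)"

lemma odd_cofactor_M: "odd_cofactor M" using M_pos by (simp add: odd_cofactor_def)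

lemma odd_cofactor_mult: "odd_cofactor n \<Longrightarrow> k > 0 \<Longrightarrow> odd_cofactor (n * k)"
proof -
  assume n: "odd_cofactor n" and k: "k > 0"
  have dv: "gcd n M dvd gcd (n * k) M" by (rule gcd_mono) simp_all
  obtain t where t: "gcd (n * k) M = gcd n M * t" using dv by (elim dvdE)
  obtain r where r: "M = gcd (n * k) M * r" by (metis dvdE gcd_dvd2)
  have g0: "gcd n M > 0" "gcd (n * k) M > 0" using M_pos by simp_all
  have "M div gcd (n * k) M = r" by (subst r) (use g0 in simp)
  moreover have "M div gcd n M = t * r"
  proof -
    have "M = gcd n M * (t * r)" using r t by (simp add: mult.assoc)
    then show ?thesis using g0(1) by (metis nonzero_mult_div_cancel_left less_numeral_extra(3))
  qed
  ultimately show ?thesis using n k by (simp add: odd_cofactor_def)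
qed

lemma gcd_double_odd_cofactor:
  assumes "odd_cofactor n" shows "gcd (2 * n) M = gcd n M"
proof -
  let ?g = "gcd n M"
  have n: "n > 0" and od: "odd (M div ?g)" using assms by (simp_all add: odd_cofactor_def)
  have g0: "?g > 0" using n by simp
  have nM: "n = ?g * (n div ?g)" "M = ?g * (M div ?g)" by simp_all
  have "coprime (n div ?g) (M div ?g)" using n by (intro div_gcd_coprime) auto
  then have "coprime (2 * (n div ?g)) (M div ?g)" using od by simp
  then have "gcd (?g * (2 * (n div ?g))) (?g * (M div ?g)) = ?g"
    by (rule gcd_scaled)
  moreover have "?g * (2 * (n div ?g)) = 2 * n" by (simp add: mult.left_commute)
  ultimately show ?thesis by simp
qed

lemma odd_cofactor_double: "odd_cofactor n \<Longrightarrow> odd_cofactor (2 * n)"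
  using odd_cofactor_mult[of n 2] by (simp add: mult.commute)

text \<open>
  In the compositum of \<open>F n\<close> and \<open>F M\<close>, an odd degree extension of \<open>F n\<close>, the trace of \<open>f w\<close> is the one over \<open>F n\<close>. It is also a
  multiple of the one over \<open>F M\<close>, which is zero.
\<close>

lemma q_odd_cofactor:
  assumes n: "odd_cofactor n" and w: "w \<in> W_in n" shows "q n w = 0"
proof -
  define t where "t = M div gcd n M"
  define r where "r = n div gcd n M"
  have od: "odd t" using n by (simp add: odd_cofactor_def t_def)
  have nt: "n * t = M * r"
    unfolding t_def r_def by (metis div_mult_swap dvd_div_mult gcd_dvd1 gcd_dvd2 mult.commute)
  have "q n w = q (n * t) w" using q_odd_multiple[OF _ od] w by simp
  also have "\<dots> = to_bit (tr (m * (M * r)) (f w))" by (simp only: q_def nt)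
  also have "tr (m * (M * r)) (f w) = of_nat r * tr (m * M) (f w)"
    using tr_multiple[of "f w" "m * M" r] f_closed[of w M] w W_F by (auto simp: mult.assoc)
  also have "tr (m * M) (f w) = 0"
    using q_M[of w] w by (simp add: q_def to_bit_eq_0)
  finally show ?thesis by simp
qed

lemma eps_odd_cofactor: "odd_cofactor n \<Longrightarrow> eps n \<in> {1, -1}"
  using q_odd_cofactor eps_cases[of n] by (auto simp: odd_cofactor_def)

definition K :: "nat \<Rightarrow> int" where
  "K n = (\<Sum>w\<in>W_in n. chi (kappa w))"

lemma T_double_odd_cofactor:
  assumes "odd_cofactor n" shows "T (2 * n) = K n"
  using T_double[of n] assms q_odd_cofactor[OF assms] by (simp add: odd_cofactor_def K_def)

lemma K_gcd: "n > 0 \<Longrightarrow> K n = K (gcd n M)"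
  unfolding K_def by (subst W_in_gcd) simp_all

lemma rad_dim_gcd: "n > 0 \<Longrightarrow> rad_dim n = rad_dim (gcd n M)"
  unfolding rad_dim_def by (subst W_in_gcd) simp_all

lemma rad_dim_double: "odd_cofactor n \<Longrightarrow> rad_dim (2 * n) = rad_dim n"
  using rad_dim_gcd[of n] rad_dim_gcd[of "2 * n"] gcd_double_odd_cofactor[of n] by (simp add: odd_cofactor_def)

lemma rad_dim_M: "rad_dim M = 2 * d"
proof -
  have "(2::nat) ^ rad_dim M = 2 ^ (2 * d)"
    using card_W_in[OF M_pos] card_W(2) by (simp only: W_in_M)
  then show ?thesis by (simp only: power_inject_exp)
qed

theorem sum_chi_kappa_W: "(\<Sum>w\<in>W. chi (kappa w)) = - (2 ^ d)"
proof -
  have T: "T (2 * M) = (\<Sum>w\<in>W. chi (kappa w))"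
    using T_double_odd_cofactor[OF odd_cofactor_M] by (simp add: K_def W_in_M)
  have "T (2 * M) = eps (2 * M) * 2 ^ d"
    using rad_dim_double[OF odd_cofactor_M] by (simp add: T_def rad_dim_M)
  with T sum_chi_kappa_W_neq eps_odd_cofactor[OF odd_cofactor_double[OF odd_cofactor_M]] show ?thesis by auto
qed

lemma eps_double_M: "eps (2 * M) = -1"
proof -
  have "eps (2 * M) * 2 ^ d = - (2 ^ d)"
    using T_double_odd_cofactor[OF odd_cofactor_M] rad_dim_double[OF odd_cofactor_M] sum_chi_kappa_W
    by (simp add: T_def rad_dim_M K_def W_in_M)
  then have "(eps (2 * M) + 1) * 2 ^ d = 0" by (simp add: algebra_simps)
  then show ?thesis by simp
qed

text \<open>
  For \<open>n\<close> with odd cofactor this sign is the quotient of \<open>T n\<close> by \<open>T (2 n)\<close>. It is insensitive to a growth of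
  \<open>W \<inter> F n\<close>, in contrast to \<open>eps n\<close>.
\<close>

definition ratio :: "nat \<Rightarrow> int" where
  "ratio n = eps n * eps (2 * n)"

text \<open>
  Both \<open>T n\<close> and \<open>T (2 n)\<close> are signed powers of 2 with the same exponent, and they satisfy the same congruence modulo \<open>p\<close>; so the
  signs \<open>ratio (n p)\<close> and \<open>ratio n\<close> agree modulo \<open>p\<close>, hence are equal.
\<close>

lemma ratio_prime:
  assumes n: "odd_cofactor n" and p: "prime p" "odd p"
  shows "ratio (n * p) = ratio n"
proof -
  have p0: "p > 0" using p(1) by (rule prime_gt_0_nat)
  have rT: "T k = ratio k * T (2 * k)" if k: "odd_cofactor k" for k
  proof -
    have "eps (2 * k) * eps (2 * k) = 1" using eps_odd_cofactor[OF odd_cofactor_double[OF k]] by auto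
    then show ?thesis by (simp add: T_def ratio_def rad_dim_double[OF k] mult.assoc flip: mult.assoc[of "eps (2 * k)"])
  qed
  have r1: "ratio k \<in> {-1, 0, 1}" if k: "odd_cofactor k" for k
    using eps_odd_cofactor[OF k] eps_odd_cofactor[OF odd_cofactor_double[OF k]] by (auto simp: ratio_def)
  have np: "odd_cofactor (n * p)" by (rule odd_cofactor_mult[OF n p0])
  have n0: "n > 0" using n by (simp add: odd_cofactor_def)
  have "[ratio (n * p) * T (2 * n) = ratio (n * p) * T (2 * (n * p))] (mod int p)"
    using T_cong[of "2 * n" p] n0 p by (intro cong_mult cong_refl) (simp add: mult.assoc cong_sym)
  also have "[ratio (n * p) * T (2 * (n * p)) = ratio n * T (2 * n)] (mod int p)"
    using T_cong[OF n0 p] by (simp only: rT[OF n] rT[OF np])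
  finally have "[ratio (n * p) * T (2 * n) = ratio n * T (2 * n)] (mod int p)" .
  moreover have "coprime (T (2 * n)) (int p)"
    using eps_odd_cofactor[OF odd_cofactor_double[OF n]] coprime_two_power[OF p] by (auto simp: T_def)
  ultimately have "[ratio (n * p) = ratio n] (mod int p)"
    by (simp add: cong_mult_rcancel)
  then show ?thesis by (rule small_cong[OF _ p r1[OF np] r1[OF n]])
qed

lemma ratio_odd_multiple:
  assumes "odd_cofactor n" "odd t" shows "ratio (n * t) = ratio n"
  using assms(2)
proof (induction rule: odd_multiple_induct)
  case (step s p)
  have "s > 0" using step(3) assms(2) by (metis dvd_0_left_iff mult_0 gr0I even_zero)
  then have "ratio (n * s * p) = ratio (n * s)"
    using ratio_prime[OF odd_cofactor_mult[OF assms(1)]] step by blast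
  then show ?case using step by (simp add: mult.assoc)
qed simp

text \<open>
  Passing from \<open>gcd n M\<close> to \<open>n\<close> through odd primes never enlarges \<open>W \<inter> F n\<close>, so the congruence for \<open>T\<close> is one between values of
  \<open>eps\<close>, which differ by at most 2.
\<close>

lemma eps_odd_over_gcd:
  assumes n: "n > 0" and od: "odd (n div gcd n M)"
  shows "eps n = eps (gcd n M)"
proof -
  let ?g = "gcd n M"
  have g0: "?g > 0" using n by simp
  have ng: "n = ?g * (n div ?g)" by simp
  have "eps (?g * (n div ?g)) = eps ?g"
    using od
  proof (induction rule: odd_multiple_induct)
    case (step s p)
    have gc: "gcd (?g * r) M = ?g" if "r dvd n div ?g" for r
    proof (rule dvd_antisym)
      have "?g * r dvd n" using that ng by (metis dvd_refl mult_dvd_mono)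
      then show "gcd (?g * r) M dvd ?g" by (intro gcd_mono) auto
      show "?g dvd gcd (?g * r) M" by simp
    qed
    have s0: "s * p > 0" using step(3) od by (metis dvd_0_left_iff gr0I even_zero)
    have pos: "?g * s > 0" "?g * (s * p) > 0" using s0 g0 by simp_all
    have sd: "s dvd n div ?g" using step(3) by (rule dvd_mult_left)
    have rad_dim: "rad_dim (?g * (s * p)) = rad_dim (?g * s)"
      using rad_dim_gcd[OF pos(1)] rad_dim_gcd[OF pos(2)] gc[OF sd] gc[OF step(3)] by simp
    have "[T (?g * s * p) = T (?g * s)] (mod int p)" by (rule T_cong[OF pos(1) step(1,2)])
    then have "[eps (?g * (s * p)) * 2 ^ (rad_dim (?g * s) div 2) = eps (?g * s) * 2 ^ (rad_dim (?g * s) div 2)] (mod int p)"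
      by (simp only: T_def rad_dim mult.assoc)
    then have "[eps (?g * (s * p)) = eps (?g * s)] (mod int p)"
      using coprime_two_power[OF step(1,2)] by (simp add: cong_mult_rcancel)
    then have "eps (?g * (s * p)) = eps (?g * s)"
      by (rule small_cong[OF _ step(1,2)]) (use eps_cases[OF pos(1)] eps_cases[OF pos(2)] in auto)
    then show ?case using step(4) by simp
  qed simp
  then show ?thesis by simp
qed

text \<open>
  A signed power of 2 is not divisible by an odd prime.
\<close>

lemma eps_neq_0_odd_multiple:
  assumes n: "n > 0" and t: "odd t" and e: "eps n \<noteq> 0"
  shows "eps (n * t) \<noteq> 0"
  using t
proof (induction rule: odd_multiple_induct)
  case one
  then show ?case using e by simp
next
  case (step s p)
  have s0: "n * s > 0" using step(3) t n by (metis dvd_0_left_iff gr0I even_zero mult_eq_0_iff)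
  have "eps (n * s * p) \<noteq> 0"
  proof
    assume "eps (n * s * p) = 0"
    then have "[0 = T (n * s)] (mod int p)" using T_cong[OF s0 step(1,2)] by (simp add: T_def)
    then have "[T (n * s) = 0] (mod int p)" by (rule cong_sym)
    then have "int p dvd T (n * s)" by (simp only: cong_0_iff)
    then have "int p dvd 2 ^ (rad_dim (n * s) div 2)"
      using eps_cases[OF s0] step(4) by (auto simp: T_def)
    then have "is_unit (int p)"
      by (rule coprime_common_divisor[OF coprime_two_power[OF step(1,2)] _ dvd_refl])
    then show False using prime_gt_1_nat[OF step(1)] by simp
  qed
  then show ?case by (simp add: mult.assoc)
qed

text \<open>
  Write \<open>n = 2 n'\<close> and \<open>g = gcd n M\<close>. Doubling expresses \<open>T n\<close> and \<open>T (2 g)\<close> by the same sum of \<open>kappa\<close> over \<open>W \<inter> F g\<close>, so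
  \<open>eps n = eps (2 g)\<close>. The ratio at \<open>g\<close> is the ratio at \<open>M\<close>, which is \<open>- eps M\<close>.
\<close>

lemma eps_even_over_gcd:
  assumes n: "odd_cofactor n" and ev: "even (n div gcd n M)"
  shows "eps n = - eps M * eps (gcd n M)"
proof -
  let ?g = "gcd n M"
  have n0: "n > 0" and od: "odd (M div ?g)" using n by (simp_all add: odd_cofactor_def)
  have g0: "?g > 0" using n0 by simp
  obtain r where r: "n div ?g = 2 * r" using ev by blast
  define n' where "n' = ?g * r"
  have nn: "n = 2 * n'" using r by (metis dvd_mult_div_cancel gcd_dvd1 mult.left_commute n'_def)
  have cop: "coprime (2 * r) (M div ?g)" using n0 r by (metis div_gcd_coprime less_numeral_extra(3))
  then have "coprime r (M div ?g)" by simp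
  then have "gcd (?g * r) (?g * (M div ?g)) = ?g"
    by (rule gcd_scaled)
  then have g': "gcd n' M = ?g" by (simp add: n'_def)
  have n'0: "n' > 0" using nn n0 by simp
  have an': "odd_cofactor n'" using n'0 od g' by (simp add: odd_cofactor_def)
  have ag: "odd_cofactor ?g" using g0 od by (simp add: odd_cofactor_def)
  have "T n = T (2 * ?g)"
  proof -
    have "T n = K n'" using T_double_odd_cofactor[OF an'] by (simp only: nn[symmetric])
    also have "\<dots> = K ?g" unfolding g'[symmetric] by (rule K_gcd[OF n'0])
    finally show ?thesis by (simp only: T_double_odd_cofactor[OF ag])
  qed
  moreover have "rad_dim n = rad_dim ?g" by (rule rad_dim_gcd[OF n0])
  moreover have "rad_dim (2 * ?g) = rad_dim ?g" by (rule rad_dim_double[OF ag])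
  ultimately have e: "eps n = eps (2 * ?g)" by (simp add: T_def)
  have "ratio (?g * (M div ?g)) = ratio ?g" by (rule ratio_odd_multiple[OF ag od])
  then have "eps ?g * eps (2 * ?g) = - eps M" by (simp add: ratio_def eps_double_M)
  then show ?thesis using e eps_odd_cofactor[OF ag] eps_odd_cofactor[OF n] by auto
qed

text \<open>
  The square of the sum \<open>- 2^d\<close> is the order of \<open>W\<close>, which leaves order 1 for the radical.
\<close>

lemma pair_nondegenerate:
  assumes "x \<in> W" "\<And>y. y \<in> W \<Longrightarrow> pair x y = 0" shows "x = 0"
proof -
  let ?rad = "polar_radical W kappa"
  have "int (2 ^ (2 * d)) * (\<Sum>x\<in>?rad. chi (kappa x)) = (- (2 ^ d))\<^sup>2"
    using sum_chi_square[OF W_F2_space kappa_quadratic] by (simp only: sum_chi_kappa_W card_W(2))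
  then have "(2 ^ (2 * d) :: int) * (\<Sum>x\<in>?rad. chi (kappa x)) = 2 ^ (2 * d) * 1"
    by (simp add: power_even_eq)
  then have "(\<Sum>x\<in>?rad. chi (kappa x)) = 1" by simp
  then have "card ?rad = 1"
    unfolding sum_chi_radical[OF W_F2_space kappa_quadratic] by (simp split: if_splits)
  moreover have "0 \<in> ?rad" "x \<in> ?rad"
    using F2_spaceD(2)[OF radical_F2_space[OF W_F2_space kappa_quadratic]] assms
    by (auto simp: polar_radical_def)
  ultimately show ?thesis by (metis card_1_singletonE singletonD)
qed

lemma double_perp:
  assumes U: "F2_space U" "U \<subseteq> W" and y: "y \<in> W" "\<And>h. h \<in> orth U \<Longrightarrow> pair h y = 0"
  shows "y \<in> U"
proof -
  have "\<exists>u\<in>U. \<forall>x\<in>W. pair x y = pair x u"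
  proof (rule functional_eq_pairing[OF W_F2_space U(1)])
    show "additive_on W (\<lambda>x. pair x u)" if "u \<in> U" for u
      using polarisation_additive(2)[OF kappa_quadratic] that U(2) by blast
    show "additive_on U (pair x)" if "x \<in> W" for x
      using additive_on_subset[OF polarisation_additive(1)[OF kappa_quadratic that] U(2)] .
    show "additive_on W (\<lambda>x. pair x y)" by (rule polarisation_additive(2)[OF kappa_quadratic y(1)])
  qed (use y in \<open>auto simp: perp_def\<close>)
  then obtain u where u: "u \<in> U" "\<And>x. x \<in> W \<Longrightarrow> pair x y = pair x u" by blast
  have uW: "u \<in> W" using u U by blast
  have "y + u = 0"
  proof (rule pair_nondegenerate[OF W_add[OF y(1) uW]])
    fix x assume x: "x \<in> W"
    have "pair x (y + u) = 0" using u(2)[OF x] by (simp add: pair_add(2)[OF y(1) uW x])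
    then show "pair (y + u) x = 0" by (simp add: pair_commute)
  qed
  then show ?thesis using u(1) by (simp add: add_eq_0)
qed

section \<open>A nonzero invariant below a split degree\<close>

lemma orth_frob:
  assumes U: "F2_space U" "U \<subseteq> W" and st: "\<And>u. u \<in> U \<Longrightarrow> u + frob n u \<in> U" and w: "w \<in> orth U"
  shows "frob n w \<in> orth U"
proof -
  have stU: "frob n u \<in> U" if "u \<in> U" for u
  proof -
    have "u + (u + frob n u) \<in> U" by (rule F2_spaceD(3)[OF U(1) that st[OF that]])
    then show ?thesis by simp
  qed
  have img: "frob n ` U = U" by (rule frob_image_eq[OF F2_spaceD(1)[OF U(1)] stU])
  have wW: "w \<in> W" by (rule orth_W[OF w])
  have "pair (frob n w) u = 0" if u: "u \<in> U" for u
  proof -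
    obtain v where v: "v \<in> U" "u = frob n v" using img u by blast
    then have "v \<in> W" using U(2) by blast
    then show ?thesis using kappa_polar_frob[OF wW] orth_pair[OF w v(1)] v(2) by simp
  qed
  then show ?thesis using wW by (simp add: perp_def W_frob)
qed

text \<open>
  On the orthogonal space of \<open>U\<close> modulo \<open>U\<close>, the orthogonal space of the kernel of \<open>1 + frob n\<close> is the image of its adjoint
  \<open>1 + (frob n)^(-1)\<close>, which equals the image of \<open>1 + frob n\<close>.
\<close>

lemma orthogonal_to_frob_fixed:
  assumes U: "F2_space U" "U \<subseteq> W" and st: "\<And>u. u \<in> U \<Longrightarrow> u + frob n u \<in> U"
    and w0: "w0 \<in> W" and orth: "\<And>p. p \<in> frob_fixed n U \<Longrightarrow> pair p w0 = 0"
  shows "\<exists>h\<in>orth U. w0 + (h + frob n h) \<in> U"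
proof -
  have HW: "orth U \<subseteq> W" using orth_W by blast
  note H = orth_F2_space[OF U(2)]
  have Hfr: "\<And>x. x \<in> orth U \<Longrightarrow> frob n x \<in> orth U" by (rule orth_frob[OF U st])
  have DH: "x + frob n x \<in> orth U" if "x \<in> orth U" for x
    by (rule F2_spaceD(3)[OF H that Hfr[OF that]])
  have "\<exists>h\<in>orth U. \<forall>x\<in>orth U. pair x w0 = pair (x + frob n x) h"
  proof (rule functional_eq_pairing[OF H H])
    show "additive_on (orth U) (\<lambda>x. pair (x + frob n x) h)" if h: "h \<in> orth U" for h
      unfolding additive_on_def
    proof (intro ballI)
      fix x y assume x: "x \<in> orth U" and y: "y \<in> orth U"
      have "x + y + frob n (x + y) = (x + frob n x) + (y + frob n y)"
        by (simp add: frob_add algebra_simps)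
      moreover have "pair ((x + frob n x) + (y + frob n y)) h = pair (x + frob n x) h + pair (y + frob n y) h"
        by (rule pair_add(1)) (use DH x y h HW in blast)+
      ultimately show "pair (x + y + frob n (x + y)) h = pair (x + frob n x) h + pair (y + frob n y) h"
        by (simp only:)
    qed
    show "additive_on (orth U) (pair (x + frob n x))" if "x \<in> orth U" for x
      using additive_on_subset[OF polarisation_additive(1)[OF kappa_quadratic] HW] DH[OF that] HW by blast
    show "additive_on (orth U) (\<lambda>x. pair x w0)"
      by (rule additive_on_subset[OF polarisation_additive(2)[OF kappa_quadratic w0] HW])
    fix x assume x: "x \<in> orth U" and van: "\<forall>h\<in>orth U. pair (x + frob n x) h = 0"
    have "x + frob n x \<in> U"
      by (rule double_perp[OF U]) (use DH[OF x] HW van pair_commute in auto)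
    then show "pair x w0 = 0" using x orth by (simp add: frob_fixed_def)
  qed
  then obtain h where h: "h \<in> orth U" and hw: "\<And>x. x \<in> orth U \<Longrightarrow> pair x w0 = pair (x + frob n x) h"
    by blast
  have "frob n ` orth U = orth U"
    by (rule frob_image_eq[OF F2_spaceD(1)[OF H] Hfr])
  then obtain k where k: "k \<in> orth U" "h = frob n k" using h by blast
  have kW: "k \<in> W" "frob n k \<in> W" "k + frob n k \<in> W" using k h DH HW by blast+
  have "pair x (w0 + (k + frob n k)) = 0" if x: "x \<in> orth U" for x
  proof -
    have xW: "x \<in> W" "frob n x \<in> W" using x Hfr HW by blast+
    have "pair (x + frob n x) (frob n k) = pair x (frob n k) + pair x k"
      using kappa_polar_frob[OF xW(1) kW(1)] by (simp add: pair_add(1)[OF xW kW(2)])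
    then have "pair x w0 = pair x (k + frob n k)"
      using hw[OF x] k(2) by (simp add: pair_add(2)[OF kW(1,2) xW(1)] add.commute)
    then show ?thesis by (simp add: pair_add(2)[OF w0 kW(3) xW(1)])
  qed
  then have "w0 + (k + frob n k) \<in> U"
    by (rule double_perp[OF U W_add[OF w0 kW(3)]])
  then show ?thesis using k(1) by blast
qed

text \<open>
  The vector \<open>w0\<close> is adjoined to \<open>U\<close>. If a vector \<open>w1\<close> of the new orthogonal space moves by \<open>w0\<close> modulo \<open>U\<close>, the lift of \<open>w0\<close> is chosen
  such that \<open>w1\<close> has defect 0, and additivity of the defect gives the rest. The fixed space modulo \<open>U\<close> then keeps its
  dimension, since \<open>w0\<close> is orthogonal to it. If there is no such \<open>w1\<close>, then \<open>w0\<close> is not orthogonal to the old fixed space, whose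
  dimension drops by 2. Here \<open>kappa w0 = 0\<close> is used: it ensures that any \<open>h\<close> with \<open>h + frob n h\<close> in \<open>w0 + U\<close> is orthogonal to \<open>w0\<close>.
\<close>

lemma admissible_extend:
  assumes gd: "admissible n U s" and w0: "w0 \<in> frob_fixed n U" "w0 \<notin> U" and k0: "kappa w0 = 0"
  shows "\<exists>U' s'. admissible n U' s' \<and> card U < card U'"
proof -
  have l: "lift U s" and st: "\<And>u. u \<in> U \<Longrightarrow> u + frob n u \<in> U"
    and def0: "\<And>w. w \<in> frob_fixed n U \<Longrightarrow> defect n s w = 0"
    using gd by (auto simp: admissible_def)
  obtain t where t: "card (frob_fixed n U) * card U = t\<^sup>2" using gd by (auto simp: admissible_def)
  note U = liftD(1)[OF l] and UW = liftD(2)[OF l]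
  note P = frob_fixed_F2_space[OF l, of n]
  have w0H: "w0 \<in> orth U" and w0U: "w0 + frob n w0 \<in> U" using w0 by (auto simp: frob_fixed_def)
  have w0W: "w0 \<in> W" by (rule orth_W[OF w0H])
  define U1 where "U1 = U \<union> (\<lambda>u. u + w0) ` U"
  have U1: "F2_space U1" unfolding U1_def by (rule F2_space_adjoin[OF W_F2_space U UW w0W])
  have UU1: "U \<subseteq> U1" and w0U1: "w0 \<in> U1" using F2_spaceD(2)[OF U] by (auto simp: U1_def image_iff)
  have cU1: "card U1 = 2 * card U"
  proof (rule card_index_two[OF U1 U UU1 w0U1 w0(2)])
    fix x assume "x \<in> U1" "x \<notin> U"
    then obtain u where "u \<in> U" "x = u + w0" by (auto simp: U1_def)
    then show "x + w0 \<in> U" by (simp add: add.assoc)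
  qed
  have st1: "u + frob n u \<in> U1" if uU1: "u \<in> U1" for u
  proof -
    consider "u \<in> U" | v where "v \<in> U" "u = v + w0" using uU1 by (auto simp: U1_def)
    then show ?thesis
    proof cases
      case 1
      then show ?thesis using st UU1 by blast
    next
      case (2 v)
      have "u + frob n u = (v + frob n v) + (w0 + frob n w0)"
        by (simp add: 2 frob_add algebra_simps)
      then have "u + frob n u \<in> U" using F2_spaceD(3)[OF U st[OF 2(1)] w0U] by simp
      then show ?thesis using UU1 by blast
    qed
  qed
  have H1: "w \<in> orth U1 \<longleftrightarrow> w \<in> orth U \<and> pair w w0 = 0" for w
  proof
    assume "w \<in> orth U1"
    then show "w \<in> orth U \<and> pair w w0 = 0" using UU1 w0U1 by (auto simp: perp_def)
  next
    assume w: "w \<in> orth U \<and> pair w w0 = 0"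
    then have wW: "w \<in> W" using orth_W by blast
    have "pair w u = 0" if uU1: "u \<in> U1" for u
    proof -
      consider "u \<in> U" | v where "v \<in> U" "u = v + w0" using uU1 by (auto simp: U1_def)
      then show ?thesis
      proof cases
        case 1
        then show ?thesis using w orth_pair by blast
      next
        case (2 v)
        then have "v \<in> W" using UW by blast
        moreover have "pair w v = 0" by (rule orth_pair[OF _ 2(1)]) (use w in blast)
        ultimately show ?thesis using 2 w by (simp add: pair_add(2)[OF _ w0W wW])
      qed
    qed
    then show "w \<in> orth U1" using wW by (simp add: perp_def)
  qed
  have lift1: "\<exists>s1. lift U1 s1 \<and> (\<forall>u\<in>U. s1 u = s u) \<and> s1 w0 = e0" if e0: "e0\<^sup>2 + e0 = f w0" for e0
  proof -
    define s1 where "s1 = (\<lambda>x. if x \<in> U then s x else e0 + s (x + w0) + g (x + w0) w0)"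
    have "lift U1 s1"
      unfolding U1_def s1_def by (rule lift_extend(1)[OF l w0H w0(2) k0 e0])
    moreover have "\<forall>u\<in>U. s1 u = s u" by (simp add: s1_def)
    moreover have "s1 w0 = e0" using w0(2) by (simp add: s1_def lift_0[OF l])
    ultimately show ?thesis by blast
  qed
  have ext: "defect n s1 w = 0" if "\<forall>u\<in>U. s1 u = s u" "w \<in> orth U" "w + frob n w \<in> U" for s1 w
    using def0[of w] that by (simp add: defect_def frob_fixed_def)
  obtain e0 where e0: "e0\<^sup>2 + e0 = f w0"
  proof -
    define p :: "'a poly" where "p = [:f w0, 1, 1:]"
    obtain x where "poly p x = 0" using alg_closed_imp_poly_has_root[of p] by (auto simp: p_def)
    then have "(x\<^sup>2 + x) + f w0 = 0" by (simp add: p_def power2_eq_square algebra_simps)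
    then show ?thesis using that by (simp only: add_eq_0)
  qed
  obtain s1 where l1: "lift U1 s1" and s1U: "\<forall>u\<in>U. s1 u = s u" and s1w0: "s1 w0 = e0"
    using lift1[OF e0] by blast
  note P1 = frob_fixed_F2_space[OF l1, of n]
  show ?thesis
  proof (cases "\<exists>w1\<in>frob_fixed n U1. w1 + frob n w1 \<notin> U")
    case False
    have P1P: "frob_fixed n U1 \<subseteq> frob_fixed n U" using False H1 by (auto simp: frob_fixed_def)
    have d1: "\<forall>w\<in>frob_fixed n U1. defect n s1 w = 0"
      using ext[OF s1U] P1P by (auto simp: frob_fixed_def)
    \<comment> \<open>Otherwise \<open>w0\<close> would be in the image of \<open>1 + frob n\<close> modulo \<open>U\<close>, which yields a vector \<open>w1\<close>.\<close>
    have "\<not> (\<forall>p\<in>frob_fixed n U. pair p w0 = 0)"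
    proof
      assume "\<forall>p\<in>frob_fixed n U. pair p w0 = 0"
      then obtain h where h: "h \<in> orth U" "w0 + (h + frob n h) \<in> U"
        using orthogonal_to_frob_fixed[OF U UW st w0W] by blast
      define u where "u = w0 + (h + frob n h)"
      have hu: "h + frob n h = u + w0" by (simp add: u_def algebra_simps)
      have uU: "u \<in> U" using h by (simp add: u_def)
      have uW: "u \<in> W" and hW: "h \<in> W" using uU UW h orth_W by blast+
      have fh: "frob n h = h + (u + w0)" using hu by (metis add_self_left)
      have "kappa (frob n h) = kappa h + kappa (u + w0) + pair h (u + w0)"
        unfolding fh by (rule quadratic_add)
      moreover have "kappa (u + w0) = 0"
        using lift_singular(2)[OF l uU] k0 orth_pair[OF w0H uU]
        by (simp add: quadratic_add[of kappa] pair_commute[of u])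
      moreover have "pair h (u + w0) = pair h w0"
        using orth_pair[OF h(1) uU] by (simp add: pair_add(2)[OF uW w0W hW])
      ultimately have "kappa h = kappa h + pair h w0" using kappa_frob[OF hW] by simp
      then have "pair h w0 = 0" by (metis bit_double_left bit_double)
      then have "h \<in> frob_fixed n U1" using h(1) hu uU H1 by (auto simp: frob_fixed_def U1_def)
      moreover have "h + frob n h \<notin> U"
      proof
        assume hU: "h + frob n h \<in> U"
        have "u + (u + w0) \<in> U" using F2_spaceD(3)[OF U uU hU] unfolding hu .
        then show False using w0(2) by simp
      qed
      ultimately show False using False by blast
    qed
    then obtain p where p: "p \<in> frob_fixed n U" "pair p w0 = 1" by auto
    have pW: "p \<in> W" using p orth_W by (auto simp: frob_fixed_def)
    have mem1: "x \<in> frob_fixed n U1" if "x \<in> frob_fixed n U" "pair x w0 = 0" for x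
      using that H1 UU1 by (auto simp: frob_fixed_def)
    have "card (frob_fixed n U) = 2 * card (frob_fixed n U1)"
    proof (rule card_index_two[OF P P1 P1P p(1)])
      show "p \<notin> frob_fixed n U1" using p(2) H1 by (auto simp: frob_fixed_def)
      fix x assume x: "x \<in> frob_fixed n U" "x \<notin> frob_fixed n U1"
      then have "pair x w0 \<noteq> 0" using mem1 by blast
      then have "pair x w0 = 1" by simp
      moreover have xW: "x \<in> W" using x orth_W by (auto simp: frob_fixed_def)
      ultimately have "pair (x + p) w0 = 0" using p(2) by (simp add: pair_add(1)[OF xW pW w0W])
      then show "x + p \<in> frob_fixed n U1" using mem1 F2_spaceD(3)[OF P x(1) p(1)] by blast
    qed
    then have "card (frob_fixed n U1) * card U1 = t\<^sup>2" using t cU1 by simp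
    then have "admissible n U1 s1" unfolding admissible_def using l1 st1 d1 by blast
    then show ?thesis using cU1 F2_space_card_pos[OF U] by (intro exI[of _ U1] exI[of _ s1]) simp
  next
    case True
    then obtain w1 where w1: "w1 \<in> frob_fixed n U1" "w1 + frob n w1 \<notin> U" by blast
    have w1H: "w1 \<in> orth U" "pair w1 w0 = 0" "w1 + frob n w1 \<in> U1" "w1 \<in> orth U1"
      using w1 H1 by (auto simp: frob_fixed_def)
    have w1W: "w1 \<in> W" by (rule orth_W[OF w1H(1)])
    obtain u where u: "u \<in> U" "w1 + frob n w1 = u + w0"
      using w1(2) w1H(3) by (auto simp: U1_def)
    have uW: "u \<in> W" using u UW by blast
    have fw1H: "frob n w1 \<in> orth U" by (rule orth_frob[OF U UW st w1H(1)])
    have fw1W: "frob n w1 \<in> W" by (rule orth_W[OF fw1H])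
    \<comment> \<open>Passing from \<open>e0\<close> to the other root \<open>e0 + 1\<close> changes the defect of \<open>w1\<close> by 1, so one root kills it.\<close>
    obtain s2 where l2: "lift U1 s2" and s2U: "\<forall>v\<in>U. s2 v = s v" and d2: "defect n s2 w1 = 0"
    proof (cases "defect n s1 w1 = 0")
      case True
      then show ?thesis using that l1 s1U by blast
    next
      case False
      then have d1: "defect n s1 w1 = 1" using defect_bit_val[OF l1 w1W w1H(3)] by blast
      have "(e0 + 1)\<^sup>2 + (e0 + 1) = f w0" using e0 by (simp add: square_add algebra_simps)
      then obtain s2 where s2: "lift U1 s2" "\<forall>v\<in>U. s2 v = s v" "s2 w0 = e0 + 1"
        using lift1 by blast
      have "s2 (u + w0) = s1 (u + w0) + 1"
        using liftD(4)[OF s2(1), of u w0] liftD(4)[OF l1, of u w0] u(1) UU1 w0U1 s2 s1U s1w0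
        by (simp add: subset_iff algebra_simps)
      then have "defect n s2 w1 = defect n s1 w1 + 1" by (simp add: defect_def u(2) algebra_simps)
      then show ?thesis using that s2 d1 by simp
    qed
    have sumU: "x + w1 \<in> frob_fixed n U" if x: "x \<in> frob_fixed n U1" "x \<notin> frob_fixed n U" for x
    proof -
      have xH: "x \<in> orth U" "x + frob n x \<in> U1" using x H1 by (auto simp: frob_fixed_def)
      then have "x + frob n x \<notin> U" using x by (auto simp: frob_fixed_def)
      then obtain v where v: "v \<in> U" "x + frob n x = v + w0" using xH(2) by (auto simp: U1_def)
      have "(x + w1) + frob n (x + w1) = (x + frob n x) + (w1 + frob n w1)"
        by (simp add: frob_add algebra_simps)
      also have "\<dots> = v + u" by (simp add: u(2) v(2) algebra_simps)
      finally have "(x + w1) + frob n (x + w1) \<in> U" using F2_spaceD(3)[OF U v(1) u(1)] by simp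
      moreover have "x + w1 \<in> orth U"
        by (rule F2_spaceD(3)[OF orth_F2_space[OF UW] xH(1) w1H(1)])
      ultimately show ?thesis by (simp add: frob_fixed_def)
    qed
    have orth: "pair p w0 = 0" if p: "p \<in> frob_fixed n U" for p
    proof -
      have pH: "p \<in> orth U" "p + frob n p \<in> U" using p by (auto simp: frob_fixed_def)
      have pW: "p \<in> W" "frob n p \<in> W" using orth_W[OF pH(1)] by (simp_all add: W_frob)
      have w0e: "w0 = u + (w1 + frob n w1)" using u(2) by simp
      have "pair p (w1 + frob n w1) = pair (frob n p) (frob n w1) + pair p (frob n w1)"
        using kappa_polar_frob[OF pW(1) w1W] by (simp add: pair_add(2)[OF w1W fw1W pW(1)])
      also have "\<dots> = pair (p + frob n p) (frob n w1)"
        by (simp add: pair_add(1)[OF pW fw1W] add.commute)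
      also have "\<dots> = 0" using orth_pair[OF fw1H pH(2)] by (simp add: pair_commute)
      finally have "pair p (w1 + frob n w1) = 0" .
      then show ?thesis
        unfolding w0e pair_add(2)[OF uW W_add[OF w1W fw1W] pW(1)] using orth_pair[OF pH(1) u(1)] by simp
    qed
    have PP1: "frob_fixed n U \<subseteq> frob_fixed n U1" using orth H1 UU1 by (auto simp: frob_fixed_def)
    have "w1 \<notin> frob_fixed n U" using w1(2) by (simp add: frob_fixed_def)
    from card_index_two[OF P1 P PP1 w1(1) this sumU]
    have "card (frob_fixed n U1) * card U1 = (2 * t)\<^sup>2" using t cU1 by (simp add: power_mult_distrib)
    moreover have "defect n s2 w = 0" if w: "w \<in> frob_fixed n U1" for w
    proof (cases "w \<in> frob_fixed n U")
      case True
      then show ?thesis using ext[OF s2U] by (auto simp: frob_fixed_def)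
    next
      case False
      have "w + w1 \<in> frob_fixed n U" by (rule sumU[OF w False])
      then have "defect n s2 (w + w1) = 0" using ext[OF s2U] by (auto simp: frob_fixed_def)
      moreover have "defect n s2 (w + w1) = defect n s2 w + defect n s2 w1"
        by (rule defect_add[OF l2]) (use w w1H in \<open>auto simp: frob_fixed_def\<close>)
      ultimately show ?thesis using d2 by simp
    qed
    ultimately have "admissible n U1 s2" unfolding admissible_def using l2 st1 by blast
    then show ?thesis using cU1 F2_space_card_pos[OF U] by (intro exI[of _ U1] exI[of _ s2]) simp
  qed
qed

lemma admissible_maximal:
  assumes n: "n > 0" and e: "eps n \<noteq> 0"
  shows "\<exists>U s. admissible n U s \<and> (\<forall>w\<in>frob_fixed n U. kappa w = 0 \<longrightarrow> w \<in> U)"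
proof -
  let ?Q = "\<lambda>k. \<exists>U s. admissible n U s \<and> card U = k"
  have ex: "?Q (card {0::'a})" using admissible_trivial[OF n e] by blast
  have bd: "\<forall>k. ?Q k \<longrightarrow> k \<le> card W"
    using liftD(2) card_mono[OF card_W(1)] by (auto simp: admissible_def)
  obtain k where k: "?Q k" "\<forall>j. ?Q j \<longrightarrow> j \<le> k" using Nat.ex_has_greatest_nat[OF ex bd] by blast
  then obtain U s where U: "admissible n U s" "card U = k" by blast
  have "w \<in> U" if "w \<in> frob_fixed n U" "kappa w = 0" for w
    using admissible_extend[OF U(1) that(1) _ that(2)] k(2) U(2) by (metis not_le)
  then show ?thesis using U(1) by blast
qed

lemma funpow_add_frob: "((\<lambda>x. x + frob n x) ^^ (2 ^ j)) x = x + frob (n * 2 ^ j) x"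
proof (induction j arbitrary: x)
  case (Suc j)
  have "((\<lambda>x. x + frob n x) ^^ (2 ^ Suc j)) x
      = ((\<lambda>x. x + frob n x) ^^ (2 ^ j)) (((\<lambda>x. x + frob n x) ^^ (2 ^ j)) x)"
    by (simp add: mult_2 funpow_add)
  also have "\<dots> = x + frob (2 * (n * 2 ^ j)) x"
    by (simp only: Suc frob_add frob_double) (simp add: algebra_simps)
  finally show ?case by (simp add: mult.left_commute)
qed simp

text \<open>
  For maximal \<open>U\<close> the form \<open>kappa\<close> has value 1 on all vectors of the fixed space outside \<open>U\<close>. So the radical of the fixed space
  exceeds \<open>U\<close> by at most one dimension, and the parity condition excludes this case. If \<open>frob n\<close> acted nontrivially on the
  orthogonal space modulo \<open>U\<close>, the last vector outside \<open>U\<close> in a sequence of iterates of \<open>1 + frob n\<close> would be fixed and in the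
  image of \<open>1 + frob n\<close>, hence orthogonal to the fixed space, and lie in that radical.
\<close>

lemma maximal_imp_unipotent_trivial:
  assumes gd: "admissible n U s" and mx: "\<forall>w\<in>frob_fixed n U. kappa w = 0 \<longrightarrow> w \<in> U" and Mn: "M = n * 2 ^ i"
  shows "frob_fixed n U = orth U"
proof -
  have l: "lift U s" and st: "\<And>u. u \<in> U \<Longrightarrow> u + frob n u \<in> U" using gd by (auto simp: admissible_def)
  obtain r where r: "card (frob_fixed n U) * card U = r\<^sup>2" using gd by (auto simp: admissible_def)
  note U = liftD(1)[OF l] and UW = liftD(2)[OF l]
  note P = frob_fixed_F2_space[OF l, of n] and H = orth_F2_space[OF UW]
  have PW: "frob_fixed n U \<subseteq> W" using orth_W by (auto simp: frob_fixed_def)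
  have UP: "U \<subseteq> frob_fixed n U" using lift_subset_orth[OF l] st by (auto simp: frob_fixed_def)
  note qP = quadratic_on_subset[OF kappa_quadratic PW]
  let ?rad = "polar_radical (frob_fixed n U) kappa"
  note rad = radical_F2_space[OF P qP]
  have "pair u p = 0" if "u \<in> U" "p \<in> frob_fixed n U" for u p
    using orth_pair[of p U u] that by (simp add: frob_fixed_def pair_commute)
  then have Urad: "U \<subseteq> ?rad"
    using UP by (auto simp: polar_radical_def)
  have rad_eq: "?rad = U"
  proof (rule ccontr)
    assume "?rad \<noteq> U"
    then obtain x0 where x0: "x0 \<in> ?rad" "x0 \<notin> U" using Urad by blast
    have k1: "kappa x = 1" if "x \<in> ?rad" "x \<notin> U" for x
      using mx that by (auto simp: polar_radical_def)
    have "card ?rad = 2 * card U"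
    proof (rule card_index_two[OF rad U Urad x0])
      fix x assume x: "x \<in> ?rad" "x \<notin> U"
      have "kappa (x + x0) = 0"
        using x x0 k1 by (simp add: quadratic_add[of kappa] polar_radical_def)
      moreover have "x + x0 \<in> frob_fixed n U"
        using F2_spaceD(3)[OF rad x(1) x0(1)] by (simp add: polar_radical_def)
      ultimately show "x + x0 \<in> U" using mx by blast
    qed
    moreover obtain t where "card (frob_fixed n U) * card ?rad = t\<^sup>2"
      using card_times_card_radical_square[OF P qP] by blast
    ultimately have "t\<^sup>2 = 2 * r\<^sup>2" using r by simp
    then have "r = 0" by (rule square_double_square)
    then show False using r F2_space_card_pos[OF P] F2_space_card_pos[OF U] by simp
  qed
  show ?thesis
  proof (rule ccontr)
    assume "frob_fixed n U \<noteq> orth U"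
    then obtain h where h: "h \<in> orth U" "h \<notin> frob_fixed n U" by (auto simp: frob_fixed_def)
    \<comment> \<open>\<open>D\<close> is nilpotent on \<open>W\<close>: its \<open>2^i\<close>-th power is \<open>1 + frob M\<close>, which is 0 there.\<close>
    define D where "D = (\<lambda>x. x + frob n x)"
    have fH: "frob n x \<in> orth U" if "x \<in> orth U" for x by (rule orth_frob[OF U UW st that])
    have DH: "D x \<in> orth U" if "x \<in> orth U" for x
      unfolding D_def by (rule F2_spaceD(3)[OF H that fH[OF that]])
    have DkH: "(D ^^ k) h \<in> orth U" for k by (induction k) (simp_all add: h(1) DH)
    have "frob M h = h" using W_F orth_W[OF h(1)] by (auto simp: GF2_def)
    then have "(D ^^ (2 ^ i)) h = 0" unfolding D_def funpow_add_frob by (simp add: Mn)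
    then have ex: "(D ^^ (2 ^ i)) h \<in> U" using F2_spaceD(2)[OF U] by simp
    define k where "k = (LEAST k. (D ^^ k) h \<in> U)"
    have kU: "(D ^^ k) h \<in> U" unfolding k_def by (rule LeastI[of _ "2 ^ i"]) (rule ex)
    have below: "(D ^^ j) h \<notin> U" if "j < k" for j using that not_less_Least unfolding k_def by blast
    have "k \<noteq> 0"
    proof
      assume "k = 0"
      then have "h \<in> U" using kU by simp
      then show False using h(2) UP by blast
    qed
    moreover have "k \<noteq> 1" using kU h by (auto simp: D_def frob_fixed_def)
    ultimately obtain j where k: "k = Suc (Suc j)" by (metis One_nat_def not0_implies_Suc)
    define y where "y = (D ^^ j) h"
    define z where "z = (D ^^ Suc j) h"
    have zy: "z = y + frob n y" and Dz: "z + frob n z \<in> U"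
      using kU by (simp_all add: z_def y_def k D_def)
    have zU: "z \<notin> U" using below[of "Suc j"] k by (simp add: z_def)
    have yH: "y \<in> orth U" unfolding y_def by (rule DkH)
    have "z \<in> orth U" unfolding z_def by (rule DkH)
    then have zP: "z \<in> frob_fixed n U" using Dz by (simp add: frob_fixed_def)
    have yW: "y \<in> W" "frob n y \<in> W" using orth_W[OF yH] by (simp_all add: W_frob)
    have "pair z p = 0" if p: "p \<in> frob_fixed n U" for p
    proof -
      have pH: "p + frob n p \<in> U" and pW: "p \<in> W" "frob n p \<in> W"
        using p PW by (auto simp: frob_fixed_def W_frob)
      have "pair z p = pair (frob n y) (frob n p) + pair (frob n y) p"
        unfolding zy pair_add(1)[OF yW pW(1)] by (simp only: kappa_polar_frob[OF yW(1) pW(1)])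
      also have "\<dots> = pair (frob n y) (p + frob n p)"
        by (simp add: pair_add(2)[OF pW yW(2)] add.commute)
      also have "\<dots> = 0" by (rule orth_pair[OF fH[OF yH] pH])
      finally show ?thesis .
    qed
    then have "z \<in> ?rad" using zP by (simp add: polar_radical_def)
    then show False using rad_eq zU by blast
  qed
qed

text \<open>
  The powers of \<open>frob n\<close> also act trivially on the lifts, up to the lift of \<open>U\<close>.
\<close>

lemma defect_iterate:
  assumes gd: "admissible n U s" and PH: "frob_fixed n U = orth U" and w: "w \<in> orth U"
  shows "w + frob (n * k) w \<in> U \<and> defect (n * k) s w = 0"
  using w
proof (induction k arbitrary: w)
  case 0
  have l: "lift U s" using gd by (simp add: admissible_def)
  then show ?case using F2_spaceD(2)[OF liftD(1)[OF l]] lift_0[OF l] by (simp add: defect_def tr_def)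
next
  case (Suc k)
  have l: "lift U s" and st: "\<And>u. u \<in> U \<Longrightarrow> u + frob n u \<in> U"
    and def0: "\<And>w. w \<in> orth U \<Longrightarrow> defect n s w = 0"
    using gd PH by (auto simp: admissible_def)
  have fw: "frob n w \<in> orth U" by (rule orth_frob[OF liftD(1,2)[OF l] st Suc.prems])
  define b where "b = w + frob n w"
  define c where "c = frob n w + frob (n * k) (frob n w)"
  have bU: "b \<in> U" using Suc.prems PH by (auto simp: b_def frob_fixed_def)
  have cU: "c \<in> U" and dc: "defect (n * k) s (frob n w) = 0"
    using Suc.IH[OF fw] by (simp_all add: c_def)
  have fb: "frob n w = w + b" by (simp add: b_def)
  have "frob (n * Suc k) w = frob (n * k) (frob n w)"
    unfolding frob_frob by (simp add: algebra_simps)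
  then have sum: "w + frob (n * Suc k) w = c + b"
    by (simp add: b_def c_def algebra_simps)
  have "tr (m * (n * Suc k)) (f w) = tr (m * n) (f w) + tr (m * (n * k)) (f (frob n w))"
    using tr_append[of "m * n" "m * (n * k)" "f w"] by (simp add: f_frob distrib_left)
  moreover have "tr (m * n) (f w) = s b + g b w"
    using def0[OF Suc.prems] by (simp add: defect_def b_def[symmetric] add_eq_0 add.assoc)
  moreover have "tr (m * (n * k)) (f (frob n w)) = s c + g c (frob n w)"
    using dc by (simp add: defect_def c_def[symmetric] add_eq_0 add.assoc)
  ultimately have "defect (n * Suc k) s w = 0"
    unfolding defect_def sum liftD(4)[OF l cU bU]
    by (simp add: fb g_add_left g_add_right algebra_simps)
  then show ?case using sum F2_spaceD(3)[OF liftD(1)[OF l] cU bU] by simp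
qed

text \<open>
  Let \<open>n' = M / 2\<close>. By \<open>defect_iterate\<close> the linear form \<open>q n'\<close> on \<open>W \<inter> F n'\<close> vanishes on the vectors orthogonal to \<open>U\<close>, so it is the
  pairing with some \<open>u\<close> in \<open>U\<close>. The form \<open>kappa w + pair w u = kappa (w + u)\<close> on \<open>W\<close> is zero on the image \<open>I\<close> of \<open>1 + frob n'\<close>, because \<open>q M\<close> is
  zero on \<open>W\<close>, and the orthogonal space of \<open>I\<close> is \<open>W \<inter> F n'\<close>. Hence its sum over \<open>W\<close> is the doubling formula for \<open>T M\<close>.
\<close>

theorem eps_split_of_nonzero:
  assumes n: "n > 0" and e: "eps n \<noteq> 0" and Mn: "M = n * 2 ^ Suc j"
  shows "eps M = -1"
proof -
  define n' where "n' = n * 2 ^ j"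
  have n'0: "n' > 0" using n by (simp add: n'_def)
  have M2: "M = 2 * n'" by (simp add: Mn n'_def mult.left_commute)
  obtain U s where gd: "admissible n U s" and mx: "\<forall>w\<in>frob_fixed n U. kappa w = 0 \<longrightarrow> w \<in> U"
    using admissible_maximal[OF n e] by blast
  have PH: "frob_fixed n U = orth U" by (rule maximal_imp_unipotent_trivial[OF gd mx Mn])
  have l: "lift U s" using gd by (simp add: admissible_def)
  note U = liftD(1)[OF l] and UW = liftD(2)[OF l]
  note Wn' = W_in_F2_space[OF n'0]
  have q_add: "additive_on (W_in n') (q n')"
  proof -
    have "polarisation (q n') x y = 0" if "x \<in> W_in n'" "y \<in> W_in n'" for x y
      using that unfolding q_radical[OF n'0, symmetric] polar_radical_def by blast
    then show ?thesis by (simp add: additive_on_def quadratic_add[of "q n'"])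
  qed
  have "\<exists>u\<in>U. \<forall>x\<in>W_in n'. q n' x = pair x u"
  proof (rule functional_eq_pairing[OF Wn' U _ _ q_add])
    show "additive_on (W_in n') (\<lambda>x. pair x u)" if "u \<in> U" for u
      by (rule additive_on_subset[OF polarisation_additive(2)[OF kappa_quadratic]]) (use that UW in auto)
    show "additive_on U (pair x)" if "x \<in> W_in n'" for x
      by (rule additive_on_subset[OF polarisation_additive(1)[OF kappa_quadratic] UW]) (use that in auto)
    fix x assume x: "x \<in> W_in n'" and "\<forall>u\<in>U. pair x u = 0"
    then have "x \<in> orth U" by (simp add: perp_def)
    then have "defect n' s x = 0" using defect_iterate[OF gd PH] by (simp add: n'_def)
    moreover have "frob n' x = x" using x by (simp add: GF2_def)
    ultimately have "tr (m * n') (f x) = 0" by (simp add: defect_def lift_0[OF l])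
    then show "q n' x = 0" by (simp add: q_def)
  qed
  then obtain u where u: "u \<in> U" and qu: "\<And>x. x \<in> W_in n' \<Longrightarrow> q n' x = pair x u" by blast
  have uW: "u \<in> W" using u UW by blast
  define k' where "k' w = kappa w + pair w u" for w
  have k'_shift: "k' w = kappa (w + u)" for w
    using lift_singular(2)[OF l u] by (simp add: k'_def quadratic_add[of kappa])
  have k'_pol: "polarisation k' x y = pair x y" if "x \<in> W" "y \<in> W" for x y
  proof -
    have "pair (x + y) u = pair x u + pair y u" by (rule pair_add(1)[OF that uW])
    then have "polarisation k' x y = (kappa (x + y) + kappa x + kappa y)
        + ((pair x u + pair x u) + (pair y u + pair y u))"
      by (simp add: polarisation_def[of k'] k'_def ac_simps del: bit_double bit_double_left)
    then show ?thesis by (simp add: polarisation_def)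
  qed
  have k'_quad: "quadratic_on W k'"
    unfolding quadratic_on_def additive_on_def
  proof (intro ballI)
    fix z x y assume *: "z \<in> W" "x \<in> W" "y \<in> W"
    then show "polarisation k' (x + y) z = polarisation k' x z + polarisation k' y z"
      by (simp add: k'_pol W_add pair_add(1))
  qed
  define I where "I = (\<lambda>w. w + frob n' w) ` W"
  have IW: "I \<subseteq> W" using W_add W_frob by (auto simp: I_def)
  have I_Wn: "I \<subseteq> W_in n'"
    using IW frob_add_self_closed[of _ n'] W_F by (auto simp: I_def M2)
  have I: "F2_space I"
    unfolding F2_space_def
  proof (intro conjI ballI)
    show "finite I" using card_W(1) by (simp add: I_def)
    show "0 \<in> I" unfolding I_def
      by (rule image_eqI[of _ _ 0]) (simp_all add: F2_spaceD(2)[OF W_F2_space] power_0_left)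
    fix x assume x: "x \<in> I"
    show "x + x = 0" by simp
    fix y assume y: "y \<in> I"
    obtain v w where vw: "v \<in> W" "w \<in> W" "x = v + frob n' v" "y = w + frob n' w"
      using x y by (auto simp: I_def)
    have "x + y = (v + w) + frob n' (v + w)" by (simp add: vw(3,4) frob_add algebra_simps)
    then show "x + y \<in> I" unfolding I_def using W_add[OF vw(1,2)] by blast
  qed
  have sing: "k' y = 0" if y: "y \<in> I" for y
  proof -
    obtain w where w: "w \<in> W" "y = w + frob n' w" using y by (auto simp: I_def)
    have "q M w = q n' y + kappa y"
      using q_doubled[of w n'] I_Wn y w W_F by (auto simp: M2)
    also have "q n' y = pair y u" by (rule qu) (use I_Wn y in blast)
    finally show ?thesis using q_M[OF w(1)] by (simp add: k'_def add.commute)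
  qed
  have perpI: "perp W k' I = W_in n'"
  proof (intro equalityI subsetI)
    fix x assume x: "x \<in> perp W k' I"
    then have xW: "x \<in> W" "frob n' x \<in> W" by (simp_all add: perp_def W_frob)
    have img: "frob n' ` W = W" by (rule frob_image_eq[OF card_W(1)]) (simp add: W_frob)
    have "x + frob n' x = 0"
    proof (rule pair_nondegenerate[OF W_add[OF xW]])
      fix y assume "y \<in> W"
      then obtain w where w: "w \<in> W" "y = frob n' w" using img by blast
      have fw: "frob n' w \<in> W" using w by (simp add: W_frob)
      have wI: "w + frob n' w \<in> I" using w by (simp add: I_def)
      then have "pair x (w + frob n' w) = 0"
        using x k'_pol[OF xW(1), of "w + frob n' w"] IW by (auto simp: perp_def)
      then have "pair x w = pair x (frob n' w)"
        by (simp add: pair_add(2)[OF w(1) fw xW(1)] bit_add_eq_0_iff)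
      then show "pair (x + frob n' x) y = 0"
        by (simp add: w(2) pair_add(1)[OF xW fw] kappa_polar_frob[OF xW(1) w(1)])
    qed
    then show "x \<in> W_in n'" using xW by (simp add: GF2_def add_eq_0)
  next
    fix x assume x: "x \<in> W_in n'"
    have fx: "frob n' x = x" and xW: "x \<in> W" using x by (simp_all add: GF2_def)
    have "polarisation k' x y = 0" if y: "y \<in> I" for y
    proof -
      obtain w where w: "w \<in> W" "y = w + frob n' w" using y by (auto simp: I_def)
      have fw: "frob n' w \<in> W" using w by (simp add: W_frob)
      have "pair x (frob n' w) = pair x w" using kappa_polar_frob[OF xW w(1), of n'] fx by simp
      then show ?thesis
        using k'_pol[OF xW] y IW by (auto simp: w(2) pair_add(2)[OF w(1) fw xW])
    qed
    then show "x \<in> perp W k' I" using xW by (simp add: perp_def)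
  qed
  have "T M = (\<Sum>w\<in>W_in n'. chi (q n' w + kappa w))"
    unfolding M2 by (rule T_double[OF n'0])
  also have "\<dots> = (\<Sum>w\<in>perp W k' I. chi (k' w))"
    unfolding perpI by (intro sum.cong refl) (simp add: k'_def qu add.commute)
  also have "\<dots> = (\<Sum>w\<in>W. chi (k' w))"
    by (rule sum_chi_singular_subspace[OF W_F2_space k'_quad I IW sing, symmetric])
  also have "\<dots> = (\<Sum>w\<in>W. chi (kappa w))"
    unfolding k'_shift using sum_translate[OF W_F2_space uW, of "\<lambda>w. chi (kappa w)"] .
  also have "\<dots> = - (2 ^ d)" by (rule sum_chi_kappa_W)
  finally have "T M = - (2 ^ d)" .
  then have "(eps M + 1) * 2 ^ d = 0" by (simp add: T_def rad_dim_M algebra_simps)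
  then show ?thesis by simp
qed

section \<open>The invariants in all degrees\<close>

text \<open>
  Multiplying \<open>gcd n M\<close> by the odd part of \<open>M / gcd n M\<close> keeps the invariant nonzero and leaves a power of 2 below \<open>M\<close>.
\<close>

lemma eps_zero_of_split:
  assumes n: "n > 0" and eM: "eps M = 1" and ev: "even (M div gcd n M)" and od: "odd (n div gcd n M)"
  shows "eps n = 0"
proof (rule ccontr)
  assume "eps n \<noteq> 0"
  let ?g = "gcd n M"
  have g0: "?g > 0" using n by simp
  have eg: "eps ?g \<noteq> 0" using \<open>eps n \<noteq> 0\<close> eps_odd_over_gcd[OF n od] by simp
  have "M div ?g \<noteq> 0" using M_pos by (simp add: dvd_div_eq_0_iff)
  then obtain t where t: "M div ?g = 2 ^ multiplicity 2 (M div ?g) * t" "odd t"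
    using multiplicity_decompose'[of "M div ?g" 2] by auto
  define j where "j = multiplicity 2 (M div ?g)"
  have jt: "M div ?g = 2 ^ j * t" "odd t" using t by (simp_all add: j_def)
  then have "j \<noteq> 0" using ev by (auto intro: ccontr)
  then obtain i where i: "j = Suc i" by (metis not0_implies_Suc)
  have "M = ?g * (M div ?g)" by simp
  then have "M = (?g * t) * 2 ^ Suc i" using jt(1) i by (simp only: mult.assoc mult.commute[of t])
  moreover have "eps (?g * t) \<noteq> 0" by (rule eps_neq_0_odd_multiple[OF g0 jt(2) eg])
  moreover have "?g * t > 0" using g0 jt(2) by (simp add: odd_pos)
  ultimately have "eps M = -1" using eps_split_of_nonzero by blast
  then show False using eM by simp
qed

lemma multiplicity_two_cases:
  assumes n: "n > 0"
  shows "multiplicity 2 n < multiplicity 2 M \<Longrightarrow> even (M div gcd n M) \<and> odd (n div gcd n M)"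
    and "multiplicity 2 n = multiplicity 2 M \<Longrightarrow> odd (n div gcd n M)"
    and "multiplicity 2 M < multiplicity 2 n \<Longrightarrow> odd_cofactor n \<and> even (n div gcd n M)"
proof -
  let ?g = "gcd n M"
  define s where "s = n div ?g"
  define t where "t = M div ?g"
  have ns: "n = ?g * s" and Mt: "M = ?g * t" by (simp_all add: s_def t_def)
  have g0: "?g \<noteq> 0" and s0: "s \<noteq> 0" and t0: "t \<noteq> 0" using n M_pos ns Mt by (auto intro: ccontr)
  have cop: "coprime s t" unfolding s_def t_def using n by (intro div_gcd_coprime) auto
  then have one: "odd s \<or> odd t" by (metis coprime_common_divisor_nat even_numeral odd_one)
  have "multiplicity 2 n = multiplicity 2 ?g + multiplicity 2 s"
    by (subst (1) ns) (use g0 s0 in \<open>simp add: prime_elem_multiplicity_mult_distrib\<close>)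
  moreover have "multiplicity 2 M = multiplicity 2 ?g + multiplicity 2 t"
    by (subst (1) Mt) (use g0 t0 in \<open>simp add: prime_elem_multiplicity_mult_distrib\<close>)
  moreover have "multiplicity 2 x = 0 \<longleftrightarrow> odd x" if "x \<noteq> 0" for x :: nat
    using that by (simp add: multiplicity_eq_zero_iff)
  ultimately show "multiplicity 2 n < multiplicity 2 M \<Longrightarrow> even (M div ?g) \<and> odd (n div ?g)"
    and "multiplicity 2 n = multiplicity 2 M \<Longrightarrow> odd (n div ?g)"
    and "multiplicity 2 M < multiplicity 2 n \<Longrightarrow> odd_cofactor n \<and> even (n div ?g)"
    using one s0 t0 n unfolding odd_cofactor_def s_def[symmetric] t_def[symmetric]
    by (metis add_less_cancel_left add_left_cancel less_numeral_extra(3) not_less_zero)+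
qed

theorem eps_of_anisotropic_split:
  assumes n: "n > 0" and eM: "eps M = -1"
  shows "eps n = eps (gcd n M)"
proof (cases "odd (n div gcd n M)")
  case True
  then show ?thesis by (rule eps_odd_over_gcd[OF n])
next
  case False
  then have ev: "even (n div gcd n M)" by simp
  have "coprime (n div gcd n M) (M div gcd n M)" using n by (intro div_gcd_coprime) auto
  then have "odd (M div gcd n M)" using ev by (metis coprime_common_divisor_nat even_numeral odd_one)
  then have "odd_cofactor n" using n by (simp add: odd_cofactor_def)
  from eps_even_over_gcd[OF this ev] show ?thesis by (simp add: eM)
qed

theorem eps_of_isotropic_split:
  assumes n: "n > 0" and eM: "eps M = 1"
  shows "multiplicity 2 n < multiplicity 2 M \<Longrightarrow> eps n = 0"
    and "multiplicity 2 n = multiplicity 2 M \<Longrightarrow> eps n = eps (gcd n M)"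
    and "multiplicity 2 M < multiplicity 2 n \<Longrightarrow> eps n = - eps (gcd n M)"
  using eps_zero_of_split[OF n eM] eps_odd_over_gcd[OF n] eps_even_over_gcd[of n] multiplicity_two_cases[OF n] eM
  by auto

end

text \<open>
  Forms are total functions, and \<open>q n\<close> is the form of the statement only on \<open>F n\<close>.
\<close>

lemma qf_epsilon_cong:
  assumes V: "F2_space V" and eq: "\<And>x. x \<in> V \<Longrightarrow> q x = q' x"
  shows "qf_epsilon s V q = qf_epsilon s V q'"
proof -
  have "polar_radical V q = polar_radical V q'"
    using F2_spaceD(3)[OF V] by (auto simp: polar_radical_def polarisation_def eq)
  moreover have "isometric_to_coord s V q k Q = isometric_to_coord s V q' k Q" for k Q
    by (simp add: isometric_to_coord_def eq cong: ball_cong)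
  moreover have "(\<exists>x\<in>polar_radical V q'. q x \<noteq> 0) = (\<exists>x\<in>polar_radical V q'. q' x \<noteq> 0)"
    by (rule bex_cong) (auto simp: polar_radical_def eq)
  ultimately show ?thesis by (simp only: qf_epsilon_def)
qed

theorem proposition4p1:
  fixes m d N :: nat
    and a :: "nat \<Rightarrow> 'a::alg_closed_field"
    and R f Rt :: "'a poly"
  assumes char2: "CHAR('a) = 2"
    and m: "m \<ge> 2" "even m"
    and d: "d \<ge> 1"
    and a: "\<And>i. i \<le> d \<Longrightarrow> a i \<in> GF2 m" "a d \<noteq> 0"
    and R: "R = (\<Sum>i=0..d. Polynomial.monom (a i) (2 ^ i))"
    and f: "f = Polynomial.monom 1 1 * R"
    and Rt: "Rt = (\<Sum>i=0..d. Polynomial.monom (a i ^ (2 ^ d)) (2 ^ (d + i))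
                           + Polynomial.monom (a i ^ (2 ^ (d - i))) (2 ^ (d - i)))"
    and N: "N \<ge> 1" "splitting_field_over (GF2 m) Rt = GF2 (m * N)"
  shows
    "(epsilon_n m f N = - 1 \<longrightarrow>
        (\<forall>n\<ge>1. epsilon_n m f n = epsilon_n m f (gcd n N))) \<and>
     (epsilon_n m f N = 1 \<longrightarrow>
        (\<forall>n\<ge>1.
           (v2 n \<le> v2 N - 1 \<longrightarrow> epsilon_n m f n = 0) \<and>
           (v2 n = v2 N \<longrightarrow> epsilon_n m f n = epsilon_n m f (gcd n N)) \<and>
           (v2 n \<ge> v2 N + 1 \<longrightarrow> epsilon_n m f n = - epsilon_n m f (gcd n N)))) \<and>
     (epsilon_n m f N = 0 \<longrightarrow>
        (epsilon_n m f (2 * N) = - 1 \<longrightarrow>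
           (\<forall>n\<ge>1. epsilon_n m f n = epsilon_n m f (gcd n (2 * N)))) \<and>
        (epsilon_n m f (2 * N) = 1 \<longrightarrow>
           (\<forall>n\<ge>1.
              (v2 n \<le> v2 N \<longrightarrow> epsilon_n m f n = 0) \<and>
              (v2 n = v2 N + 1 \<longrightarrow> epsilon_n m f n = epsilon_n m f (gcd n (2 * N))) \<and>
              (v2 n \<ge> v2 N + 2 \<longrightarrow> epsilon_n m f n = - epsilon_n m f (gcd n (2 * N))))))"
proof -
  interpret A: artin_schreier_form "TYPE('a)" m d a
    by standard (use assms in auto)
  have poly_f: "poly f x = A.f x" for x
    by (simp add: f R A.f_def A.R_def poly_sum poly_monom atLeast0AtMost)
  have poly_Rt: "poly Rt x = A.Rt x" for x
    by (simp add: Rt A.Rt_def poly_sum poly_monom atLeast0AtMost)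
  have eps: "epsilon_n m f n = A.eps n" if "n \<ge> 1" for n
    unfolding epsilon_n_def A.eps_def
    by (rule qf_epsilon_cong[OF A.F_F2_space])
       (use that in \<open>simp_all add: poly_f A.q_def A.GF2_trace_eq A.f_closed\<close>)
  have W_N: "A.W \<subseteq> GF2 (m * N)"
    unfolding N(2)[symmetric] splitting_field_over_def A.W_def
    by (auto simp: poly_Rt intro: generate_field.incl)
  have split: "split_form m d a M" if "M = N \<or> M = 2 * N" "A.eps M \<noteq> 0" for M
  proof unfold_locales
    show "M > 0" using that N(1) by auto
    show "A.W \<subseteq> GF2 (m * M)" using that(1) W_N A.F_double by blast
    show "A.eps M \<noteq> 0" by fact
  qed
  have gcd1: "gcd n M \<ge> 1" if "n \<ge> 1" for n M :: nat
    using that by (metis Suc_leI One_nat_def gcd_pos_nat not_one_le_zero neq0_conv)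
  have mult2N: "multiplicity 2 (2 * N) = Suc (multiplicity 2 N)"
    using N(1) by (simp add: multiplicity_times_same)
  have minus: "\<forall>n\<ge>1. epsilon_n m f n = epsilon_n m f (gcd n M)"
    if M: "M = N \<or> M = 2 * N" and e: "epsilon_n m f M = -1" for M
  proof (intro allI impI)
    fix n :: nat assume n: "n \<ge> 1"
    have eM: "A.eps M = -1" using e eps M N(1) by auto
    interpret B: split_form "TYPE('a)" m d a M by (rule split[OF M]) (simp add: eM)
    show "epsilon_n m f n = epsilon_n m f (gcd n M)"
      unfolding eps[OF n] eps[OF gcd1[OF n]]
      by (rule B.eps_of_anisotropic_split[OF _ eM]) (use n in simp)
  qed
  have plus: "(multiplicity 2 n < multiplicity 2 M \<longrightarrow> epsilon_n m f n = 0) \<and>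
      (multiplicity 2 n = multiplicity 2 M \<longrightarrow> epsilon_n m f n = epsilon_n m f (gcd n M)) \<and>
      (multiplicity 2 M < multiplicity 2 n \<longrightarrow> epsilon_n m f n = - epsilon_n m f (gcd n M))"
    if M: "M = N \<or> M = 2 * N" and e: "epsilon_n m f M = 1" and n: "n \<ge> 1" for M n
  proof -
    have eM: "A.eps M = 1" using e eps M N(1) by auto
    interpret B: split_form "TYPE('a)" m d a M by (rule split[OF M]) (simp add: eM)
    show ?thesis
      unfolding eps[OF n] eps[OF gcd1[OF n]]
      using B.eps_of_isotropic_split[OF _ eM, of n] n by simp
  qed
  show ?thesis
  proof (intro conjI impI)
    assume "epsilon_n m f N = -1"
    then show "\<forall>n\<ge>1. epsilon_n m f n = epsilon_n m f (gcd n N)" by (rule minus[OF disjI1[OF refl]])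
  next
    assume e: "epsilon_n m f N = 1"
    show "\<forall>n\<ge>1.
           (v2 n \<le> v2 N - 1 \<longrightarrow> epsilon_n m f n = 0) \<and>
           (v2 n = v2 N \<longrightarrow> epsilon_n m f n = epsilon_n m f (gcd n N)) \<and>
           (v2 n \<ge> v2 N + 1 \<longrightarrow> epsilon_n m f n = - epsilon_n m f (gcd n N))"
      (is "\<forall>n\<ge>1. ?thesis1 n")
    proof (rule allI, rule impI)
      fix n :: nat assume "n \<ge> 1"
      from plus[OF disjI1[OF refl] e this] show "?thesis1 n" by auto
    qed
  next
    assume "epsilon_n m f (2 * N) = -1"
    then show "\<forall>n\<ge>1. epsilon_n m f n = epsilon_n m f (gcd n (2 * N))" by (rule minus[OF disjI2[OF refl]])
  next
    assume e: "epsilon_n m f (2 * N) = 1"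
    show "\<forall>n\<ge>1.
              (v2 n \<le> v2 N \<longrightarrow> epsilon_n m f n = 0) \<and>
              (v2 n = v2 N + 1 \<longrightarrow> epsilon_n m f n = epsilon_n m f (gcd n (2 * N))) \<and>
              (v2 n \<ge> v2 N + 2 \<longrightarrow> epsilon_n m f n = - epsilon_n m f (gcd n (2 * N)))"
      (is "\<forall>n\<ge>1. ?thesis2 n")
    proof (rule allI, rule impI)
      fix n :: nat assume "n \<ge> 1"
      from plus[OF disjI2[OF refl] e this, unfolded mult2N] show "?thesis2 n" by auto
    qed
  qed
qed

end
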